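(* Let $n\ge 1$, let $\delta_n=(n,n-1,\ldots,2,1)$, and let $\mu$ be any partition (possibly empty) whose diagram is contained in that of $\delta_n$. Then the skew Schur function $s_{\delta_n/\mu}$ is a nonnegative linear combination of Schur $P$-functions. More precisely, $$ s_{\delta_n/\mu}=\sum_{U\in \mathsf{CompShSYT}(\delta_n/\mu)} P_{\operatorname{sh}(U)},$$ where $\mathsf{CompShSYT}(\delta_n/\mu)$ is the set of shifted standard Young tableaux (of size $|\delta_n|-|\mu|$) which are $\delta_n/\mu$-compatible, and $\operatorname{sh}(U)$ denotes the shifted shape (a strict partition) of $U$.
   Context: Diagrams use English (matrix) notation: rows are numbered top to bottom, columns left to right. The diagram of a partition $\lambda=(\lambda_1\ge\cdots\ge\lambda_l>0)$ has $\lambda_i$ cells in row $i$, left justified; its size is $|\lambda|=\lambda_1+\cdots+\lambda_l$. For a strict partition $\lambda_1>\cdots>\lambda_l>0$, the shifted diagram (shifted shape) has $\lambda_i$ cells in row $i$, with row $i$ shifted $i-1$ units to the right (so row $i$ occupies columns $i,\ldots,i+\lambda_i-1$). A skew shape $\lambda/\mu$ is obtained by removing the diagram of $\mu$ from the diagram of $\lambda\supseteq\mu$. Skew Schur functions: a semistandard Young tableau of shape $\lambda/\mu$ is a filling of its cells by positive integers, weakly increasing along rows and strictly increasing down columns; $s_{\lambda/\mu}=\sum_T x^T$ over all such $T$, where $x^T=\prod_i x_i^{a_i}$ and $a_i$ is the number of entries equal to $i$. Schur $P$-functions: for a strict partition $\lambda$, a shifted semistandard Young tableau of shape $\lambda$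 is a filling of the shifted diagram of $\lambda$ by letters of the alphabet $1'<1<2'<2<\cdots$ such that rows and columns are weakly increasing, each unprimed $k$ appears at most once in every column, each primed $k'$ appears at most once in every row, and there are no primed entries on the main diagonal (the first cells of the rows). $P_\lambda=\sum_T x^T$ over all such $T$, where $x^T=\prod_i x_i^{a_i}$ and $a_i$ is the number of entries equal to $i$ or $i'$. A shifted standard Young tableau (shifted SYT) of shifted shape $\lambda$ is a filling of the shifted diagram by the (unprimed) letters $1,2,\ldots,|\lambda|$, each exactly once, with rows and columns increasing. In a shifted SYT $U$, for entries $i<j$: the pair $(i,j)$ is an ascent if $j$ is located weakly north and strictly east of $i$; it is a descent if $j$ is located strictly south and weakly west of $i$ (positions are taken in the shifted diagram). An entry $i$ is called an ascent (descent) if the pair $(i,i+1)$ is an ascent (descent). Standard filling: for a skew shape $\lambda/\mu$ of size $N$, $T_{\lambda/\mu}$ is the filling of its cells with $1,2,\ldots,N$ in order, starting from the bottom row and moving up, each row being filled from left to right. A shifted SYT $U$ of size $|\lambda|-|\mu|$ is $\lambda/\mu$-compatible if: (i) whenever $i$ and $i+1$ occupy horizontally adjacent cells of a row of $T_{\lambda/\mu}$ ($i$ immediately to the left of $i+1$), $i$ is a descent in $U$; and (ii) whenever the cell of $T_{\lambda/\mu}$ containing $j$ is directly above (in the same column and adjacent to) the cell containing $i$, the pair $(i,j)$ is an ascent in $U$. *)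

theory Defs
  imports Main "HOL-Library.FuncSet" "HOL-Library.Multiset" "HOL-Library.Function_Algebras"
begin

section \<open>Partitions and diagrams\<close>

text \<open>
  A partition is the list of its (positive) parts. Cells are pairs (row, column), rows growing
  downwards. Both coordinates start at 0, following list indexing.
\<close>

type_synonym cell = "nat \<times> nat"

definition is_partition :: "nat list \<Rightarrow> bool" where
  "is_partition l \<longleftrightarrow> sorted_wrt (\<ge>) l \<and> 0 \<notin> set l"

definition strict_partition :: "nat list \<Rightarrow> bool" where
  "strict_partition l \<longleftrightarrow> sorted_wrt (>) l \<and> 0 \<notin> set l"

definition diagram :: "nat list \<Rightarrow> cell set" where
  "diagram l = {(r, c). r < length l \<and> c < l ! r}"

definition shifted_diagram :: "nat list \<Rightarrow> cell set" where
  "shifted_diagram l = {(r, c). r < length l \<and> r \<le> c \<and> c < r + l ! r}"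

definition skew_diagram :: "nat list \<Rightarrow> nat list \<Rightarrow> cell set" where
  "skew_diagram l \<mu> = diagram l - diagram \<mu>"

definition staircase :: "nat \<Rightarrow> nat list" where
  "staircase n = rev [1..<Suc n]"


section \<open>Formal power series in infinitely many variables\<close>

text \<open>
  A monomial in \<open>x\<^sub>1, x\<^sub>2, \<dots>\<close> is the multiset of the indices of its variables, and a formal
  power series is its coefficient function. Sums of power series are the pointwise sums of
  \<^theory>\<open>HOL-Library.Function_Algebras\<close>.
\<close>

type_synonym monomial = "nat multiset"
type_synonym power_series = "monomial \<Rightarrow> int"

text \<open>
  The series \<open>\<Sum>T\<in>A. w T\<close>, for a possibly infinite set \<open>A\<close> with finite fibres of the
  weight \<open>w\<close>; the fibres are shown to be finite in the two uses below.
\<close>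

definition generating_series :: "'a set \<Rightarrow> ('a \<Rightarrow> monomial) \<Rightarrow> power_series" where
  "generating_series A w = (\<lambda>m. int (card {T \<in> A. w T = m}))"


section \<open>Skew Schur functions\<close>

text \<open>Fillings of a set of cells are made unique by being \<^const>\<open>undefined\<close> outside of it.\<close>

definition SSYT :: "nat list \<Rightarrow> nat list \<Rightarrow> (cell \<Rightarrow> nat) set" where
  "SSYT l \<mu> = {T \<in> skew_diagram l \<mu> \<rightarrow>\<^sub>E {1..}.
     (\<forall>r c c'. (r, c) \<in> skew_diagram l \<mu> \<and> (r, c') \<in> skew_diagram l \<mu> \<and> c < c'
        \<longrightarrow> T (r, c) \<le> T (r, c')) \<and>
     (\<forall>r r' c. (r, c) \<in> skew_diagram l \<mu> \<and> (r', c) \<in> skew_diagram l \<mu> \<and> r < r'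
        \<longrightarrow> T (r, c) < T (r', c))}"

definition skew_schur :: "nat list \<Rightarrow> nat list \<Rightarrow> power_series" where
  "skew_schur l \<mu> =
     generating_series (SSYT l \<mu>) (\<lambda>T. image_mset T (mset_set (skew_diagram l \<mu>)))"


section \<open>Schur P-functions\<close>

datatype letter = Primed nat | Unprimed nat

fun letter_index :: "letter \<Rightarrow> nat" where
  "letter_index (Primed k) = k"
| "letter_index (Unprimed k) = k"

text \<open>The order \<open>1' < 1 < 2' < 2 < \<dots>\<close>:\<close>

fun letter_le :: "letter \<Rightarrow> letter \<Rightarrow> bool" where
  "letter_le (Primed j) (Primed k) \<longleftrightarrow> j \<le> k"
| "letter_le (Primed j) (Unprimed k) \<longleftrightarrow> j \<le> k"
| "letter_le (Unprimed j) (Primed k) \<longleftrightarrow> j < k"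
| "letter_le (Unprimed j) (Unprimed k) \<longleftrightarrow> j \<le> k"

definition shifted_SSYT :: "nat list \<Rightarrow> (cell \<Rightarrow> letter) set" where
  "shifted_SSYT l = {T \<in> shifted_diagram l \<rightarrow>\<^sub>E {a. 1 \<le> letter_index a}.
     (\<forall>r c c'. (r, c) \<in> shifted_diagram l \<and> (r, c') \<in> shifted_diagram l \<and> c < c'
        \<longrightarrow> letter_le (T (r, c)) (T (r, c'))) \<and>
     (\<forall>r r' c. (r, c) \<in> shifted_diagram l \<and> (r', c) \<in> shifted_diagram l \<and> r < r'
        \<longrightarrow> letter_le (T (r, c)) (T (r', c))) \<and>
     (\<forall>r r' c k. (r, c) \<in> shifted_diagram l \<and> (r', c) \<in> shifted_diagram l
        \<and> T (r, c) = Unprimed k \<and> T (r', c) = Unprimed k \<longrightarrow> r = r') \<and>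
     (\<forall>r c c' k. (r, c) \<in> shifted_diagram l \<and> (r, c') \<in> shifted_diagram l
        \<and> T (r, c) = Primed k \<and> T (r, c') = Primed k \<longrightarrow> c = c') \<and>
     (\<forall>r k. (r, r) \<in> shifted_diagram l \<longrightarrow> T (r, r) \<noteq> Primed k)}"

definition schur_P :: "nat list \<Rightarrow> power_series" where
  "schur_P l = generating_series (shifted_SSYT l)
     (\<lambda>T. image_mset (\<lambda>x. letter_index (T x)) (mset_set (shifted_diagram l)))"

definition schur_P_nonneg :: "power_series \<Rightarrow> bool" where
  "schur_P_nonneg f \<longleftrightarrow> (\<exists>S a. finite S \<and>
     (\<forall>l\<in>S. strict_partition l \<and> (0::int) \<le> a l) \<and> f = (\<Sum>l\<in>S. (\<lambda>m. a l * schur_P l m)))"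


section \<open>Compatible shifted standard tableaux\<close>

definition shifted_SYT :: "nat list \<Rightarrow> (cell \<Rightarrow> nat) set" where
  "shifted_SYT l = {U \<in> extensional (shifted_diagram l).
     bij_betw U (shifted_diagram l) {1..sum_list l} \<and>
     (\<forall>r c c'. (r, c) \<in> shifted_diagram l \<and> (r, c') \<in> shifted_diagram l \<and> c < c'
        \<longrightarrow> U (r, c) < U (r, c')) \<and>
     (\<forall>r r' c. (r, c) \<in> shifted_diagram l \<and> (r', c) \<in> shifted_diagram l \<and> r < r'
        \<longrightarrow> U (r, c) < U (r', c))}"

definition ascent_pair :: "nat list \<Rightarrow> (cell \<Rightarrow> nat) \<Rightarrow> nat \<Rightarrow> nat \<Rightarrow> bool" where
  "ascent_pair l U i j \<longleftrightarrow> i < j \<and> (\<exists>r c r' c'.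
     (r, c) \<in> shifted_diagram l \<and> U (r, c) = i \<and>
     (r', c') \<in> shifted_diagram l \<and> U (r', c') = j \<and> r' \<le> r \<and> c < c')"

definition descent_pair :: "nat list \<Rightarrow> (cell \<Rightarrow> nat) \<Rightarrow> nat \<Rightarrow> nat \<Rightarrow> bool" where
  "descent_pair l U i j \<longleftrightarrow> i < j \<and> (\<exists>r c r' c'.
     (r, c) \<in> shifted_diagram l \<and> U (r, c) = i \<and>
     (r', c') \<in> shifted_diagram l \<and> U (r', c') = j \<and> r < r' \<and> c' \<le> c)"

definition descent :: "nat list \<Rightarrow> (cell \<Rightarrow> nat) \<Rightarrow> nat \<Rightarrow> bool" where
  "descent l U i \<longleftrightarrow> descent_pair l U i (i + 1)"

text \<open>
  The entry of a cell is its position in the reading order: it counts the cells in lower rows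
  and those weakly to the left in the same row.
\<close>

definition standard_filling :: "nat list \<Rightarrow> nat list \<Rightarrow> cell \<Rightarrow> nat" where
  "standard_filling l \<mu> = (\<lambda>(r, c).
     card {(r', c') \<in> skew_diagram l \<mu>. r < r' \<or> r' = r \<and> c' \<le> c})"

definition compatible ::
    "nat list \<Rightarrow> nat list \<Rightarrow> nat list \<Rightarrow> (cell \<Rightarrow> nat) \<Rightarrow> bool" where
  "compatible l \<mu> \<nu> U \<longleftrightarrow>
     (\<forall>i r c. (r, c) \<in> skew_diagram l \<mu> \<and> (r, c + 1) \<in> skew_diagram l \<mu> \<and>
        standard_filling l \<mu> (r, c) = i \<and> standard_filling l \<mu> (r, c + 1) = i + 1
        \<longrightarrow> descent \<nu> U i) \<and>
     (\<forall>i j r c. (r, c) \<in> skew_diagram l \<mu> \<and> (r + 1, c) \<in> skew_diagram l \<mu> \<and>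
        standard_filling l \<mu> (r, c) = j \<and> standard_filling l \<mu> (r + 1, c) = i
        \<longrightarrow> ascent_pair \<nu> U i j)"

text \<open>A shifted standard tableau is paired with its shape.\<close>

definition CompShSYT :: "nat list \<Rightarrow> nat list \<Rightarrow> (nat list \<times> (cell \<Rightarrow> nat)) set" where
  "CompShSYT l \<mu> = {(\<nu>, U). strict_partition \<nu> \<and> sum_list \<nu> = sum_list l - sum_list \<mu> \<and>
     U \<in> shifted_SYT \<nu> \<and> compatible l \<mu> \<nu> U}"


section \<open>Finiteness\<close>

text \<open>
  The cardinalities and the sum over \<^const>\<open>CompShSYT\<close> thus have their intended meaning.
\<close>

lemma finite_diagram: "finite (diagram l)"
proof -
  have "diagram l = (SIGMA r:{..<length l}. {..<l ! r})"
    by (auto simp: diagram_def)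
  then show ?thesis by simp
qed

lemma finite_skew_diagram: "finite (skew_diagram l \<mu>)"
  by (simp add: skew_diagram_def finite_diagram)

lemma finite_shifted_diagram: "finite (shifted_diagram l)"
proof -
  have "shifted_diagram l = (SIGMA r:{..<length l}. {r..<r + l ! r})"
    by (auto simp: shifted_diagram_def)
  then show ?thesis by simp
qed

lemma finite_SSYT_fibre:
  "finite {T \<in> SSYT l \<mu>. image_mset T (mset_set (skew_diagram l \<mu>)) = x}"
proof (rule finite_subset)
  show "{T \<in> SSYT l \<mu>. image_mset T (mset_set (skew_diagram l \<mu>)) = x}
      \<subseteq> skew_diagram l \<mu> \<rightarrow>\<^sub>E set_mset x"
    using finite_skew_diagram[of l \<mu>]
    by (auto simp: SSYT_def PiE_iff intro: extensional_arb)
  show "finite (skew_diagram l \<mu> \<rightarrow>\<^sub>E set_mset x)"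
    by (intro finite_PiE finite_skew_diagram) simp
qed

lemma finite_shifted_SSYT_fibre:
  "finite {T \<in> shifted_SSYT l.
     image_mset (\<lambda>y. letter_index (T y)) (mset_set (shifted_diagram l)) = x}"
proof (rule finite_subset)
  let ?L = "Primed ` set_mset x \<union> Unprimed ` set_mset x"
  have L: "a \<in> ?L" if "letter_index a \<in># x" for a
    using that by (cases a) auto
  show "{T \<in> shifted_SSYT l.
      image_mset (\<lambda>y. letter_index (T y)) (mset_set (shifted_diagram l)) = x}
      \<subseteq> shifted_diagram l \<rightarrow>\<^sub>E ?L"
  proof
    fix T assume T: "T \<in> {T \<in> shifted_SSYT l.
      image_mset (\<lambda>y. letter_index (T y)) (mset_set (shifted_diagram l)) = x}"
    then have "letter_index (T y) \<in># x" if "y \<in> shifted_diagram l" for y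
      using finite_shifted_diagram[of l] that by auto
    then have "T y \<in> ?L" if "y \<in> shifted_diagram l" for y
      using that L by blast
    then show "T \<in> shifted_diagram l \<rightarrow>\<^sub>E ?L"
      using T unfolding shifted_SSYT_def PiE_iff by blast
  qed
  show "finite (shifted_diagram l \<rightarrow>\<^sub>E ?L)"
    by (intro finite_PiE finite_shifted_diagram) simp
qed

lemma finite_shifted_SYT: "finite (shifted_SYT l)"
proof (rule finite_subset)
  show "shifted_SYT l \<subseteq> shifted_diagram l \<rightarrow>\<^sub>E {1..sum_list l}"
    by (rule subsetI, unfold shifted_SYT_def PiE_iff mem_Collect_eq)
       (metis bij_betw_apply)
  show "finite (shifted_diagram l \<rightarrow>\<^sub>E {1..sum_list l})"
    by (intro finite_PiE finite_shifted_diagram) simp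
qed

lemma finite_CompShSYT: "finite (CompShSYT l \<mu>)"
proof (rule finite_subset)
  let ?N = "sum_list l - sum_list \<mu>"
  let ?K = "{k. set k \<subseteq> {..?N} \<and> length k \<le> ?N}"
  have len: "0 \<notin> set k \<Longrightarrow> length k \<le> sum_list k" for k :: "nat list"
    by (induction k) auto
  show "CompShSYT l \<mu> \<subseteq> (SIGMA k:?K. shifted_SYT k)"
    using len member_le_sum_list by (fastforce simp: CompShSYT_def strict_partition_def)
  show "finite (SIGMA k:?K. shifted_SYT k)"
    by (intro finite_SigmaI finite_lists_length_le finite_shifted_SYT) simp
qed

end

theory Submission
  imports Defs
begin

text \<open>
  Reading the row of \<open>\<delta>\<^sub>n/\<mu>\<close> with index \<open>n - k\<close> as block \<open>k\<close>, a compatible tableau \<open>U\<close> becomes the chain of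
  strict shapes \<open>Y 0 \<subseteq> Y 1 \<subseteq> \<dots>\<close> occupied by the entries of its first \<open>k\<close> blocks. Compatibility along
  rows makes each \<open>Y (k + 1) / Y k\<close> a vertical strip; compatibility along columns says that for every \<open>s\<close>
  the number of cells of \<open>Y k\<close> in the rows \<open>\<ge> s\<close> is concave in \<open>k\<close> up to 1, and this is equivalent to a
  similar condition on columns. A box is inserted into a chain at a given block as in Sagan--Worley
  insertion: it moves down the rows as \<open>k\<close> grows and turns into column insertion at the diagonal. Row moves
  preserve the row condition and column moves the column condition, so the result is again a chain.

  Inserting boxes at weakly decreasing blocks adds a horizontal strip to the block sizes and a strip of
  primed and unprimed copies of one letter to the final shape, and this is a bijection. Hence
  \<open>\<Sum>\<^sub>U P\<^bsub>sh(U)\<^esub>\<close> satisfies the recursion that removes one letter at a time from semistandard fillings of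
  \<open>\<delta>\<^sub>n/\<mu>\<close>, except that the letters are removed in the opposite order. The order is irrelevant, by
  the Bender--Knuth involution on pairs of horizontal strips.
\<close>

text \<open>Inside a block the entries of \<open>U\<close> increase strictly downwards, one per row.
  A block is therefore determined by the set of rows that it meets, and the chain \<open>Y\<close>
  loses no information. Enlarging block \<open>k\<close> adds a cell at the left end of a row of the
  skew shape, so every shape from \<open>Y k\<close> on has to gain exactly one box. The obstacle is
  a run of rows that all grow in one step and that reaches down to an empty row: a box in row mode
  then has no row to drop to. Concavity, with its slack of 1, excludes such runs, apart from a box
  on the diagonal, and there the insertion turns to columns. A row move is controlled by tail sums
  and a column move by left sums. Strictness of the shapes translates between the two, so each
  triple of consecutive shapes can be treated in the form that suits its middle box. The letters
  come off in opposite orders because the left ends of the skew rows carry the smallest letter,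
  whereas the outer rim of a shifted filling carries the largest.\<close>

section \<open>Strict shapes and concavity\<close>

text \<open>Shapes are given by their row lengths, row \<open>u\<close> starting in column \<open>u\<close>; hence
  \<open>min (v u) (c - u)\<close> below counts the cells of row \<open>u\<close> in the columns \<open>< c\<close>.\<close>

definition strict_shape :: "(nat \<Rightarrow> nat) \<Rightarrow> bool" where
  "strict_shape v \<longleftrightarrow> (\<forall>s. v (Suc s) < v s \<or> v (Suc s) = 0)"

definition add_box :: "(nat \<Rightarrow> nat) \<Rightarrow> nat \<Rightarrow> nat \<Rightarrow> nat" where
  "add_box v t = v(t := Suc (v t))"

definition vstrip :: "(nat \<Rightarrow> nat) \<Rightarrow> (nat \<Rightarrow> nat) \<Rightarrow> bool" where
  "vstrip v w \<longleftrightarrow> (\<forall>u. w u = v u \<or> w u = Suc (v u))"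

definition tail_cells :: "nat \<Rightarrow> (nat \<Rightarrow> nat) \<Rightarrow> nat \<Rightarrow> nat" where
  "tail_cells M v s = (\<Sum>u\<in>{s..<M}. v u)"

definition left_cells :: "nat \<Rightarrow> (nat \<Rightarrow> nat) \<Rightarrow> nat \<Rightarrow> nat" where
  "left_cells M v c = (\<Sum>u<M. min (v u) (c - u))"

text \<open>For consecutive vertical strips this bounds the surplus of the second over the first in
  the lower rows. The slack 1 comes from the staircase, whose neighbouring rows differ by one; in
  the additive form an added box changes each term by 0 or 1.\<close>

definition row_concave :: "nat \<Rightarrow> (nat \<Rightarrow> nat) \<Rightarrow> (nat \<Rightarrow> nat) \<Rightarrow> (nat \<Rightarrow> nat) \<Rightarrow> bool" where
  "row_concave M v0 v1 v2 \<longleftrightarrow>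
     (\<forall>s. tail_cells M v2 s + tail_cells M v0 s \<le> 2 * tail_cells M v1 s + 1)"

text \<open>The column version is offset by one: cells of the second strip in the columns
  \<open>\<le> c\<close> are weighed against cells of the first in the columns
  \<open>< c\<close>.\<close>

definition col_concave :: "nat \<Rightarrow> (nat \<Rightarrow> nat) \<Rightarrow> (nat \<Rightarrow> nat) \<Rightarrow> (nat \<Rightarrow> nat) \<Rightarrow> bool" where
  "col_concave M v0 v1 v2 \<longleftrightarrow> (\<forall>c. left_cells M v2 (Suc c) + left_cells M v0 c
     \<le> left_cells M v1 (Suc c) + left_cells M v1 c + 1)"

section \<open>Elementary facts on strict shapes and cell counts\<close>

lemma strict_shape_less:
  assumes "strict_shape v" "u < s" "0 < v s"
  shows "s + v s \<le> u + v u" "v s < v u"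
proof -
  have "s + v s \<le> u + v u \<and> v s < v u"
    using assms(2,3)
  proof (induction s)
    case (Suc s)
    have "v (Suc s) < v s"
      using assms(1) Suc.prems unfolding strict_shape_def by (metis less_numeral_extra(3))
    moreover have "u = s \<or> u < s" using Suc.prems by auto
    ultimately show ?case using Suc.IH by auto
  qed simp
  then show "s + v s \<le> u + v u" "v s < v u" by auto
qed

lemma strict_shape_le:
  assumes "strict_shape v" "u \<le> s" "0 < v s"
  shows "s + v s \<le> u + v u"
  using strict_shape_less[OF assms(1), of u s] assms by (cases "u = s") auto

lemma strict_shape_zero:
  assumes "strict_shape v" "u \<le> s" "v u = 0"
  shows "v s = 0"
  using strict_shape_less(2)[OF assms(1), of u s] assms by (cases "u = s") auto

lemma strict_add_box:
  assumes "strict_shape v" "0 < t \<Longrightarrow> Suc (v t) < v (t - 1)"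
  shows "strict_shape (add_box v t)"
  unfolding strict_shape_def
proof
  fix s
  show "add_box v t (Suc s) < add_box v t s \<or> add_box v t (Suc s) = 0"
    using assms(2) assms(1)[unfolded strict_shape_def, rule_format, of s]
    by (auto simp: add_box_def)
qed

lemma strict_add_boxD:
  assumes "strict_shape (add_box v t)" "u < t"
  shows "Suc (v t) < v u" "t + v t < u + v u"
  using strict_shape_less[OF assms(1), of u t] assms(2) by (auto simp: add_box_def)

lemma strict_remove_box:
  assumes "strict_shape (add_box v t)" "v (Suc t) < v t \<or> v (Suc t) = 0"
  shows "strict_shape v"
  unfolding strict_shape_def
proof
  fix s
  show "v (Suc s) < v s \<or> v (Suc s) = 0"
    using assms(2) assms(1)[unfolded strict_shape_def, rule_format, of s]
    by (auto simp: add_box_def split: if_splits)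
qed

lemma add_box_inj: "add_box v t = add_box w t \<Longrightarrow> v = w"
  by (rule ext) (metis add_box_def fun_upd_apply nat.inject)

lemma tail_add_box:
  assumes "t < M"
  shows "tail_cells M (add_box v t) s = tail_cells M v s + (if s \<le> t then 1 else 0)"
proof (cases "s \<le> t")
  case True
  then have t: "t \<in> {s..<M}" using assms by auto
  show ?thesis
    unfolding tail_cells_def add_box_def
    using True by (auto simp: sum.remove[OF _ t] intro!: sum.cong)
next
  case False
  then show ?thesis unfolding tail_cells_def add_box_def by (auto intro!: sum.cong)
qed

lemma left_add_box:
  assumes "t < M"
  shows "left_cells M (add_box v t) c = left_cells M v c + (if t + v t < c then 1 else 0)"
proof -
  have t: "t \<in> {..<M}" using assms by auto
  have "(\<Sum>u\<in>{..<M}-{t}. min ((v(t := Suc (v t))) u) (c - u)) = (\<Sum>u\<in>{..<M}-{t}. min (v u) (c - u))"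
    by (rule sum.cong) auto
  then show ?thesis
    unfolding left_cells_def add_box_def sum.remove[OF finite_lessThan t]
    by (auto simp: min_def)
qed

lemma tail_split:
  assumes "s \<le> t" "t \<le> M"
  shows "tail_cells M v s = (\<Sum>u\<in>{s..<t}. v u) + tail_cells M v t"
  unfolding tail_cells_def using assms by (simp add: sum.atLeastLessThan_concat)

lemma tail_vstrip:
  assumes "vstrip v w"
  shows "tail_cells M w s = tail_cells M v s + card {u\<in>{..<M}. w u = Suc (v u) \<and> s \<le> u}"
proof -
  have "tail_cells M w s = (\<Sum>u\<in>{s..<M}. v u + (if w u = Suc (v u) then 1 else 0))"
    unfolding tail_cells_def using assms unfolding vstrip_def
    by (intro sum.cong refl) (metis Suc_eq_plus1 add.right_neutral n_not_Suc_n)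
  also have "\<dots> = tail_cells M v s + (\<Sum>u\<in>{s..<M}. if w u = Suc (v u) then 1 else 0)"
    unfolding tail_cells_def by (rule sum.distrib)
  also have "(\<Sum>u\<in>{s..<M}. if w u = Suc (v u) then 1 else 0) = card {u\<in>{s..<M}. w u = Suc (v u)}"
    by (simp add: sum.If_cases Int_def)
  also have "{u\<in>{s..<M}. w u = Suc (v u)} = {u\<in>{..<M}. w u = Suc (v u) \<and> s \<le> u}" by auto
  finally show ?thesis .
qed

lemma left_vstrip:
  assumes "vstrip v w"
  shows "left_cells M w c = left_cells M v c + card {u\<in>{..<M}. w u = Suc (v u) \<and> u + v u < c}"
proof -
  have "left_cells M w c = (\<Sum>u<M. min (v u) (c - u) + (if w u = Suc (v u) \<and> u + v u < c then 1 else 0))"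
    unfolding left_cells_def
  proof (intro sum.cong refl)
    fix u
    show "min (w u) (c - u) = min (v u) (c - u) + (if w u = Suc (v u) \<and> u + v u < c then 1 else 0)"
      using assms[unfolded vstrip_def, rule_format, of u] by (auto simp: min_def)
  qed
  also have "\<dots> = left_cells M v c + (\<Sum>u<M. if w u = Suc (v u) \<and> u + v u < c then 1 else 0)"
    unfolding left_cells_def by (rule sum.distrib)
  also have "(\<Sum>u<M. if w u = Suc (v u) \<and> u + v u < c then 1 else 0)
      = card {u\<in>{..<M}. w u = Suc (v u) \<and> u + v u < c}"
    by (simp add: sum.If_cases Int_def)
  finally show ?thesis .
qed

section \<open>Equivalence of the row and the column condition\<close>

lemma row_concave_iff_card:
  assumes "vstrip v0 v1" "vstrip v1 v2"
  shows "row_concave M v0 v1 v2 \<longleftrightarrow> (\<forall>s. card {u\<in>{..<M}. v2 u = Suc (v1 u) \<and> s \<le> u}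
    \<le> Suc (card {u\<in>{..<M}. v1 u = Suc (v0 u) \<and> s \<le> u}))"
  unfolding row_concave_def tail_vstrip[OF assms(1)] tail_vstrip[OF assms(2)] by simp

lemma col_concave_iff_card:
  assumes "vstrip v0 v1" "vstrip v1 v2"
  shows "col_concave M v0 v1 v2 \<longleftrightarrow> (\<forall>c. card {u\<in>{..<M}. v2 u = Suc (v1 u) \<and> u + v1 u \<le> c}
    \<le> Suc (card {u\<in>{..<M}. v1 u = Suc (v0 u) \<and> u + v0 u < c}))"
  unfolding col_concave_def left_vstrip[OF assms(1)] left_vstrip[OF assms(2)] 
  by (simp add: less_Suc_eq_le)

text \<open>Let \<open>s\<close> be the topmost row where the second strip has a cell in the columns
  \<open>\<le> c\<close>. By strictness of \<open>v1\<close> all cells of the first strip in the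
  rows \<open>\<ge> s\<close> lie in columns \<open>< c\<close>, so the row condition at
  \<open>s\<close> suffices.\<close>

lemma row_concave_imp_col:
  assumes st: "strict_shape v1" and vs: "vstrip v0 v1" "vstrip v1 v2"
    and rc: "row_concave M v0 v1 v2"
  shows "col_concave M v0 v1 v2"
  unfolding col_concave_iff_card[OF vs]
proof
  fix c
  let ?A = "{u\<in>{..<M}. v2 u = Suc (v1 u) \<and> u + v1 u \<le> c}"
  show "card ?A \<le> Suc (card {u\<in>{..<M}. v1 u = Suc (v0 u) \<and> u + v0 u < c})"
  proof (cases "?A = {}")
    case False
    define s where "s = Min ?A"
    have s: "s \<in> ?A" unfolding s_def using False by (intro Min_in) auto
    have "card ?A \<le> card {u\<in>{..<M}. v2 u = Suc (v1 u) \<and> s \<le> u}"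
      by (rule card_mono) (auto simp: s_def)
    also have "\<dots> \<le> Suc (card {u\<in>{..<M}. v1 u = Suc (v0 u) \<and> s \<le> u})"
      using rc row_concave_iff_card[OF vs] by blast
    also have "card {u\<in>{..<M}. v1 u = Suc (v0 u) \<and> s \<le> u}
        \<le> card {u\<in>{..<M}. v1 u = Suc (v0 u) \<and> u + v0 u < c}"
    proof (rule card_mono)
      show "{u\<in>{..<M}. v1 u = Suc (v0 u) \<and> s \<le> u} \<subseteq> {u\<in>{..<M}. v1 u = Suc (v0 u) \<and> u + v0 u < c}"
        using strict_shape_le[OF st, of s] s by fastforce
    qed auto
    finally show ?thesis by simp
  next
    case True
    show ?thesis unfolding True by simp
  qed
qed

text \<open>In the lowest violating row \<open>s\<close> the second strip has a cell and the first
  has none. The column condition at that cell yields a cell of the first strip further left but in a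
  higher row, which is possible only if row \<open>s\<close> of \<open>v0\<close> is empty. Then
  \<open>s\<close> is the last row of \<open>v2\<close>, and a single cell is no violation.\<close>

lemma col_concave_imp_row:
  assumes st: "strict_shape v0" "strict_shape v1" "strict_shape v2"
    and vs: "vstrip v0 v1" "vstrip v1 v2"
    and cc: "col_concave M v0 v1 v2"
  shows "row_concave M v0 v1 v2"
proof (rule ccontr)
  define N1 where "N1 s = card {u\<in>{..<M}. v1 u = Suc (v0 u) \<and> s \<le> u}" for s
  define N2 where "N2 s = card {u\<in>{..<M}. v2 u = Suc (v1 u) \<and> s \<le> u}" for s
  assume "\<not> row_concave M v0 v1 v2"
  then obtain s0 where s0: "Suc (N1 s0) < N2 s0"
    unfolding row_concave_iff_card[OF vs] N1_def N2_def by (auto simp: not_le)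
  let ?P = "\<lambda>s. Suc (N1 s) < N2 s"
  have bd: "s < M" if "?P s" for s
  proof (rule ccontr)
    assume "\<not> s < M"
    then have "{u\<in>{..<M}. v2 u = Suc (v1 u) \<and> s \<le> u} = {}" by auto
    then have "N2 s = 0" unfolding N2_def by (metis card.empty)
    then show False using that by simp
  qed
  define s where "s = Max {s. ?P s}"
  have fin: "finite {s. ?P s}" by (rule finite_subset[of _ "{..<M}"]) (use bd in auto)
  have Ps: "?P s" unfolding s_def using Max_in[OF fin] s0 by blast
  have sM: "s < M" using bd Ps .
  have nP: "\<not> ?P (Suc s)"
    unfolding s_def using Max_ge[OF fin, of "Suc (Max {s. ?P s})"] by auto
  have rec: "{u\<in>{..<M}. P u \<and> s \<le> u} = (if P s then insert s {u\<in>{..<M}. P u \<and> Suc s \<le> u} else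
       {u\<in>{..<M}. P u \<and> Suc s \<le> u})" for P
    using sM by (auto simp: Suc_le_eq dest: le_neq_implies_less)
  have r1: "N1 s = N1 (Suc s) + (if v1 s = Suc (v0 s) then 1 else 0)"
    unfolding N1_def rec by auto
  have r2: "N2 s = N2 (Suc s) + (if v2 s = Suc (v1 s) then 1 else 0)"
    unfolding N2_def rec by auto
  have b2: "v2 s = Suc (v1 s)" and nb1: "v1 s \<noteq> Suc (v0 s)"
    using Ps nP r1 r2 by (auto split: if_splits)
  have e1: "v1 s = v0 s" using nb1 vs(1) unfolding vstrip_def by auto
  have sub: "{u\<in>{..<M}. v2 u = Suc (v1 u) \<and> s \<le> u} \<subseteq> {u\<in>{..<M}. v2 u = Suc (v1 u) \<and> u + v1 u \<le> s + v1 s}"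
    using strict_shape_le[OF st(3), of s] b2 by fastforce
  have "N2 s \<le> card {u\<in>{..<M}. v2 u = Suc (v1 u) \<and> u + v1 u \<le> s + v1 s}"
    unfolding N2_def by (rule card_mono[OF _ sub]) auto
  also have "\<dots> \<le> Suc (card {u\<in>{..<M}. v1 u = Suc (v0 u) \<and> u + v0 u < s + v1 s})"
    using cc col_concave_iff_card[OF vs] by blast
  finally have lt: "N1 s < card {u\<in>{..<M}. v1 u = Suc (v0 u) \<and> u + v0 u < s + v1 s}"
    using Ps by simp
  have "\<not> {u\<in>{..<M}. v1 u = Suc (v0 u) \<and> u + v0 u < s + v1 s} \<subseteq> {u\<in>{..<M}. v1 u = Suc (v0 u) \<and> s \<le> u}"
    (is "\<not> ?S \<subseteq> ?T")
  proof
    assume "{u\<in>{..<M}. v1 u = Suc (v0 u) \<and> u + v0 u < s + v1 s} \<subseteq> {u\<in>{..<M}. v1 u = Suc (v0 u) \<and> s \<le> u}"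
    from card_mono[OF _ this] lt show False unfolding N1_def by simp
  qed
  then obtain u where u: "v1 u = Suc (v0 u)" "u + v0 u < s + v1 s" "u < s"
    by (fastforce simp: not_le)
  have z: "v0 s = 0"
    using strict_shape_less(1)[OF st(1) u(3)] u e1 by (cases "v0 s = 0") auto
  then have "v2 s = 1" using b2 e1 by simp
  then have "v2 (Suc s) = 0" using st(3) unfolding strict_shape_def by (metis less_one)
  then have "v2 u = 0" if "Suc s \<le> u" for u using strict_shape_zero[OF st(3) that] by simp
  then have "{u\<in>{..<M}. v2 u = Suc (v1 u) \<and> Suc s \<le> u} = {}" by auto
  then have "N2 (Suc s) = 0" unfolding N2_def by (metis card.empty)
  then show False using Ps r2 b2 by simp
qed

section \<open>Box insertion into a vertical strip\<close>

text \<open>A box added in the given row, during row insertion (\<open>RowB\<close>) or during column insertion (\<open>ColB\<close>).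
  A step from \<open>v\<close> to \<open>w\<close> turns the box added to \<open>v\<close> into the box added to \<open>w\<close>; \<open>None\<close> stands for
  the blocks before the first one that is affected.\<close>

datatype box = RowB nat | ColB nat

fun box_row :: "box \<Rightarrow> nat" where
  "box_row (RowB t) = t"
| "box_row (ColB t) = t"

fun put :: "box option \<Rightarrow> (nat \<Rightarrow> nat) \<Rightarrow> nat \<Rightarrow> nat" where
  "put None v = v"
| "put (Some b) v = add_box v (box_row b)"

text \<open>A column box is kept off the diagonal, so that a diagonal box has the single encoding
  \<open>RowB\<close>.\<close>

definition box_ok :: "(nat \<Rightarrow> nat) \<Rightarrow> box option \<Rightarrow> bool" where
  "box_ok v x \<longleftrightarrow> strict_shape v \<and> strict_shape (put x v) \<and> (\<forall>t. x = Some (ColB t) \<longrightarrow> 0 < v t)"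

text \<open>In \<open>start\<close> and \<open>row\<close> the box drops to the first row that does
  not grow from \<open>v\<close> to \<open>w\<close>. In \<open>turn\<close> the cell of the box is
  also new in \<open>w\<close>, and the box is pushed to the next column; from row mode this happens
  only on the diagonal, where \<open>v a = 0\<close>. In \<open>stay\<close> nothing collides with a
  column box.\<close>

inductive step :: "(nat \<Rightarrow> nat) \<Rightarrow> (nat \<Rightarrow> nat) \<Rightarrow> box option \<Rightarrow> box option \<Rightarrow> bool"
  for v w where
  none: "step v w None None"
| start: "(\<And>u. u < t \<Longrightarrow> w u = Suc (v u)) \<Longrightarrow> w t = v t \<Longrightarrow> step v w None (Some (RowB t))"
| row: "a \<le> t \<Longrightarrow> (\<And>u. a \<le> u \<Longrightarrow> u < t \<Longrightarrow> w u = Suc (v u)) \<Longrightarrow> w t = v t \<Longrightarrow>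
    step v w (Some (RowB a)) (Some (RowB t))"
| turn: "x = RowB a \<and> v a = 0 \<or> x = ColB a \<Longrightarrow> w a = Suc (v a) \<Longrightarrow> t + w t = Suc (a + v a) \<Longrightarrow>
    step v w (Some x) (Some (ColB t))"
| stay: "w a = v a \<Longrightarrow> step v w (Some (ColB a)) (Some (ColB a))"

section \<open>A single insertion step, forwards and backwards\<close>

lemma strict_shape_support:
  assumes "strict_shape v" "v 0 \<le> s"
  shows "v s = 0"
  using strict_shape_le[OF assms(1), of 0 s] assms(2) strict_shape_less(2)[OF assms(1), of 0 s]
  by (cases "v s = 0"; cases "s = 0") auto

lemma vstripD: "vstrip v w \<Longrightarrow> w u = v u \<or> w u = Suc (v u)"
  by (simp add: vstrip_def)

lemma add_box_apply: "add_box v t u = (if u = t then Suc (v t) else v u)"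
  by (simp add: add_box_def)

lemma add_box_remove: "0 < V t \<Longrightarrow> add_box (V(t := V t - 1)) t = V"
  by (auto simp: add_box_def)

lemma strict_shape_remove:
  assumes "strict_shape V" "0 < V t" "V (Suc t) < V t - 1 \<or> V (Suc t) = 0"
  shows "strict_shape (V(t := V t - 1))"
  by (rule strict_remove_box[where t = t]) (use assms in \<open>auto simp: add_box_remove simp del: One_nat_def\<close>)

text \<open>Every row above an addable box ends strictly further right; among the rows ending in one
  column the addable one is thus the topmost.\<close>

lemma turn_le:
  assumes "strict_shape (add_box w t)" "t + w t = Suc c" "a + w a = Suc c"
  shows "t \<le> a"
  using strict_add_boxD(2)[OF assms(1), of a] assms by (cases "t \<le> a") auto

text \<open>Row \<open>t\<close> lies above row \<open>a\<close>, so in \<open>v\<close> it already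
  reaches the column where it ends in \<open>w\<close>.\<close>

lemma turn_same:
  assumes "strict_shape (add_box v a)" "strict_shape (add_box w t)" "t + w t = Suc (a + v a)"
    "w a = Suc (v a)" "vstrip v w" "t \<noteq> a"
  shows "w t = v t"
  using strict_add_boxD(2)[OF assms(1), of t] turn_le[OF assms(2,3), of a] vstripD[OF assms(5), of t]
    assms by auto

text \<open>Unless both rows coincide, the row that gains a box in \<open>w\<close> did not grow
  from \<open>v\<close> to \<open>w\<close>, and the row that gains one in \<open>v\<close>
  did.\<close>

lemma step_vstrip:
  assumes "step v w x y" "vstrip v w" "box_ok v x" "box_ok w y"
  shows "vstrip (put x v) (put y w)"
  using assms(1)
proof cases
  case (row a t)
  have "add_box w t u = add_box v a u \<or> add_box w t u = Suc (add_box v a u)" for u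
    using row(4)[of u] row(3,5) vstripD[OF assms(2), of u] by (auto simp: add_box_apply)
  then show ?thesis using row by (simp add: vstrip_def)
next
  case (turn x' a t)
  have s: "strict_shape (add_box v a)" "strict_shape (add_box w t)"
    using assms(3,4) turn by (auto simp: box_ok_def)
  have "add_box w t u = add_box v a u \<or> add_box w t u = Suc (add_box v a u)" for u
    using turn_same[OF s turn(5,4) assms(2)] turn(4) vstripD[OF assms(2), of u]
    by (auto simp: add_box_apply)
  moreover have "box_row x' = a" using turn(3) by auto
  ultimately show ?thesis using turn by (simp add: vstrip_def)
qed (use assms(2) in \<open>auto simp: vstrip_def add_box_apply\<close>)

lemma addable_unique:
  assumes "strict_shape (add_box w t)" "strict_shape (add_box w t')" "t + w t = t' + w t'"
  shows "t = t'"
  using strict_add_boxD(2)[OF assms(1), of t'] strict_add_boxD(2)[OF assms(2), of t] assms(3)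
  by (cases t t' rule: linorder_cases) auto

text \<open>Keeps \<open>row\<close> and \<open>turn\<close> apart: dropping would place a box below
  a row of length 1.\<close>

lemma row_turn_conflict:
  assumes "v a = 0" "w a = Suc (v a)" "box_ok w (Some (RowB t))" "a \<le> t"
    "\<And>u. a \<le> u \<Longrightarrow> u < t \<Longrightarrow> w u = Suc (v u)" "w t = v t"
  shows False
proof -
  have "a < t" using assms by (cases "a = t") auto
  then show False
    using strict_add_boxD(1)[of w t a] assms(1-3) by (auto simp: box_ok_def)
qed

text \<open>From \<open>None\<close> both \<open>none\<close> and \<open>start\<close> may apply;
  the last premise fixes which one is meant, since the starting block is prescribed.\<close>

lemma step_deterministic:
  assumes "step v w x y" "step v w x y'" "box_ok w y" "box_ok w y'" "y = None \<longleftrightarrow> y' = None"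
  shows "y = y'"
proof -
  have rr: "t = t'" if "a \<le> t" "\<And>u. a \<le> u \<Longrightarrow> u < t \<Longrightarrow> w u = Suc (v u)" "w t = v t"
    "a \<le> t'" "\<And>u. a \<le> u \<Longrightarrow> u < t' \<Longrightarrow> w u = Suc (v u)" "w t' = v t'" for a t t'
    using that(2)[of t'] that(5)[of t] that by (cases t t' rule: linorder_cases) auto
  show ?thesis
    using assms(1)
  proof cases
    case none
    then show ?thesis using assms(5) by simp
  next
    case (start t)
    from assms(2) obtain t' where t': "y' = Some (RowB t')" "\<And>u. u < t' \<Longrightarrow> w u = Suc (v u)" "w t' = v t'"
      unfolding start(1) by cases (use assms(5) start in auto)
    show ?thesis using rr[of 0 t t'] start t' by auto
  next
    case (row a t)
    from assms(2)[unfolded row(1)] show ?thesis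
    proof cases
      case (row t')
      then show ?thesis using rr[of a t t'] \<open>y = _\<close> \<open>a \<le> t\<close> \<open>w t = v t\<close>
          \<open>\<And>u. a \<le> u \<Longrightarrow> u < t \<Longrightarrow> w u = Suc (v u)\<close> by auto
    next
      case (turn a' t')
      then show ?thesis using row_turn_conflict[of v a w t] row assms(3) by auto
    qed
  next
    case (turn x' a t)
    from assms(2)[unfolded turn(1)] show ?thesis
    proof cases
      case (row a' t')
      then show ?thesis using row_turn_conflict[of v a w t'] turn assms(4) by auto
    next
      case (turn a' t')
      have "a' = a" using turn(2) \<open>x' = RowB a \<and> v a = 0 \<or> x' = ColB a\<close> by auto
      then have "t = t'"
        using addable_unique[of w t t'] turn \<open>y = _\<close> \<open>t + w t = _\<close> assms(3,4)
        by (auto simp: box_ok_def)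
      then show ?thesis using turn \<open>y = _\<close> by auto
    next
      case (stay a')
      then show ?thesis using turn by auto
    qed
  next
    case (stay a)
    from assms(2)[unfolded stay(1)] show ?thesis
      by cases (use stay in auto)
  qed
qed

lemma step_Some: "step v w (Some b) y \<Longrightarrow> y \<noteq> None"
  by (auto elim: step.cases)

text \<open>Backward determinism, where only the enlarged shape \<open>put x v\<close> is known. In
  column mode it rests on the fact that two removable cells of one shape never share a
  column.\<close>

lemma step_source_unique:
  assumes "step v w x y" "step v' w x' y" "put x v = put x' v'" "y \<noteq> None"
    "vstrip v w" "vstrip v' w" "box_ok v x" "box_ok v' x'"
  shows "x = x' \<and> v = v'"
proof -
  \<comment> \<open>Conflicting pairs of rules: \<open>nr\<close> excludes \<open>start\<close>
    against \<open>row\<close>, \<open>rr\<close> two \<open>row\<close> steps from different rows,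
    \<open>tt\<close> two \<open>turn\<close> steps from different rows, and \<open>ts\<close> a
    \<open>turn\<close> against a \<open>stay\<close>.\<close>
  have nr: False if "put (Some (RowB a')) v1 = v2" "a' \<le> t" "\<And>u. a' \<le> u \<Longrightarrow> u < t \<Longrightarrow> w u = Suc (v1 u)"
    "w t = v1 t" "\<And>u. u < t \<Longrightarrow> w u = Suc (v2 u)" "w t = v2 t" for a' t v1 v2
    using that(2-) that(3)[of a'] that(5)[of a'] arg_cong[OF that(1), of "\<lambda>f. f a'"]
    by (cases "a' = t") (auto simp: add_box_apply)
  have rr: False if "put (Some (RowB a)) v1 = put (Some (RowB a')) v2"
     "a < a'" "a' \<le> t" "\<And>u. a \<le> u \<Longrightarrow> u < t \<Longrightarrow> w u = Suc (v1 u)" "w t = v1 t"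
     "\<And>u. a' \<le> u \<Longrightarrow> u < t \<Longrightarrow> w u = Suc (v2 u)" "w t = v2 t" for a a' t v1 v2
    using that(2-) that(4)[of a'] that(6)[of a'] arg_cong[OF that(1), of "\<lambda>f. f a'"]
    by (cases "a' = t") (auto simp: add_box_apply)
  have tt: False if "add_box v1 a = add_box v2 a'" "a < a'" "a + v1 a = a' + v2 a'" "strict_shape v1"
    for a a' v1 v2
    using strict_shape_less(1)[OF that(4,2)] arg_cong[OF that(1), of "\<lambda>f. f a'"] that(2,3)
    by (auto simp: add_box_apply)
  have ts: False if "add_box v1 a = add_box v2 t" "w t = v2 t" "t + w t = Suc (a + v1 a)"
    "w a = Suc (v1 a)" "vstrip v1 w" for a t v1 v2
    using arg_cong[OF that(1), of "\<lambda>f. f t"] that(2-) vstripD[OF that(5), of t]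
    by (cases "a = t") (auto simp: add_box_apply)
  have "x = x'"
    using assms(1)
  proof cases
    case none
    then show ?thesis using assms(4) by simp
  next
    case (start t)
    from assms(2)[unfolded start(2)] show ?thesis
    proof cases
      case (row a')
      have "put (Some (RowB a')) v' = v" using assms(3) start(1) row(1) by simp
      from nr[OF this row(2,3,4) start(3,4)] show ?thesis by simp
    qed (simp add: start)
  next
    case (row a t)
    from assms(2)[unfolded row(2)] show ?thesis
    proof cases
      case start
      have "put (Some (RowB a)) v = v'" using assms(3) start(1) row(1) by simp
      from nr[OF this row(3,4,5) start(2,3)] show ?thesis by simp
    next
      case row': (row a')
      have e: "put (Some (RowB a)) v = put (Some (RowB a')) v'" using assms(3) row(1) row'(1) by simp
      show ?thesis
      proof (cases a a' rule: linorder_cases)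
        case less
        from rr[OF e less row'(2) row(4,5) row'(3,4)] show ?thesis by simp
      next
        case equal
        then show ?thesis using row(1) row'(1) by simp
      next
        case greater
        from rr[OF e[symmetric] greater row(3) row'(3,4) row(4,5)] show ?thesis by simp
      qed
    qed
  next
    case (turn z a t)
    have z: "put x v = add_box v a" using turn by auto
    from assms(2)[unfolded turn(2)] show ?thesis
    proof cases
      case (turn z' a')
      have z': "put x' v' = add_box v' a'" using turn by auto
      have "a + v a = a' + v' a'" using turn \<open>t + w t = Suc (a + v a)\<close> by auto
      moreover have "strict_shape v" "strict_shape v'" using assms(7,8) by (auto simp: box_ok_def)
      ultimately have aa: "a = a'"
        using tt[of v a v' a'] tt[of v' a' v a] z z' assms(3)
        by (cases a a' rule: linorder_cases) auto
      then have "v = v'" using z z' assms(3) add_box_inj by metis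
      then show ?thesis using aa turn \<open>z = RowB a \<and> v a = 0 \<or> z = ColB a\<close> \<open>x = Some z\<close> assms(7,8)
        by (auto simp: box_ok_def)
    next
      case stay
      then show ?thesis using ts[of v a v' t] z turn assms(3,5) by auto
    qed
  next
    case (stay a)
    from assms(2)[unfolded stay(2)] show ?thesis
    proof cases
      case (turn z' a')
      have z': "put x' v' = add_box v' a'" using turn by auto
      then show ?thesis using ts[of v' a' v a] turn stay assms(3,6) by auto
    next
      case stay
      then show ?thesis using \<open>x = _\<close> by auto
    qed
  qed
  moreover from this have "v = v'"
    using assms(3) by (cases x) (auto dest: add_box_inj)
  ultimately show ?thesis by simp
qed

text \<open>The topmost row that does not reach beyond the end of row \<open>a\<close> ends in the
  same column as row \<open>a\<close>, and the row above it leaves room.\<close>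

lemma addable_in_column:
  assumes "strict_shape w" "0 < w a"
  obtains t where "t \<le> a" "t + w t = a + w a" "strict_shape (add_box w t)" "0 < w t"
proof -
  define t where "t = (LEAST u. u + w u \<le> a + w a)"
  have t: "t + w t \<le> a + w a" unfolding t_def by (rule LeastI[of _ a]) simp
  have ta: "t \<le> a" unfolding t_def by (rule Least_le) simp
  have e: "t + w t = a + w a" using strict_shape_le[OF assms(1) ta assms(2)] t by simp
  have "0 < w t" using ta assms strict_shape_zero by (metis neq0_conv)
  moreover have "strict_shape (add_box w t)"
  proof (rule strict_add_box[OF assms(1)])
    assume "0 < t"
    then have "\<not> (t - 1 + w (t - 1) \<le> a + w a)" using not_less_Least[of "t - 1"] unfolding t_def
      by (metis diff_less zero_less_one)
    then show "Suc (w t) < w (t - 1)" using e \<open>0 < t\<close> by auto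
  qed
  ultimately show ?thesis using that ta e by blast
qed

text \<open>\<open>no_run\<close> rules out the bad case, a run of growing rows from
  \<open>a\<close> that reaches an empty row strictly below \<open>a\<close>: the next row would
  have a row of length 1 above it. If the run ends at an empty row \<open>a\<close> itself, the box
  is on the diagonal and turns.\<close>

lemma step_row_exists:
  assumes ok: "box_ok v (Some (RowB a))" and w: "strict_shape w" "vstrip v w"
    and no_run: "\<And>s. a < s \<Longrightarrow> v s = 0 \<Longrightarrow> (\<And>u. a \<le> u \<Longrightarrow> u \<le> s \<Longrightarrow> w u = Suc (v u)) \<Longrightarrow> False"
  shows "\<exists>y. step v w (Some (RowB a)) y \<and> box_ok w y"
proof -
  have sv: "strict_shape v" "strict_shape (add_box v a)" using ok by (auto simp: box_ok_def)
  define t where "t = (LEAST u. a \<le> u \<and> w u = v u)"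
  have "a \<le> a + w 0 + v 0 \<and> w (a + w 0 + v 0) = v (a + w 0 + v 0)"
    using strict_shape_support[OF w(1), of "a + w 0 + v 0"]
      strict_shape_support[OF sv(1), of "a + w 0 + v 0"] by simp
  then have "a \<le> t \<and> w t = v t" unfolding t_def by (rule LeastI)
  then have t: "a \<le> t" "w t = v t" by auto
  have run: "w u = Suc (v u)" if "a \<le> u" "u < t" for u
    using that vstripD[OF w(2), of u] not_less_Least[of u "\<lambda>u. a \<le> u \<and> w u = v u"]
    unfolding t_def by auto
  show ?thesis
  proof (cases "a < t \<and> v (t - 1) = 0")
    case True
    have r: "w u = Suc (v u)" if "a \<le> u" "u \<le> t - 1" for u
      by (rule run) (use that True in auto)
    have "\<not> a < t - 1" using no_run[OF _ _ r] True by auto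
    then have "a = t - 1" using True by linarith
    then have "v a = 0" using True by metis
    moreover have "w a = Suc (v a)" by (rule run) (use True in auto)
    ultimately have a: "v a = 0" "w a = Suc (v a)" by auto
    obtain b where "b + w b = a + w a" "strict_shape (add_box w b)" "0 < w b"
      by (rule addable_in_column[OF w(1), of a]) (use a in auto)
    then have "step v w (Some (RowB a)) (Some (ColB b)) \<and> box_ok w (Some (ColB b))"
      using a w(1) by (auto intro!: step.turn simp: box_ok_def)
    then show ?thesis by blast
  next
    case False
    have "strict_shape (add_box w t)"
    proof (rule strict_add_box[OF w(1)])
      assume t0: "0 < t"
      show "Suc (w t) < w (t - 1)"
      proof (cases "a = t")
        case True
        then show ?thesis using strict_add_boxD(1)[OF sv(2), of "t - 1"] t t0 vstripD[OF w(2), of "t - 1"]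
          by auto
      next
        case at: False
        then have "a < t" using t by simp
        then have v: "0 < v (t - 1)" "w (t - 1) = Suc (v (t - 1))" using False run[of "t-1"] by auto
        have "v t < v (t - 1) \<or> v t = 0" using sv(1) t0 unfolding strict_shape_def by (metis Suc_pred')
        then show ?thesis using v t by auto
      qed
    qed
    then have "step v w (Some (RowB a)) (Some (RowB t)) \<and> box_ok w (Some (RowB t))"
      using t run w(1) by (auto intro!: step.row simp: box_ok_def)
    then show ?thesis by blast
  qed
qed

text \<open>Here a run consisting of the first row alone is excluded as well: there is no earlier
  box that could turn.\<close>

lemma step_start_exists:
  assumes v: "strict_shape v" and w: "strict_shape w" "vstrip v w"
    and no_run: "\<And>s. v s = 0 \<Longrightarrow> (\<And>u. u \<le> s \<Longrightarrow> w u = Suc (v u)) \<Longrightarrow> False"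
  shows "\<exists>y. y \<noteq> None \<and> step v w None y \<and> box_ok w y"
proof -
  define t where "t = (LEAST u. w u = v u)"
  have "w (w 0 + v 0) = v (w 0 + v 0)"
    using strict_shape_support[OF w(1), of "w 0 + v 0"]
      strict_shape_support[OF v, of "w 0 + v 0"] by simp
  then have t: "w t = v t" unfolding t_def by (rule LeastI)
  have run: "w u = Suc (v u)" if "u < t" for u
    using that vstripD[OF w(2), of u] not_less_Least[of u "\<lambda>u. w u = v u"]
    unfolding t_def by auto
  have "strict_shape (add_box w t)"
  proof (rule strict_add_box[OF w(1)])
    assume t0: "0 < t"
    have r: "w u = Suc (v u)" if "u \<le> t - 1" for u
      by (rule run) (use that t0 in auto)
    have "0 < v (t - 1)" using no_run[OF _ r] by (metis neq0_conv)
    moreover have "w (t - 1) = Suc (v (t - 1))" by (rule run) (use t0 in auto)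
    moreover have "v t < v (t - 1) \<or> v t = 0" using v t0 unfolding strict_shape_def by (metis Suc_pred')
    ultimately show "Suc (w t) < w (t - 1)" using t by linarith
  qed
  then have "step v w None (Some (RowB t)) \<and> box_ok w (Some (RowB t))"
    using t run w(1) by (auto intro!: step.start simp: box_ok_def)
  then show ?thesis by blast
qed

lemma step_col_exists:
  assumes "box_ok v (Some (ColB a))" "strict_shape w" "vstrip v w"
  shows "\<exists>y. step v w (Some (ColB a)) y \<and> box_ok w y"
proof (cases "w a = v a")
  case True
  have "strict_shape (add_box w a)"
  proof (rule strict_add_box[OF assms(2)])
    assume "0 < a"
    then show "Suc (w a) < w (a - 1)"
      using strict_add_boxD(1)[of v a "a - 1"] assms(1) True vstripD[OF assms(3), of "a - 1"]
      by (auto simp: box_ok_def)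
  qed
  then have "step v w (Some (ColB a)) (Some (ColB a)) \<and> box_ok w (Some (ColB a))"
    using True assms by (auto intro: step.stay simp: box_ok_def)
  then show ?thesis by blast
next
  case False
  then have wa: "w a = Suc (v a)" using vstripD[OF assms(3)] by blast
  obtain b where "b + w b = a + w a" "strict_shape (add_box w b)" "0 < w b"
    by (rule addable_in_column[OF assms(2), of a]) (use wa in auto)
  then have "step v w (Some (ColB a)) (Some (ColB b)) \<and> box_ok w (Some (ColB b))"
    using wa assms(2) by (auto intro!: step.turn simp: box_ok_def)
  then show ?thesis by blast
qed

text \<open>For a row box one searches upwards from \<open>t\<close> for a row that does not grow
  from \<open>V\<close> to \<open>put y w\<close> and removes its last cell; if there is none, the
  box started here. A column box either stayed or was pushed out by the bottom cell of the preceding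
  column.\<close>

lemma step_reverse_exists:
  assumes V: "strict_shape V" "vstrip V (put y w)" and ok: "box_ok w y"
  shows "\<exists>x v. V = put x v \<and> box_ok v x \<and> step v w x y \<and> vstrip v w"
proof -
  have sw: "strict_shape w" "strict_shape (put y w)" using ok by (auto simp: box_ok_def)
  have remove: ?thesis
    if "0 < V m" "strict_shape (V(m := V m - 1))"
      "step (V(m := V m - 1)) w (Some b) y" "vstrip (V(m := V m - 1)) w" "b \<in> {RowB m, ColB m}"
      "b = ColB m \<Longrightarrow> 1 < V m"
    for m b
  proof -
    have "V = put (Some b) (V(m := V m - 1))" using that(1,5) by (auto simp: add_box_def)
    then show ?thesis using that V(1)
      by (intro exI[of _ "Some b"] exI[of _ "V(m := V m - 1)"]) (auto simp: box_ok_def)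
  qed
  show ?thesis
  proof (cases y)
    case None
    then show ?thesis using V sw by (intro exI[of _ None] exI[of _ V]) (auto simp: box_ok_def intro: step.none)
  next
    case (Some yb)
    show ?thesis
    proof (cases yb)
      case (RowB t)
      let ?W = "add_box w t"
      have W: "strict_shape ?W" "vstrip V ?W" using V sw Some RowB by auto
      show ?thesis
      proof (cases "\<forall>u\<le>t. ?W u = Suc (V u)")
        case True
        have "step V w None y" unfolding Some RowB
        proof (rule step.start)
          show "w u = Suc (V u)" if "u < t" for u
            using True[rule_format, of u] that by (simp add: add_box_apply)
          show "w t = V t" using True[rule_format, of t] by (simp add: add_box_apply)
        qed
        moreover have "vstrip V w"
          unfolding vstrip_def using vstripD[OF W(2)] True
          by (metis add_box_apply diff_Suc_1 order_refl)
        ultimately show ?thesis using V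
          by (intro exI[of _ None] exI[of _ V]) (auto simp: box_ok_def)
      next
        case False
        define m where "m = (GREATEST u. u \<le> t \<and> ?W u = V u)"
        have "\<exists>u. u \<le> t \<and> ?W u = V u" using False vstripD[OF W(2)] by blast
        then have "m \<le> t \<and> ?W m = V m" unfolding m_def by (rule GreatestI_ex_nat) auto
        then have m: "m \<le> t" "?W m = V m" by auto
        have run: "?W u = Suc (V u)" if "m < u" "u \<le> t" for u
          using that vstripD[OF W(2), of u] Greatest_le_nat[of "\<lambda>u. u \<le> t \<and> ?W u = V u" u t]
          unfolding m_def by auto
        have Vm: "V (Suc m) < V m - 1 \<or> V (Suc m) = 0" "0 < V m"
        proof -
          have "(V (Suc m) < V m - 1 \<or> V (Suc m) = 0) \<and> 0 < V m"
          proof (cases "m = t")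
            case True
            then have "Suc (w m) = V m" using m by (simp add: add_box_apply)
            moreover have "V (Suc m) \<le> w (Suc m)" 
              using vstripD[OF W(2), of "Suc m"] True by (auto simp: add_box_apply)
            ultimately show ?thesis using sw(1)[unfolded strict_shape_def, rule_format, of m] by auto
          next
            case False
            then have "?W (Suc m) = Suc (V (Suc m))" using run m by auto
            then show ?thesis using m(2) W(1)[unfolded strict_shape_def, rule_format, of m] by auto
          qed
          then show "V (Suc m) < V m - 1 \<or> V (Suc m) = 0" "0 < V m" by auto
        qed
        have sv: "strict_shape (V(m := V m - 1))"
          using strict_shape_remove[OF V(1), of m] Vm by auto
        have stp: "step (V(m := V m - 1)) w (Some (RowB m)) y" unfolding Some RowB
        proof (rule step.row[OF m(1)])
          fix u assume u: "m \<le> u" "u < t"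
          then show "w u = Suc ((V(m := V m - 1)) u)"
            using m run[of u] Vm by (cases "u = m") (auto simp: add_box_apply)
        next
          show "w t = (V(m := V m - 1)) t"
            using m run[of t] by (cases "t = m") (auto simp: add_box_apply)
        qed
        have "vstrip (V(m := V m - 1)) w"
          unfolding vstrip_def
        proof
          fix u
          show "w u = (V(m := V m - 1)) u \<or> w u = Suc ((V(m := V m - 1)) u)"
            using m run[of t] Vm(2) vstripD[OF W(2), of u]
            by (auto simp: add_box_apply split: if_splits)
        qed
        then show ?thesis using remove[of m "RowB m"] Vm(2) sv stp by auto
      qed
    next
      case (ColB t)
      let ?W = "add_box w t"
      have W: "strict_shape ?W" "vstrip V ?W" using V sw Some ColB by auto
      have wt: "0 < w t" using ok Some ColB by (auto simp: box_ok_def)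
      show ?thesis
      proof (cases "?W t = V t")
        case True
        then have Vt: "V t = Suc (w t)" by (simp add: add_box_apply)
        have "V (Suc t) \<le> w (Suc t)" 
          using vstripD[OF W(2), of "Suc t"] by (auto simp: add_box_apply)
        then have d: "V (Suc t) < V t - 1 \<or> V (Suc t) = 0"
          using Vt sw(1)[unfolded strict_shape_def, rule_format, of t] by auto
        have sv: "strict_shape (V(t := V t - 1))"
          using strict_shape_remove[OF V(1), of t] d Vt by auto
        have stp: "step (V(t := V t - 1)) w (Some (ColB t)) y" unfolding Some ColB
          by (rule step.stay) (use Vt in auto)
        have "vstrip (V(t := V t - 1)) w"
          unfolding vstrip_def
        proof
          fix u
          show "w u = (V(t := V t - 1)) u \<or> w u = Suc ((V(t := V t - 1)) u)"
            using Vt vstripD[OF W(2), of u] by (auto simp: add_box_apply)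
        qed
        then show ?thesis using remove[of t "ColB t"] Vt wt sv stp by auto
      next
        case False
        then have Vt: "V t = w t" using vstripD[OF W(2), of t] by (simp add: add_box_apply)
        define a where "a = (GREATEST u. u + V u = t + V t \<and> 0 < V u)"
        let ?P = "\<lambda>u. u + V u = t + V t \<and> 0 < V u"
        have bd: "u \<le> t + V t" if "?P u" for u using that by linarith
        have Pt: "?P t" using Vt wt by simp
        have a: "a + V a = t + V t" "0 < V a"
          using GreatestI_nat[of ?P, OF Pt bd] unfolding a_def by auto
        have ta: "t \<le> a" unfolding a_def by (rule Greatest_le_nat[of ?P, OF Pt bd])
        have "\<not> ?P (Suc a)"
          using Greatest_le_nat[of ?P "Suc a", OF _ bd] unfolding a_def by fastforce
        then have Va: "V (Suc a) < V a - 1 \<or> V (Suc a) = 0"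
          using a V(1)[unfolded strict_shape_def, rule_format, of a] by auto
        have sv: "strict_shape (V(a := V a - 1))"
          using strict_shape_remove[OF V(1), of a] a Va by auto
        have wa: "w a = V a"
        proof (cases "a = t")
          case False
          then have "t < a" using ta by simp
          then show ?thesis
            using strict_shape_less(1)[OF sw(1), of t a] a Vt vstripD[OF W(2), of a] False
            by (auto simp: add_box_apply)
        qed (simp add: Vt)
        have col: "t + w t = Suc (a + (V(a := V a - 1)) a)" using a Vt by auto
        have wa': "w a = Suc ((V(a := V a - 1)) a)" using wa a by auto
        have "vstrip (V(a := V a - 1)) w"
          unfolding vstrip_def
        proof
          fix u
          show "w u = (V(a := V a - 1)) u \<or> w u = Suc ((V(a := V a - 1)) u)"
            using wa' Vt vstripD[OF W(2), of u] by (auto simp: add_box_apply split: if_splits)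
        qed
        \<comment> \<open>A removed cell on the diagonal was the last place of row mode; elsewhere
          the box was already in column mode.\<close>
        moreover have "step (V(a := V a - 1)) w (Some (if V a = 1 then RowB a else ColB a)) y"
          unfolding Some ColB by (rule step.turn[where a = a]) (use wa' col in auto)
        ultimately show ?thesis
          using remove[of a "if V a = 1 then RowB a else ColB a"] a(2) sv by (cases "V a = 1") auto
      qed
    qed
  qed
qed

section \<open>Row concavity under insertion and deletion\<close>

definition tail_box :: "box option \<Rightarrow> nat \<Rightarrow> nat" where
  "tail_box x s = (case x of None \<Rightarrow> 0 | Some b \<Rightarrow> if s \<le> box_row b then 1 else 0)"

definition box_below :: "nat \<Rightarrow> box option \<Rightarrow> bool" where
  "box_below M x \<longleftrightarrow> (\<forall>b. x = Some b \<longrightarrow> box_row b < M)"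

lemma tail_put: "box_below M x \<Longrightarrow> tail_cells M (put x v) s = tail_cells M v s + tail_box x s"
  by (cases x) (auto simp: tail_box_def box_below_def tail_add_box)

lemma tail_box_01: "tail_box x s = 0 \<or> tail_box x s = 1"
  by (cases x) (auto simp: tail_box_def)

lemma sum_run:
  fixes v w :: "nat \<Rightarrow> nat"
  assumes "\<And>u. a \<le> u \<Longrightarrow> u < s \<Longrightarrow> w u = Suc (v u)"
  shows "sum w {a..<s} = sum v {a..<s} + (s - a)"
proof -
  have "sum w {a..<s} = (\<Sum>u\<in>{a..<s}. v u + 1)"
    by (rule sum.cong) (use assms in auto)
  then show ?thesis unfolding sum.distrib by simp
qed

lemma sum_vstrip_le:
  fixes v w :: "nat \<Rightarrow> nat"
  assumes "vstrip v w"
  shows "sum w {a..<s} \<le> sum v {a..<s} + (s - a)"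
proof -
  have "sum w {a..<s} \<le> (\<Sum>u\<in>{a..<s}. v u + 1)"
    by (rule sum_mono) (use vstripD[OF assms] in \<open>auto, metis le_SucI order_refl\<close>)
  then show ?thesis unfolding sum.distrib by simp
qed

lemma sum_vstrip_less:
  fixes v w :: "nat \<Rightarrow> nat"
  assumes "vstrip v w" "a < s" "w a = v a"
  shows "sum w {a..<s} < sum v {a..<s} + (s - a)"
  using sum_vstrip_le[OF assms(1), of "Suc a" s] assms(2,3)
  by (simp add: sum.atLeast_Suc_lessThan)

lemma concave_arith:
  fixes s0 s1 s2 T0 T1 T2 b0 b1 b2 :: nat
  assumes "s2 + s0 \<le> 2 * s1" "T2 + b2 + T0 + b0 \<le> 2 * T1 + 2 * b1 + 1"
  shows "s2 + b2 + T2 + (s0 + b0 + T0) \<le> 2 * (s1 + b1 + T1) + 1"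
  using add_mono[OF assms] by (simp add: algebra_simps)

text \<open>Harm is done only if the box of \<open>a2\<close> drops past row \<open>s\<close> and
  that of \<open>a1\<close> does not. Then the rows \<open>t1\<close> to \<open>s - 1\<close> all
  grow in the second step while row \<open>t1\<close> does not grow in the first, so the condition
  at \<open>t1\<close> leaves a spare unit at \<open>s\<close>. For a box that starts,
  \<open>size\<close> provides this unit at row 0.\<close>

lemma row_concave_insert:
  assumes rc: "row_concave M a0 a1 a2"
    and st: "step a0 a1 x0 x1" "step a1 a2 x1 x2"
    and row: "\<And>t. x1 \<noteq> Some (ColB t)"
    and below: "box_below M x0" "box_below M x1" "box_below M x2"
    and vs: "vstrip a0 a1" "vstrip a1 a2"
    and ok: "box_ok a2 x2"
    and size: "x1 = None \<Longrightarrow> x2 \<noteq> None \<Longrightarrow>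
      tail_cells M a2 0 + tail_cells M a0 0 \<le> 2 * tail_cells M a1 0"
  shows "row_concave M (put x0 a0) (put x1 a1) (put x2 a2)"
  unfolding row_concave_def tail_put[OF below(1)] tail_put[OF below(2)] tail_put[OF below(3)]
proof
  fix s
  let ?T0 = "tail_cells M a0" and ?T1 = "tail_cells M a1" and ?T2 = "tail_cells M a2"
  have base: "?T2 s + ?T0 s \<le> 2 * ?T1 s + 1" using rc by (simp add: row_concave_def)
  show "?T2 s + tail_box x2 s + (?T0 s + tail_box x0 s) \<le> 2 * (?T1 s + tail_box x1 s) + 1"
  proof (cases x1)
    case None
    then have x0: "x0 = None" using st(1) step_Some by (cases x0) auto
    show ?thesis
    proof (cases "tail_box x2 s = 0")
      case True
      then show ?thesis using base None x0 by (simp add: tail_box_def)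
    next
      case False
      from st(2)[unfolded None] obtain t where
        t: "x2 = Some (RowB t)" "s \<le> t" "\<And>u. u < t \<Longrightarrow> a2 u = Suc (a1 u)"
      proof cases
        case none
        then show ?thesis using False by (simp add: tail_box_def)
      next
        case (start t)
        then show ?thesis using False that[of t] by (simp add: tail_box_def split: if_splits)
      qed
      have sM: "s \<le> M" using below(3) t by (auto simp: box_below_def)
      have "sum a2 {0..<s} = sum a1 {0..<s} + (s - 0)"
        by (rule sum_run) (use t in auto)
      moreover have "sum a1 {0..<s} \<le> sum a0 {0..<s} + (s - 0)" by (rule sum_vstrip_le[OF vs(1)])
      ultimately show ?thesis
        using size tail_split[of 0 s M, OF _ sM] None x0 t by (simp add: tail_box_def)
    qed
  next
    case (Some b)
    then obtain t1 where x1: "x1 = Some (RowB t1)" using row by (cases b) auto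
    have e1: "a1 t1 = a0 t1" using st(1) unfolding x1 by cases auto
    have x0: "tail_box x0 s \<le> tail_box x1 s"
      using st(1) unfolding x1 by cases (auto simp: tail_box_def)
    show ?thesis
    proof (cases "s \<le> t1 \<or> tail_box x2 s = 0")
      case True
      have "tail_box x2 s \<le> 1" "tail_box x0 s \<le> 1" by (auto simp: tail_box_def split: option.splits)
      then show ?thesis using True base x1 x0 by (auto simp: tail_box_def)
    next
      case False
      then have x0': "tail_box x0 s = 0" using x0 x1 by (simp add: tail_box_def)
      have s: "t1 < s" using False by simp
      from st(2)[unfolded x1] False obtain t where t: "x2 = Some (RowB t)" "s \<le> t"
        "\<And>u. t1 \<le> u \<Longrightarrow> u < t \<Longrightarrow> a2 u = Suc (a1 u)"
      proof cases
        case (row t)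
        then show ?thesis using that[of t] False by (auto simp: tail_box_def split: if_splits)
      next
        case (turn a t)
        then have "t \<le> t1" using turn_le[of a2 t t1 t1] ok by (auto simp: box_ok_def)
        then show ?thesis using turn False by (auto simp: tail_box_def split: if_splits)
      qed
      have sM: "s \<le> M" using below(3) t by (auto simp: box_below_def)
      have "sum a2 {t1..<s} = sum a1 {t1..<s} + (s - t1)"
        by (rule sum_run) (use t in auto)
      moreover have "sum a1 {t1..<s} < sum a0 {t1..<s} + (s - t1)"
        by (rule sum_vstrip_less[OF vs(1) s e1])
      moreover have "?T2 t1 + ?T0 t1 \<le> 2 * ?T1 t1 + 1" using rc by (simp add: row_concave_def)
      ultimately show ?thesis
        using tail_split[of t1 s M, OF _ sM] x0' x1 t s by (simp add: tail_box_def)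
    qed
  qed
qed

text \<open>The middle box counts twice, so its removal hurts for \<open>s \<le> t1\<close>. The
  rows \<open>s\<close> to \<open>t1 - 1\<close> satisfy \<open>a2 u + a0 u \<le> 2 * a1 u\<close>
  one by one, as each grows in the first step or rests in the second; the remaining rows are handled
  by the given condition at \<open>Suc t1\<close>, or after a turn by the absence of cells below row
  \<open>t1\<close>.\<close>

lemma row_concave_delete:
  assumes rc: "row_concave M (put x0 a0) (put x1 a1) (put x2 a2)"
    and st: "step a0 a1 x0 x1" "step a1 a2 x1 x2"
    and row: "\<And>t. x1 \<noteq> Some (ColB t)"
    and below: "box_below M x0" "box_below M x1" "box_below M x2"
    and vs: "vstrip a0 a1" "vstrip a1 a2"
    and ok: "box_ok a1 x1" "box_ok a2 x2"
    and empty: "\<And>u. M \<le> u \<Longrightarrow> a2 u = 0"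
  shows "row_concave M a0 a1 a2"
  unfolding row_concave_def
proof
  fix s
  let ?T0 = "tail_cells M a0" and ?T1 = "tail_cells M a1" and ?T2 = "tail_cells M a2"
  have base: "?T2 s + tail_box x2 s + (?T0 s + tail_box x0 s) \<le> 2 * (?T1 s + tail_box x1 s) + 1" for s
    using rc unfolding row_concave_def tail_put[OF below(1)] tail_put[OF below(2)] tail_put[OF below(3)]
    by blast
  show "?T2 s + ?T0 s \<le> 2 * ?T1 s + 1"
  proof (cases "tail_box x1 s = 0")
    case True
    then show ?thesis using base[of s] by simp
  next
    case False
    then obtain t1 where x1: "x1 = Some (RowB t1)" and s: "s \<le> t1"
      using row by (cases x1; cases "the x1") (auto simp: tail_box_def split: if_splits)
    have e1: "a1 t1 = a0 t1" using st(1) unfolding x1 by cases auto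
    have t1M: "Suc t1 \<le> M" using below(2) x1 by (auto simp: box_below_def)
    have split: "tail_cells M v s = sum v {s..<t1} + v t1 + tail_cells M v (Suc t1)" for v
      using tail_split[of s "Suc t1" M v] s t1M by simp
    have run1: "a1 u = Suc (a0 u)" if "tail_box x0 s = 0" "s \<le> u" "u < t1" for u
      using st(1) unfolding x1
    proof cases
      case (row a)
      then show ?thesis using that by (auto simp: tail_box_def split: if_splits)
    qed (use that in \<open>auto simp: tail_box_def\<close>)
    have late: "tail_box x0 (Suc t1) = 0" 
      using st(1) unfolding x1 by cases (auto simp: tail_box_def)
    show ?thesis
    proof (cases "tail_box x0 s = 1 \<and> tail_box x2 s = 1")
      case True
      then show ?thesis using base[of s] s x1 by (simp add: tail_box_def)
    next
      case False
      from st(2)[unfolded x1] show ?thesis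
      proof cases
        case (row t)
        have "tail_box x2 s = 1" using row s by (simp add: tail_box_def)
        then have x0: "tail_box x0 s = 0" using False tail_box_01[of x0 s] by simp
        have "(\<Sum>u\<in>{s..<t1}. a2 u + a0 u) \<le> (\<Sum>u\<in>{s..<t1}. 2 * a1 u)"
        proof (rule sum_mono)
          fix u assume "u \<in> {s..<t1}"
          then show "a2 u + a0 u \<le> 2 * a1 u" using run1[OF x0, of u] vstripD[OF vs(2), of u] by auto
        qed
        then have sm: "sum a2 {s..<t1} + sum a0 {s..<t1} \<le> 2 * sum a1 {s..<t1}"
          by (simp add: sum.distrib sum_distrib_left)
        have "?T2 (Suc t1) + a2 t1 + ?T0 (Suc t1) + a0 t1 \<le> 2 * ?T1 (Suc t1) + 2 * a1 t1 + 1"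
          using base[of "Suc t1"] late row e1 x1 vstripD[OF vs(2), of t1]
          by (cases "t = t1") (auto simp: tail_box_def)
        then show ?thesis unfolding split by (rule concave_arith[OF sm])
      next
        case (turn a t)
        have "a = t1" "a1 a = 0" using turn(2) by auto
        then have t: "x2 = Some (ColB t)" "a1 t1 = 0" "a2 t1 = 1" "t + a2 t = Suc t1"
          using turn(1,3,4) by simp_all
        have sv: "strict_shape a2" "strict_shape (add_box a2 t)" "strict_shape (add_box a1 t1)"
          using ok x1 t by (auto simp: box_ok_def)
        have tt: "t \<le> t1" using turn_le[OF sv(2) t(4)] t by simp
        have col: "a2 u = a1 u" if "t \<le> u" "u < t1" for u
        proof (rule ccontr)
          assume "a2 u \<noteq> a1 u"
          then have "a2 u = Suc (a1 u)" using vstripD[OF vs(2)] by blast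
          moreover have "t1 < u + a1 u" using strict_add_boxD(2)[OF sv(3) that(2)] t by simp
          moreover have "u + a2 u \<le> t + a2 t"
            using strict_shape_le[OF sv(1) that(1)] \<open>a2 u = Suc (a1 u)\<close> by simp
          ultimately show False using t(4) by simp
        qed
        have "a2 (Suc t1) = 0" using sv(1) t(3) unfolding strict_shape_def by (metis less_one)
        then have z: "a2 u = 0" if "Suc t1 \<le> u" for u using strict_shape_zero[OF sv(1) that] by simp
        have le1: "a1 u \<le> a2 u" "a0 u \<le> a1 u" for u
          using vstripD[OF vs(2), of u] vstripD[OF vs(1), of u] by auto
        have "a1 u = 0" "a0 u = 0" if "Suc t1 \<le> u" for u using z[OF that] le1[of u] by auto
        then have "?T2 (Suc t1) = 0" "?T1 (Suc t1) = 0" "?T0 (Suc t1) = 0"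
          unfolding tail_cells_def using z by (auto intro!: sum.neutral)
        have "(\<Sum>u\<in>{s..<t1}. a2 u + a0 u) \<le> (\<Sum>u\<in>{s..<t1}. 2 * a1 u)"
        proof (rule sum_mono)
          fix u assume u: "u \<in> {s..<t1}"
          show "a2 u + a0 u \<le> 2 * a1 u"
          proof (cases "tail_box x0 s = 0")
            case True
            then show ?thesis using run1[OF True, of u] u vstripD[OF vs(2), of u] by auto
          next
            case x0: False
            then have "tail_box x2 s = 0" using False tail_box_01[of x0 s] tail_box_01[of x2 s] by auto
            then have "t < s" using t by (simp add: tail_box_def split: if_splits)
            then show ?thesis using col[of u] u le1(2)[of u] by auto
          qed
        qed
        then have sm: "sum a2 {s..<t1} + sum a0 {s..<t1} \<le> 2 * sum a1 {s..<t1}"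
          by (simp add: sum.distrib sum_distrib_left)
        show ?thesis unfolding split
          by (rule concave_arith[OF sm])
            (use t e1 \<open>?T2 (Suc t1) = 0\<close> \<open>?T1 (Suc t1) = 0\<close> \<open>?T0 (Suc t1) = 0\<close> in simp)
      qed
    qed
  qed
qed

section \<open>Column concavity under insertion and deletion\<close>

definition box_col :: "(nat \<Rightarrow> nat) \<Rightarrow> box \<Rightarrow> nat" where
  "box_col v b = box_row b + v (box_row b)"

definition left_box :: "(nat \<Rightarrow> nat) \<Rightarrow> box \<Rightarrow> nat \<Rightarrow> nat" where
  "left_box v b c = (if box_col v b < c then 1 else 0)"

lemma left_put:
  "box_row b < M \<Longrightarrow> left_cells M (put (Some b) v) c = left_cells M v c + left_box v b c"
  by (simp add: left_add_box left_box_def box_col_def)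

lemma step_col_cases:
  assumes "step v w (Some b) (Some (ColB t))"
  shows "w (box_row b) = v (box_row b) \<and> b = ColB t \<and> t + w t = box_col v b \<or>
    w (box_row b) = Suc (v (box_row b)) \<and> t + w t = Suc (box_col v b)"
  using assms by cases (auto simp: box_col_def)

lemma no_cell_in_column:
  assumes "strict_shape (add_box v t)" "strict_shape w" "w t = v t" "u + v u = t + v t"
  shows "w u \<noteq> Suc (v u)"
proof
  assume w: "w u = Suc (v u)"
  then have "t \<le> u" using strict_add_boxD(2)[OF assms(1), of u] assms(4) by (cases "t \<le> u") auto
  then show False using strict_shape_le[OF assms(2), of t u] w assms(3,4) by simp
qed

text \<open>The addable corner of column \<open>c\<close> stays free, so \<open>w / v\<close> has no
  cell in that column.\<close>

lemma left_skip_column: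
  assumes "vstrip v w" "strict_shape (add_box v t)" "strict_shape w" "w t = v t" "c = t + v t"
  shows "left_cells M w (Suc c) + left_cells M v c = left_cells M v (Suc c) + left_cells M w c"
proof -
  have "{u\<in>{..<M}. w u = Suc (v u) \<and> u + v u < Suc c} = {u\<in>{..<M}. w u = Suc (v u) \<and> u + v u < c}"
    using no_cell_in_column[OF assms(2-4)] assms(5) by (auto simp: less_Suc_eq)
  then show ?thesis unfolding left_vstrip[OF assms(1)] by simp
qed

lemma left_vstrip_mono:
  assumes "vstrip v w"
  shows "left_cells M w c + left_cells M v (Suc c) \<le> left_cells M v c + left_cells M w (Suc c)"
  unfolding left_vstrip[OF assms] by (auto intro!: card_mono)

lemma left_vstrip_step:
  assumes "vstrip v w" "w t = Suc (v t)" "c = t + v t" "t < M"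
  shows "left_cells M w c + left_cells M v (Suc c) < left_cells M v c + left_cells M w (Suc c)"
proof -
  have "{u\<in>{..<M}. w u = Suc (v u) \<and> u + v u < c} \<subset> {u\<in>{..<M}. w u = Suc (v u) \<and> u + v u < Suc c}"
    using assms by (auto simp: psubset_eq)
  from psubset_card_mono[OF _ this] show ?thesis unfolding left_vstrip[OF assms(1)] by simp
qed

text \<open>The only harmful column is one that the box enters by a turn and where it then stays.
  The second strip has no cell in it and the first has one in column \<open>c - 1\<close>, so the
  condition at \<open>c - 1\<close> provides the missing unit.\<close>

lemma col_concave_insert:
  assumes cc: "col_concave M a0 a1 a2"
    and st: "step a0 a1 (Some b0) (Some (ColB t1))" "step a1 a2 (Some (ColB t1)) (Some (ColB t2))"
    and below: "box_row b0 < M" "t1 < M" "t2 < M"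
    and vs: "vstrip a0 a1" "vstrip a1 a2"
    and ok: "box_ok a1 (Some (ColB t1))" "box_ok a2 (Some (ColB t2))"
  shows "col_concave M (put (Some b0) a0) (put (Some (ColB t1)) a1) (put (Some (ColB t2)) a2)"
  unfolding col_concave_def
proof
  fix c
  let ?K0 = "left_cells M a0" and ?K1 = "left_cells M a1" and ?K2 = "left_cells M a2"
  let ?d0 = "left_box a0 b0" and ?d1 = "left_box a1 (ColB t1)" and ?d2 = "left_box a2 (ColB t2)"
  have base: "?K2 (Suc c) + ?K0 c \<le> ?K1 (Suc c) + ?K1 c + 1" for c using cc by (simp add: col_concave_def)
  have "?K2 (Suc c) + ?d2 (Suc c) + (?K0 c + ?d0 c) \<le> ?K1 (Suc c) + ?d1 (Suc c) + (?K1 c + ?d1 c) + 1"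
  proof (cases "?d2 (Suc c) + ?d0 c \<le> ?d1 (Suc c) + ?d1 c")
    case True
    then show ?thesis using base[of c] by simp
  next
    case False
    note c1 = step_col_cases[OF st(1)] and c2 = step_col_cases[OF st(2)]
    have *: "t1 + a1 t1 = c" "c = Suc (box_col a0 b0)" "a2 t1 = a1 t1"
      "a1 (box_row b0) = Suc (a0 (box_row b0))"
      using False c1 c2 by (auto simp: left_box_def box_col_def split: if_splits)
    have sv: "strict_shape (add_box a1 t1)" "strict_shape a2" using ok by (auto simp: box_ok_def)
    have "?K2 (Suc c) + ?K1 c = ?K1 (Suc c) + ?K2 c"
      by (rule left_skip_column[OF vs(2) sv *(3) *(1)[symmetric]])
    moreover have "?K1 (box_col a0 b0) + ?K0 c < ?K0 (box_col a0 b0) + ?K1 c"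
      using left_vstrip_step[OF vs(1) *(4) _ below(1)] *(2) by (simp add: box_col_def)
    moreover have "?d2 (Suc c) + ?d0 c \<le> Suc (?d1 (Suc c) + ?d1 c)"
      using * by (auto simp: left_box_def box_col_def)
    ultimately show ?thesis using base[of "box_col a0 b0"] *(2) by simp
  qed
  then show "left_cells M (put (Some (ColB t2)) a2) (Suc c) + left_cells M (put (Some b0) a0) c
    \<le> left_cells M (put (Some (ColB t1)) a1) (Suc c) + left_cells M (put (Some (ColB t1)) a1) c + 1"
    using below by (simp add: left_put del: put.simps)
qed

text \<open>Harm is done only where the box first stays in column \<open>c\<close> and then turns
  into \<open>Suc c\<close>. The first strip has no cell in column \<open>c\<close>, and the
  condition at \<open>Suc c\<close>, where the boxes cancel, can be moved back to
  \<open>c\<close>.\<close>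

lemma col_concave_delete:
  assumes cc: "col_concave M (put (Some b0) a0) (put (Some (ColB t1)) a1) (put (Some (ColB t2)) a2)"
    and st: "step a0 a1 (Some b0) (Some (ColB t1))" "step a1 a2 (Some (ColB t1)) (Some (ColB t2))"
    and below: "box_row b0 < M" "t1 < M" "t2 < M"
    and vs: "vstrip a0 a1" "vstrip a1 a2"
    and ok: "box_ok a0 (Some b0)" "box_ok a1 (Some (ColB t1))"
  shows "col_concave M a0 a1 a2"
  unfolding col_concave_def
proof
  fix c
  let ?K0 = "left_cells M a0" and ?K1 = "left_cells M a1" and ?K2 = "left_cells M a2"
  let ?d0 = "left_box a0 b0" and ?d1 = "left_box a1 (ColB t1)" and ?d2 = "left_box a2 (ColB t2)"
  have base: "?K2 (Suc c) + ?d2 (Suc c) + (?K0 c + ?d0 c) \<le> ?K1 (Suc c) + ?d1 (Suc c) + (?K1 c + ?d1 c) + 1"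
    for c
    using cc[unfolded col_concave_def, rule_format, of c] below by (simp add: left_put del: put.simps)
  show "?K2 (Suc c) + ?K0 c \<le> ?K1 (Suc c) + ?K1 c + 1"
  proof (cases "?d1 (Suc c) + ?d1 c \<le> ?d2 (Suc c) + ?d0 c")
    case True
    then show ?thesis using base[of c] by simp
  next
    case False
    note c1 = step_col_cases[OF st(1)] and c2 = step_col_cases[OF st(2)]
    have *: "t1 + a1 t1 = c" "t2 + a2 t2 = Suc c" "b0 = ColB t1" "a1 t1 = a0 t1"
      using False c1 c2 by (auto simp: left_box_def box_col_def split: if_splits)
    have sv: "strict_shape (add_box a0 t1)" "strict_shape a1" using ok * by (auto simp: box_ok_def)
    have "?K1 (Suc c) + ?K0 c = ?K0 (Suc c) + ?K1 c"
      by (rule left_skip_column[OF vs(1) sv *(4)]) (use * in simp)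
    moreover have "?K2 (Suc c) + ?K1 (Suc (Suc c)) \<le> ?K1 (Suc c) + ?K2 (Suc (Suc c))"
      by (rule left_vstrip_mono[OF vs(2)])
    moreover have "?K2 (Suc (Suc c)) + ?K0 (Suc c) \<le> ?K1 (Suc (Suc c)) + ?K1 (Suc c) + 1"
      using base[of "Suc c"] * by (auto simp: left_box_def box_col_def)
    ultimately show ?thesis by linarith
  qed
qed

section \<open>Comparing two insertions\<close>

text \<open>Insertions into blocks \<open>k\<^sub>1 \<ge> k\<^sub>2\<close> keep the pair of boxes in the relation \<open>before\<close>, insertions
  into blocks \<open>k\<^sub>1 < k\<^sub>2\<close> keep it in the relation \<open>after\<close>; the first box is inserted into \<open>v\<close>.\<close>

fun before :: "(nat \<Rightarrow> nat) \<Rightarrow> box option \<Rightarrow> box option \<Rightarrow> bool" where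
  "before v None y \<longleftrightarrow> True"
| "before v (Some (RowB a)) (Some (RowB b)) \<longleftrightarrow> a < b"
| "before v (Some (RowB a)) (Some (ColB b)) \<longleftrightarrow> True"
| "before v (Some (ColB a)) (Some (ColB b)) \<longleftrightarrow> a + v a < b + add_box v a b"
| "before v _ _ \<longleftrightarrow> False"

fun after :: "(nat \<Rightarrow> nat) \<Rightarrow> box option \<Rightarrow> box option \<Rightarrow> bool" where
  "after v x None \<longleftrightarrow> True"
| "after v (Some (RowB a)) (Some (RowB b)) \<longleftrightarrow> b \<le> a"
| "after v (Some (ColB a)) (Some (RowB b)) \<longleftrightarrow> True"
| "after v (Some (ColB a)) (Some (ColB b)) \<longleftrightarrow> b + add_box v a b \<le> a + v a"
| "after v _ _ \<longleftrightarrow> False"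

text \<open>Row \<open>t\<close> lies weakly below row \<open>b\<close>, hence row \<open>b\<close>
  of \<open>w\<close> must reach at least the column where row \<open>t\<close> ends.\<close>

lemma col_bump:
  assumes "strict_shape (add_box v b)" "strict_shape w" "vstrip v w"
    "t + w t = Suc (b + v b)" "t + v t \<le> b + v b" "0 < w t"
  shows "w b = Suc (v b)"
proof -
  have "b \<le> t" using strict_add_boxD(2)[OF assms(1), of t] assms(5) by (cases "b \<le> t") auto
  then show ?thesis
    using strict_shape_le[OF assms(2), of b t] assms(4,6) vstripD[OF assms(3), of b] by auto
qed

text \<open>The danger is that the first box turns into the column of the second while the second
  stays. By \<open>col_bump\<close> the second is bumped in this case too.\<close>

lemma before_step_turn:
  assumes "box_ok (add_box v a) (Some (ColB b))" "box_ok (add_box w t) y2"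
    and vs: "vstrip v w" "vstrip (add_box v a) (add_box w t)"
    and s1: "t + w t = Suc (a + v a)"
    and s2: "step (add_box v a) (add_box w t) (Some (ColB b)) y2"
    and cb: "a + v a < b + add_box v a b"
  shows "before w (Some (ColB t)) y2"
proof -
  have sv: "strict_shape (add_box (add_box v a) b)" "strict_shape (add_box w t)"
    using assms(1,2) by (auto simp: box_ok_def)
  show ?thesis
    using s2
  proof cases
    case (turn a' t')
    then show ?thesis using cb s1 by auto
  next
    case stay
    show ?thesis
    proof (rule ccontr)
      assume "\<not> before w (Some (ColB t)) y2"
      then have c: "b + add_box v a b = Suc (a + v a)" using stay cb s1 by auto
      have "t + add_box v a t \<le> b + add_box v a b"
        using s1 c vstripD[OF vs(1), of t] by (auto simp: add_box_apply)
      then have "add_box w t b = Suc (add_box v a b)"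
        using col_bump[OF sv vs(2), of t] s1 c by (simp add: add_box_apply)
      then show False using stay by simp
    qed
  qed
qed

text \<open>The row where the first insertion arrives is not free for the second: it grows now, or,
  if the first box did not move, the second was already below it.\<close>

lemma step_before:
  assumes s1: "step v w x1 y1" and s2: "step (put x1 v) (put y1 w) x2 y2"
    and b: "before v x1 x2" and start: "y1 \<noteq> None \<Longrightarrow> y2 \<noteq> None"
    and vs: "vstrip v w" "vstrip (put x1 v) (put y1 w)"
    and ok: "box_ok v x1" "box_ok w y1" "box_ok (put x1 v) x2" "box_ok (put y1 w) y2"
  shows "before w y1 y2"
  using s1
proof cases
  case none
  then show ?thesis by simp
next
  case (start t)
  then obtain y where y: "y2 = Some y" using assms(4) by auto
  show ?thesis
  proof (cases y)
    case (RowB b)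
    have "add_box w t b = v b" using s2 unfolding y RowB start by cases auto
    then have "t < b" using start(3)[of b] start(4)
      by (cases b t rule: linorder_cases) (auto simp: add_box_apply)
    then show ?thesis using start y RowB by simp
  qed (use start y in simp)
next
  case (row a t)
  then obtain y where y: "y2 = Some y" using assms(4) by auto
  show ?thesis
  proof (cases y)
    case (RowB c)
    from s2[unfolded y RowB row put.simps box_row.simps] have "t < c"
    proof cases
      case start
      then show ?thesis using b row by simp
    next
      case r: (row b')
      have "a < c" using r b row(1) by simp
      then show ?thesis using r(4) row(4)[of c] row(5)
        by (cases c t rule: linorder_cases) (auto simp: add_box_apply split: if_splits)
    qed
    then show ?thesis using row y RowB by simp
  qed (use row y in simp)
next
  case (turn x a t)
  have px: "put x1 v = add_box v a" "put y1 w = add_box w t" using turn by auto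
  \<comment> \<open>Below a diagonal box no row can take another box, so \<open>before\<close>
    leaves only a column box for the second insertion.\<close>
  have "\<exists>b. x2 = Some (ColB b) \<and> a + v a < b + add_box v a b"
    using turn(3)
  proof
    assume x: "x = RowB a \<and> v a = 0"
    obtain b' where b': "x2 = Some b'" using b turn x by (cases x2) auto
    have sv: "strict_shape (add_box v a)" "strict_shape (add_box (add_box v a) (box_row b'))"
      using ok(3) b' px by (auto simp: box_ok_def)
    have le: "box_row b' \<le> a"
      using strict_add_boxD(1)[OF sv(2), of a] x by (cases "box_row b' \<le> a") (auto simp: add_box_apply)
    show ?thesis
    proof (cases b')
      case (RowB b'')
      then show ?thesis using le b b' turn(1) x by simp
    next
      case (ColB b'')
      then show ?thesis using strict_shape_le[OF sv(1), of b'' a] le b' x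
        by (simp add: add_box_apply split: if_splits)
    qed
  next
    assume "x = ColB a"
    then show ?thesis using b turn(1) by (cases x2; cases "the x2") auto
  qed
  then obtain b where b: "x2 = Some (ColB b)" "a + v a < b + add_box v a b" by blast
  have "before w (Some (ColB t)) y2"
    by (rule before_step_turn[where v = v and a = a and b = b])
      (use ok(3,4) vs s2 turn(5) b px in auto)
  then show ?thesis using turn(2) by simp
next
  case (stay a)
  then obtain b where b: "x2 = Some (ColB b)" "a + v a < b + add_box v a b"
    using b by (cases x2; cases "the x2") auto
  from s2[unfolded b stay put.simps box_row.simps] show ?thesis
    by cases (use stay b(2) in auto)
qed

text \<open>The row that the first box leaves no longer grows for the second insertion, which
  therefore stops there or above. In column mode a bump of the second box forces the first one far
  enough to the right.\<close>

lemma step_after: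
  assumes s1: "step v w x1 y1" and s2: "step (put x1 v) (put y1 w) x2 y2"
    and af: "after v x1 x2" and start: "x1 = None \<Longrightarrow> y2 = None"
    and vs: "vstrip v w" "vstrip (put x1 v) (put y1 w)"
    and ok: "box_ok v x1" "box_ok w y1" "box_ok (put x1 v) x2" "box_ok (put y1 w) y2"
  shows "after w y1 y2"
proof (cases y2)
  case None
  then show ?thesis by simp
next
  case (Some y)
  then obtain b1 where b1: "x1 = Some b1" using start by (cases x1) auto
  then obtain c1 where c1: "y1 = Some c1" using s1 step_Some by (cases y1) auto
  have row: "w' a = v' a" if "x1 = Some (RowB a)" "y1 = Some (RowB t)" "w' = put y1 w" "v' = put x1 v"
    for a t v' w'
    using s1 unfolding that by cases (auto simp: add_box_apply le_less)
  have top: "a \<le> t" if "x1 = Some (RowB a)" "y1 = Some (RowB t)" for a t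
    using s1 unfolding that by cases auto
  show ?thesis
  proof (cases x2)
    case None
    obtain t2 where y: "y = RowB t2" "\<And>u. u < t2 \<Longrightarrow> put y1 w u = Suc (put x1 v u)"
      using s2 unfolding None Some by cases auto
    show ?thesis
    proof (cases c1)
      case (RowB t)
      obtain a where a: "b1 = RowB a" using s1 unfolding b1 c1 RowB by cases auto
      have "\<not> a < t2" using y(2)[of a] row[OF b1[unfolded a] c1[unfolded RowB] refl refl] by auto
      then show ?thesis using top[OF b1[unfolded a] c1[unfolded RowB]] Some y c1 RowB by simp
    qed (simp add: Some y c1)
  next
    case x2: (Some b2)
    show ?thesis
    proof (cases b2)
      case (RowB b)
      from s2[unfolded Some x2 RowB] show ?thesis
      proof cases
        case r: (row t2)
        show ?thesis
        proof (cases c1)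
          case (RowB t)
          obtain a where a: "b1 = RowB a" using s1 unfolding b1 c1 RowB by cases auto
          have "b \<le> a" using af b1 a x2 \<open>b2 = RowB b\<close> by simp
          then have "\<not> a < t2" using r(3)[of a] row[OF b1[unfolded a] c1[unfolded RowB] refl refl] by auto
          then show ?thesis using top[OF b1[unfolded a] c1[unfolded RowB]] Some r c1 RowB by simp
        qed (simp add: Some r c1)
      next
        case tn: (turn b' t2)
        then have z: "put x1 v b = 0" "put y1 w b = 1" "t2 + put y1 w t2 = Suc b" "y = ColB t2" by auto
        have sv: "strict_shape (add_box v (box_row b1))" "strict_shape (add_box (add_box v (box_row b1)) b)"
          using ok(3) b1 x2 \<open>b2 = RowB b\<close> by (auto simp: box_ok_def)
        have ab: "box_row b1 < b"
          using strict_shape_zero[OF sv(1), of b "box_row b1"] z(1) b1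
          by (cases "box_row b1 < b") (auto simp: add_box_apply)
        obtain a where a: "b1 = ColB a"
          using af b1 x2 \<open>b2 = RowB b\<close> ab by (cases b1) auto
        have ge: "b \<le> a + v a"
          using strict_add_boxD(2)[OF sv(2) ab] z(1) a b1 by (simp add: add_box_apply split: if_splits)
        obtain t where t: "c1 = ColB t" using s1 unfolding b1 c1 a by cases auto
        have "Suc b \<le> t + w t"
          using s1[unfolded b1 c1 a t]
        proof cases
          case (turn a')
          then show ?thesis using ge by simp
        next
          case stay
          have "w b = 1" using z(2) ab a c1 t stay by (simp add: add_box_apply split: if_splits)
          moreover have "strict_shape w" using ok(2) by (simp add: box_ok_def)
          ultimately have "b + 1 \<le> a + w a" using strict_shape_less(1)[of w a b] ab a by simp
          then show ?thesis using stay by simp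
        qed
        then show ?thesis using Some z(3,4) c1 t by simp
      qed
    next
      case (ColB b)
      obtain a where a: "b1 = ColB a" and cb: "b + add_box v a b \<le> a + v a"
        using af b1 x2 ColB by (cases b1) auto
      obtain t where t: "c1 = ColB t" using s1 unfolding b1 c1 a by cases auto
      have v': "put x1 v = add_box v a" using b1 a by simp
      have w': "put y1 w = add_box w t" using c1 t by simp
      have mono: "a + v a \<le> t + w t"
        using step_col_cases[of v w b1 t] s1 b1 c1 a t by (auto simp: box_col_def)
      from s2[unfolded Some x2 ColB] show ?thesis
      proof cases
        case tn: (turn b' t2)
        then have z: "add_box w t b = Suc (add_box v a b)" "t2 + add_box w t t2 = Suc (b + add_box v a b)"
          "y = ColB t2" using v' w' by auto
        have "Suc (b + add_box v a b) \<le> t + w t"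
          using s1[unfolded b1 c1 a t]
        proof cases
          case (turn a')
          then show ?thesis using cb by simp
        next
          case stay
          have sv: "strict_shape w" "strict_shape (add_box v a)"
            using ok(2) ok(1) b1 a by (auto simp: box_ok_def)
          show ?thesis
          proof (rule ccontr)
            assume "\<not> Suc (b + add_box v a b) \<le> t + w t"
            then have e: "b + add_box v a b = a + v a" using cb stay by simp
            consider "b < a" | "b = a" | "a < b" by linarith
            then show False
            proof cases
              case 1
              then show ?thesis using strict_shape_less(1)[OF sv(2) 1] e by (simp add: add_box_apply)
            next
              case 2
              then show ?thesis using e by (simp add: add_box_apply)
            next
              case 3
              have "w b = Suc (add_box v a b)" using z(1) 3 stay by (simp add: add_box_apply)
              then show ?thesis using strict_shape_less(1)[OF sv(1) 3] e stay by simp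
            qed
          qed
        qed
        then show ?thesis using Some z c1 t by simp
      next
        case stay
        then show ?thesis using Some c1 t cb mono v' w' by simp
      qed
    qed
  qed
qed

text \<open>A box is labelled by its row and by whether its entry is unprimed; entries of diagonal
  cells count as unprimed.\<close>

definition label :: "(nat \<Rightarrow> nat) \<Rightarrow> box \<Rightarrow> bool \<times> nat" where
  "label v b = (b = ColB (box_row b) \<or> v (box_row b) = 0, box_row b)"

fun precedes :: "bool \<times> nat \<Rightarrow> bool \<times> nat \<Rightarrow> bool" where
  "precedes (c1, t1) (c2, t2) \<longleftrightarrow> (if c2 then c1 \<longrightarrow> t2 \<le> t1 else \<not> c1 \<and> t1 < t2)"

text \<open>Of two successive boxes, one further right is higher up; so the comparison of columns in
  \<open>before\<close> becomes one of rows.\<close>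

lemma before_precedes:
  assumes "before v (Some b1) (Some b2)" "box_ok (put (Some b1) v) (Some b2)"
  shows "precedes (label v b1) (label (put (Some b1) v) b2)"
proof -
  obtain t1 t2 where t: "t1 = box_row b1" "t2 = box_row b2" by blast
  have sv: "strict_shape (add_box (add_box v t1) t2)" using assms(2) t by (simp add: box_ok_def)
  have d: "t2 \<le> t1" if "v t1 = 0"
    using strict_add_boxD(1)[OF sv, of t1] that by (cases "t2 \<le> t1") (auto simp: add_box_apply)
  have c: "t2 \<le> t1" if "t1 + v t1 < t2 + add_box v t1 t2"
    using strict_add_boxD(2)[OF sv, of t1] that by (cases "t2 \<le> t1") (auto simp: add_box_apply)
  show ?thesis
    using assms(1) d c t by (cases b1; cases b2) (auto simp: label_def)
qed

lemma after_not_precedes: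
  assumes "after v (Some b1) (Some b2)" "box_ok (put (Some b1) v) (Some b2)"
  shows "\<not> precedes (label v b1) (label (put (Some b1) v) b2)"
proof -
  obtain t1 t2 where t: "t1 = box_row b1" "t2 = box_row b2" by blast
  have sv: "strict_shape (add_box v t1)" using assms(2) t by (simp add: box_ok_def)
  have d: "add_box v t1 t2 \<noteq> 0" if "t2 \<le> t1"
  proof
    assume "add_box v t1 t2 = 0"
    from strict_shape_zero[OF sv that this] show False by (simp add: add_box_apply)
  qed
  have c: "\<not> t2 \<le> t1" if "t2 + add_box v t1 t2 \<le> t1 + v t1"
    using strict_shape_le[OF sv, of t2 t1] that by (auto simp: add_box_apply)
  show ?thesis
    using assms(1) d c t by (cases b1; cases b2) (auto simp: label_def)
qed

section \<open>Concave concave_chains\<close>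

text \<open>At \<open>k = 0\<close> truncated subtraction makes the condition concern
  \<open>Y 0\<close>, \<open>Y 0\<close>, \<open>Y 1\<close>: block 1 has at most one cell. The
  shapes live in the rows \<open>< n\<close>, but a box can still be added in row \<open>n\<close>,
  whence the bound \<open>Suc n\<close>.\<close>

definition concave_chains :: "nat \<Rightarrow> (nat \<Rightarrow> nat \<Rightarrow> nat) set" where
  "concave_chains n = {Y. Y 0 = (\<lambda>_. 0) \<and> (\<forall>k. strict_shape (Y k) \<and> vstrip (Y k) (Y (Suc k)) \<and>
     row_concave (Suc n) (Y (k - 1)) (Y k) (Y (Suc k))) \<and> (\<forall>k\<ge>n. Y k = Y n)}"

definition block_size :: "nat \<Rightarrow> (nat \<Rightarrow> nat \<Rightarrow> nat) \<Rightarrow> nat \<Rightarrow> nat" where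
  "block_size n Y k = tail_cells (Suc n) (Y k) 0 - tail_cells (Suc n) (Y (k - 1)) 0"

definition box_path :: "nat \<Rightarrow> (nat \<Rightarrow> nat \<Rightarrow> nat) \<Rightarrow> (nat \<Rightarrow> box option) \<Rightarrow> bool" where
  "box_path k0 Y x \<longleftrightarrow> (\<forall>k. (x k = None \<longleftrightarrow> k < k0) \<and> box_ok (Y k) (x k) \<and>
     step (Y k) (Y (Suc k)) (x k) (x (Suc k)))"

definition inserts :: "nat \<Rightarrow> (nat \<Rightarrow> nat \<Rightarrow> nat) \<Rightarrow> nat \<Rightarrow> (nat \<Rightarrow> nat \<Rightarrow> nat) \<Rightarrow> box \<Rightarrow> bool" where
  "inserts n Y' k0 Y b \<longleftrightarrow> Y' \<in> concave_chains n \<and> Y \<in> concave_chains n \<and> 1 \<le> k0 \<and> k0 \<le> n \<and>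
     (\<exists>x. box_path k0 Y' x \<and> x n = Some b \<and> Y = (\<lambda>k. put (x k) (Y' k)))"

section \<open>Bounds on the shapes of a chain\<close>

lemma vstrip_refl: "vstrip v v" by (simp add: vstrip_def)

lemma concave_chainsD:
  assumes "Y \<in> concave_chains n"
  shows "Y 0 = (\<lambda>_. 0)" "strict_shape (Y k)" "vstrip (Y k) (Y (Suc k))"
    "row_concave (Suc n) (Y (k - 1)) (Y k) (Y (Suc k))" "n \<le> k \<Longrightarrow> Y k = Y n"
    "vstrip (Y (k - 1)) (Y k)"
proof -
  show "Y 0 = (\<lambda>_. 0)" "strict_shape (Y k)" "vstrip (Y k) (Y (Suc k))"
    "row_concave (Suc n) (Y (k - 1)) (Y k) (Y (Suc k))" "n \<le> k \<Longrightarrow> Y k = Y n" for k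
    using assms unfolding concave_chains_def mem_Collect_eq by blast+
  then show "vstrip (Y (k - 1)) (Y k)"
    by (cases k) (auto simp: vstrip_refl)
qed

lemma chainsI:
  assumes "Y 0 = (\<lambda>_. 0)" "\<And>k. strict_shape (Y k)" "\<And>k. vstrip (Y k) (Y (Suc k))"
    "\<And>k. row_concave (Suc n) (Y (k - 1)) (Y k) (Y (Suc k))" "\<And>k. n \<le> k \<Longrightarrow> Y k = Y n"
  shows "Y \<in> concave_chains n"
  using assms unfolding concave_chains_def mem_Collect_eq by blast

lemma chain_first_row:
  assumes "Y \<in> concave_chains n"
  shows "Y k 0 \<le> k"
proof (induction k)
  case 0
  then show ?case using concave_chainsD(1)[OF assms] by simp
next
  case (Suc k)
  then show ?case using vstripD[OF concave_chainsD(3)[OF assms, of k], of 0] by auto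
qed

lemma chain_empty_row:
  assumes "Y \<in> concave_chains n" "n \<le> u"
  shows "Y k u = 0"
proof -
  have "Y (min k n) 0 \<le> u" using chain_first_row[OF assms(1), of "min k n"] assms(2) by simp
  moreover have "Y k = Y (min k n)" using concave_chainsD(5)[OF assms(1), of k] by (simp add: min_def)
  ultimately show ?thesis using strict_shape_support[OF concave_chainsD(2)[OF assms(1)]] by metis
qed

lemma chain_box_below:
  assumes "Y \<in> concave_chains n" "box_ok (Y k) x"
  shows "box_below (Suc n) x"
  unfolding box_below_def
proof (intro allI impI)
  fix b assume b: "x = Some b"
  show "box_row b < Suc n"
  proof (cases "box_row b")
    case (Suc t)
    have "Suc (Y k (box_row b)) < Y k t"
      using strict_add_boxD(1)[of "Y k" "box_row b" t] assms(2) b Suc by (simp add: box_ok_def)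
    then have "t < n" using chain_empty_row[OF assms(1), of t k] by (cases "t < n") auto
    then show ?thesis using Suc by simp
  qed simp
qed

lemma tail_mono_vstrip: "vstrip v w \<Longrightarrow> tail_cells M v s \<le> tail_cells M w s"
  by (simp add: tail_vstrip)

lemma block_size_concave:
  assumes "Y \<in> concave_chains n"
  shows "block_size n Y (Suc k) \<le> Suc (block_size n Y k)"
  using concave_chainsD(4)[OF assms, of k, unfolded row_concave_def, rule_format, of 0]
    tail_mono_vstrip[OF concave_chainsD(6)[OF assms, of k], of "Suc n" 0]
  unfolding block_size_def by simp

section \<open>Insertion paths through a whole chain\<close>

lemma box_pathD:
  assumes "box_path k0 Y x"
  shows "x k = None \<longleftrightarrow> k < k0" "box_ok (Y k) (x k)" "step (Y k) (Y (Suc k)) (x k) (x (Suc k))"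
  using assms unfolding box_path_def by blast+

lemma path_step_pred:
  assumes "box_path k0 Y x" "1 \<le> k0"
  shows "step (Y (k - 1)) (Y k) (x (k - 1)) (x k)"
proof (cases k)
  case 0
  then have "x k = None" using assms box_pathD(1)[OF assms(1), of k] by simp
  then show ?thesis using 0 by (auto intro: step.none)
next
  case (Suc j)
  then show ?thesis using box_pathD(3)[OF assms(1), of j] by simp
qed

lemma step_stationary:
  assumes "step v v x y" "x \<noteq> None" "box_ok v x" "box_ok v y"
  shows "y = x"
proof -
  obtain b where b: "x = Some b" using assms(2) by auto
  have "step v v x x" unfolding b
    by (cases b) (auto intro!: step.row step.stay)
  moreover have "y \<noteq> None" using assms(1) b step_Some by blast
  ultimately show ?thesis using step_deterministic[OF assms(1), of x] assms by auto
qed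

lemma path_stationary:
  assumes "box_path k0 Y x" "Y \<in> concave_chains n" "k0 \<le> n" "n \<le> k"
  shows "x k = x n"
  using assms(4)
proof (induction rule: dec_induct)
  case (step j)
  have "step (Y j) (Y j) (x j) (x (Suc j))" "x j \<noteq> None" "box_ok (Y j) (x j)" "box_ok (Y j) (x (Suc j))"
    using assms(3) step concave_chainsD(5)[OF assms(2), of j] concave_chainsD(5)[OF assms(2), of "Suc j"]
      box_pathD[OF assms(1), of j] box_pathD(2)[OF assms(1), of "Suc j"] by auto
  then have "x (Suc j) = x j" by (rule step_stationary)
  then show ?case using step by simp
qed simp

text \<open>Rows \<open>a\<close> to \<open>s\<close> give the second strip at least
  \<open>s + 1 - a\<close> cells, while the first has at most \<open>s - a\<close> cells in the rows
  \<open>\<ge> a\<close>. The case \<open>d = 1\<close> is for a starting box, where the block sizes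
  give an extra unit; \<open>d = 0\<close> is for a box in row mode, where the first strip misses
  row \<open>a\<close>.\<close>

lemma run_too_long:
  assumes Y: "Y \<in> concave_chains n" and z: "Y k s = 0" and as: "a \<le> s"
    and run: "\<And>u. a \<le> u \<Longrightarrow> u \<le> s \<Longrightarrow> Y (Suc k) u = Suc (Y k u)"
    and cc: "tail_cells (Suc n) (Y (Suc k)) a + tail_cells (Suc n) (Y (k - 1)) a + d
      \<le> 2 * tail_cells (Suc n) (Y k) a + 1"
    and d: "sum (Y k) {a..<s} + 1 \<le> sum (Y (k - 1)) {a..<s} + (s - a) + d"
  shows False
proof -
  have "Y (Suc k) s \<noteq> 0" using run[of s] as by simp
  then have sn: "Suc s \<le> Suc n" using chain_empty_row[OF Y, of s "Suc k"] by (cases "s < n") auto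
  let ?T = "\<lambda>k. tail_cells (Suc n) (Y k)"
  have "Y k u = 0" if "s \<le> u" for u using strict_shape_zero[OF concave_chainsD(2)[OF Y] that z] .
  then have t0: "?T k s = 0" unfolding tail_cells_def by auto
  have "?T (Suc k) a \<ge> sum (Y (Suc k)) {a..<Suc s}"
    using tail_split[of a "Suc s" "Suc n" "Y (Suc k)"] as sn by simp
  moreover have "sum (Y (Suc k)) {a..<Suc s} = sum (Y k) {a..<Suc s} + (Suc s - a)"
    by (rule sum_run) (use run in auto)
  moreover have "sum (Y k) {a..<Suc s} = sum (Y k) {a..<s}" using z as by simp
  moreover have "?T k a = sum (Y k) {a..<s}"
    using tail_split[of a s "Suc n" "Y k"] as sn t0 by simp
  moreover have "?T (k - 1) a \<ge> sum (Y (k - 1)) {a..<s}"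
    using tail_split[of a s "Suc n" "Y (k - 1)"] as sn by simp
  ultimately show False using cc d as by linarith
qed

lemma path_exists:
  assumes Y: "Y \<in> concave_chains n" and k0: "1 \<le> k0"
    and size: "block_size n Y k0 \<le> block_size n Y (k0 - 1)"
  shows "\<exists>x. box_path k0 Y x"
proof -
  \<comment> \<open>The last conjunct strengthens the induction: a row box sits in a row that did
    not grow in the preceding step, which is what \<open>run_too_long\<close> asks for with
    \<open>d = 0\<close>.\<close>
  define P where "P k x \<longleftrightarrow> (x = None \<longleftrightarrow> k < k0) \<and> box_ok (Y k) x \<and>
    (\<forall>t. x = Some (RowB t) \<longrightarrow> Y k t = Y (k - 1) t)" for k x
  have "\<exists>x. \<forall>k. P k (x k) \<and> step (Y k) (Y (Suc k)) (x k) (x (Suc k))"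
  proof (rule dependent_nat_choice)
    show "\<exists>x. P 0 x"
      using k0 concave_chainsD(2)[OF Y, of 0] by (intro exI[of _ None]) (auto simp: P_def box_ok_def)
  next
    fix k x assume P: "P k x"
    note Y' = concave_chainsD(2)[OF Y, of k] concave_chainsD(2)[OF Y, of "Suc k"] concave_chainsD(3)[OF Y, of k]
    have "\<exists>y. step (Y k) (Y (Suc k)) x y \<and> box_ok (Y (Suc k)) y \<and> (y = None \<longleftrightarrow> Suc k < k0)"
    proof (cases x)
      case None
      show ?thesis
      proof (cases "Suc k < k0")
        case True
        then show ?thesis using None Y'(2)
          by (intro exI[of _ None]) (auto simp: box_ok_def intro: step.none)
      next
        case False
        then have k: "Suc k = k0" using P None by (auto simp: P_def)
        have "\<exists>y. y \<noteq> None \<and> step (Y k) (Y (Suc k)) None y \<and> box_ok (Y (Suc k)) y"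
        proof (rule step_start_exists[OF Y'])
          fix s assume s: "Y k s = 0" "\<And>u. u \<le> s \<Longrightarrow> Y (Suc k) u = Suc (Y k u)"
          show False
          proof (rule run_too_long[OF Y s(1), of 0 1])
            show "tail_cells (Suc n) (Y (Suc k)) 0 + tail_cells (Suc n) (Y (k - 1)) 0 + 1
                \<le> 2 * tail_cells (Suc n) (Y k) 0 + 1"
              using size k[symmetric] tail_mono_vstrip[OF concave_chainsD(6)[OF Y, of k], of "Suc n" 0]
                tail_mono_vstrip[OF Y'(3), of "Suc n" 0]
              by (simp add: block_size_def)
            show "sum (Y k) {0..<s} + 1 \<le> sum (Y (k - 1)) {0..<s} + (s - 0) + 1"
              using sum_vstrip_le[OF concave_chainsD(6)[OF Y, of k], of 0 s] by simp
          qed (use s in auto)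
        qed
        then show ?thesis using None k by auto
      qed
    next
      case (Some b)
      have ne: "\<not> Suc k < k0" using P Some by (auto simp: P_def)
      have "\<exists>y. step (Y k) (Y (Suc k)) x y \<and> box_ok (Y (Suc k)) y"
      proof (cases b)
        case (RowB a)
        have e: "Y k a = Y (k - 1) a" using P Some RowB by (auto simp: P_def)
        have ok: "box_ok (Y k) (Some (RowB a))" using P Some RowB by (simp add: P_def)
        have "\<exists>y. step (Y k) (Y (Suc k)) (Some (RowB a)) y \<and> box_ok (Y (Suc k)) y"
        proof (rule step_row_exists[OF ok Y'(2,3)])
          fix s assume s: "a < s" "Y k s = 0" "\<And>u. a \<le> u \<Longrightarrow> u \<le> s \<Longrightarrow> Y (Suc k) u = Suc (Y k u)"
          show False
          proof (rule run_too_long[OF Y s(2), of a 0])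
            show "tail_cells (Suc n) (Y (Suc k)) a + tail_cells (Suc n) (Y (k - 1)) a + 0
                \<le> 2 * tail_cells (Suc n) (Y k) a + 1"
              using concave_chainsD(4)[OF Y, of k] by (simp add: row_concave_def)
            show "sum (Y k) {a..<s} + 1 \<le> sum (Y (k - 1)) {a..<s} + (s - a) + 0"
              using sum_vstrip_less[OF concave_chainsD(6)[OF Y, of k] s(1) e] by simp
          qed (use s in auto)
        qed
        then show ?thesis using Some RowB by simp
      next
        case (ColB a)
        have ok: "box_ok (Y k) (Some (ColB a))" using P Some ColB by (simp add: P_def)
        show ?thesis using step_col_exists[OF ok Y'(2,3)] Some ColB by simp
      qed
      then show ?thesis using Some step_Some ne by blast
    qed
    then obtain y where y: "step (Y k) (Y (Suc k)) x y" "box_ok (Y (Suc k)) y" "y = None \<longleftrightarrow> Suc k < k0"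
      by blast
    have "Y (Suc k) t = Y k t" if "y = Some (RowB t)" for t
      using y(1) unfolding that by cases auto
    then show "\<exists>y. P (Suc k) y \<and> step (Y k) (Y (Suc k)) x y"
      using y by (intro exI[of _ y]) (auto simp: P_def)
  qed
  then obtain x where x: "P k (x k)" "step (Y k) (Y (Suc k)) (x k) (x (Suc k))" for k by blast
  have "box_path k0 Y x"
    unfolding box_path_def using x(1)[unfolded P_def] x(2) by simp
  then show ?thesis by (rule exI[of _ x])
qed

lemma path_unique:
  assumes "box_path k0 Y x" "box_path k0 Y x'" "1 \<le> k0"
  shows "x = x'"
proof (rule ext)
  fix k show "x k = x' k"
  proof (induction k)
    case 0
    show ?case using box_pathD(1)[OF assms(1), of 0] box_pathD(1)[OF assms(2), of 0] assms(3) by simp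
  next
    case (Suc k)
    have "step (Y k) (Y (Suc k)) (x k) (x (Suc k))" "step (Y k) (Y (Suc k)) (x k) (x' (Suc k))"
      "box_ok (Y (Suc k)) (x (Suc k))" "box_ok (Y (Suc k)) (x' (Suc k))"
      "x (Suc k) = None \<longleftrightarrow> x' (Suc k) = None"
      using box_pathD[OF assms(1), of k] box_pathD(2)[OF assms(1), of "Suc k"] Suc
        box_pathD[OF assms(2), of k] box_pathD(2)[OF assms(2), of "Suc k"]
        box_pathD(1)[OF assms(1), of "Suc k"] box_pathD(1)[OF assms(2), of "Suc k"] by auto
    then show ?case by (rule step_deterministic)
  qed
qed

lemma path_col:
  assumes "box_path k0 Y x" "1 \<le> k0" "x k = Some (ColB t)"
  obtains b t' where "x (k - 1) = Some b" "x (Suc k) = Some (ColB t')"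
proof -
  have "\<exists>b. x (k - 1) = Some b"
    using path_step_pred[OF assms(1,2), of k] unfolding assms(3) by cases auto
  moreover have "step (Y k) (Y (Suc k)) (Some (ColB t)) (x (Suc k))"
    using box_pathD(3)[OF assms(1), of k] assms(3) by simp
  then have "\<exists>t'. x (Suc k) = Some (ColB t')" by cases auto
  ultimately show ?thesis using that by blast
qed

text \<open>Triples are sorted by the box of the middle shape. A column box there has a box before
  it and a column box after it, so the column form is preserved and is then turned back into the row
  form; in all other cases the row form is preserved directly.\<close>

lemma path_insert_chain:
  assumes Y: "Y \<in> concave_chains n" and x: "box_path k0 Y x" and k0: "1 \<le> k0" "k0 \<le> n"
    and size: "block_size n Y k0 \<le> block_size n Y (k0 - 1)"
  shows "(\<lambda>k. put (x k) (Y k)) \<in> concave_chains n"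
proof -
  let ?Z = "\<lambda>k. put (x k) (Y k)"
  have ok: "box_ok (Y k) (x k)" for k using box_pathD[OF x] by blast
  have st: "step (Y k) (Y (Suc k)) (x k) (x (Suc k))" for k using box_pathD[OF x] by blast
  have below: "box_below (Suc n) (x k)" for k using chain_box_below[OF Y ok] .
  have strict: "strict_shape (?Z k)" for k using ok[of k] by (simp add: box_ok_def)
  have vs: "vstrip (?Z k) (?Z (Suc k))" for k
    by (rule step_vstrip[OF st concave_chainsD(3)[OF Y] ok ok])
  have vs': "vstrip (?Z (k - 1)) (?Z k)" for k
    using vs[of "k - 1"] by (cases k) (auto simp: vstrip_refl)
  have rc: "row_concave (Suc n) (?Z (k - 1)) (?Z k) (?Z (Suc k))" for k
  proof (cases "\<exists>t. x k = Some (ColB t)")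
    case False
    show ?thesis
    proof (rule row_concave_insert[OF concave_chainsD(4)[OF Y] path_step_pred[OF x k0(1)] st])
      show "x k \<noteq> Some (ColB t)" for t using False by blast
      assume "x k = None" "x (Suc k) \<noteq> None"
      then have "k0 = Suc k" using box_pathD(1)[OF x, of k] box_pathD(1)[OF x, of "Suc k"] by simp
      then show "tail_cells (Suc n) (Y (Suc k)) 0 + tail_cells (Suc n) (Y (k - 1)) 0
          \<le> 2 * tail_cells (Suc n) (Y k) 0"
        using size tail_mono_vstrip[OF concave_chainsD(6)[OF Y, of k], of "Suc n" 0]
          tail_mono_vstrip[OF concave_chainsD(3)[OF Y, of k], of "Suc n" 0]
        by (simp add: block_size_def)
    qed (rule below concave_chainsD(3,6)[OF Y] ok)+
  next
    case True
    then obtain t where t: "x k = Some (ColB t)" by blast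
    obtain b t' where b: "x (k - 1) = Some b" "x (Suc k) = Some (ColB t')"
      using path_col[OF x k0(1) t] .
    have "col_concave (Suc n) (Y (k - 1)) (Y k) (Y (Suc k))"
      by (rule row_concave_imp_col[OF concave_chainsD(2,6,3,4)[OF Y]])
    then have "col_concave (Suc n) (?Z (k - 1)) (?Z k) (?Z (Suc k))"
      unfolding b t
    proof (rule col_concave_insert)
      show "step (Y (k - 1)) (Y k) (Some b) (Some (ColB t))"
        using path_step_pred[OF x k0(1), of k] unfolding b t .
      show "step (Y k) (Y (Suc k)) (Some (ColB t)) (Some (ColB t'))" using st[of k] unfolding b t .
      show "box_row b < Suc n" using below[of "k - 1"] unfolding b by (simp add: box_below_def)
      show "box_ok (Y (Suc k)) (Some (ColB t'))" using ok[of "Suc k"] unfolding b .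
    qed (use below[of k] below[of "Suc k"] ok[of k] b t concave_chainsD(3,6)[OF Y, of k]
      in \<open>simp_all add: box_below_def\<close>)
    then show ?thesis
      by (rule col_concave_imp_row[OF strict strict strict vs' vs])
  qed
  have stat: "?Z k = ?Z n" if "n \<le> k" for k
    using path_stationary[OF x Y k0(2) that] concave_chainsD(5)[OF Y that] by simp
  have "x 0 = None" using box_pathD(1)[OF x, of 0] k0 by simp
  then have Z0: "?Z 0 = (\<lambda>_. 0)" using concave_chainsD(1)[OF Y] by simp
  show ?thesis by (rule chainsI[where Y = ?Z, OF Z0 strict vs rc stat])
qed

lemma insert_exists:
  assumes Y: "Y \<in> concave_chains n" and k0: "1 \<le> k0" "k0 \<le> n"
    and size: "block_size n Y k0 \<le> block_size n Y (k0 - 1)"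
  shows "\<exists>Z b. inserts n Y k0 Z b"
proof -
  obtain x where x: "box_path k0 Y x" using path_exists[OF Y k0(1) size] by blast
  then have "x n \<noteq> None" using k0(2) box_pathD(1)[OF x, of n] by simp
  then show ?thesis
    unfolding inserts_def using path_insert_chain[OF Y x k0 size] Y k0 x by blast
qed

lemma insert_unique:
  assumes "inserts n Y k0 Z b" "inserts n Y k0 Z' b'"
  shows "Z = Z' \<and> b = b'"
proof -
  obtain x where x: "box_path k0 Y x" "x n = Some b" "Z = (\<lambda>k. put (x k) (Y k))" "1 \<le> k0"
    using assms(1) by (auto simp: inserts_def)
  obtain x' where x': "box_path k0 Y x'" "x' n = Some b'" "Z' = (\<lambda>k. put (x' k) (Y k))"
    using assms(2) by (auto simp: inserts_def)
  have "x = x'" by (rule path_unique[OF x(1) x'(1) x(4)])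
  then show ?thesis using x x' by auto
qed

text \<open>All shapes from \<open>k0\<close> on gain one cell, so only the difference at
  \<open>k0\<close> changes.\<close>

lemma insert_block_size:
  assumes "inserts n Y k0 Z b"
  shows "block_size n Z = (block_size n Y)(k0 := Suc (block_size n Y k0))"
proof (rule ext)
  fix k
  obtain x where x: "box_path k0 Y x" "Z = (\<lambda>k. put (x k) (Y k))" and k0: "1 \<le> k0" and Y: "Y \<in> concave_chains n"
    using assms by (auto simp: inserts_def)
  have "box_below (Suc n) (x k)" for k
    using chain_box_below[OF Y box_pathD(2)[OF x(1)]] .
  then have "tail_cells (Suc n) (Z k) 0 = tail_cells (Suc n) (Y k) 0 + tail_box (x k) 0" for k
    unfolding x(2) by (rule tail_put)
  moreover have "tail_box (x k) 0 = (if k0 \<le> k then 1 else 0)" for k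
    using box_pathD(1)[OF x(1), of k] by (cases "x k") (auto simp: tail_box_def)
  ultimately show "block_size n Z k = ((block_size n Y)(k0 := Suc (block_size n Y k0))) k"
    using tail_mono_vstrip[OF concave_chainsD(6)[OF Y, of k], of "Suc n" 0] k0
    unfolding block_size_def by auto
qed

lemma delete_exists:
  assumes Z: "Z \<in> concave_chains n" and w: "Z n = put (Some b) w" "box_ok w (Some b)"
  shows "\<exists>Y k0. inserts n Y k0 Z b"
proof -
  \<comment> \<open>The path is built downwards: \<open>f j\<close> is the pair of box and shape at
    index \<open>n - j\<close>. For \<open>j \<ge> n\<close> the relation \<open>Q\<close> is void,
    so the choice may repeat its last pair.\<close>
  define P where "P j p \<longleftrightarrow> Z (n - j) = put (fst p) (snd p) \<and> box_ok (snd p) (fst p) \<and>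
      (j = 0 \<longrightarrow> p = (Some b, w))" for j and p :: "box option \<times> (nat \<Rightarrow> nat)"
  define Q where "Q j p q \<longleftrightarrow> (j < n \<longrightarrow> step (snd q) (snd p) (fst q) (fst p) \<and> vstrip (snd q) (snd p))"
    for j and p q :: "box option \<times> (nat \<Rightarrow> nat)"
  have "\<exists>f. \<forall>j. P j (f j) \<and> Q j (f j) (f (Suc j))"
  proof (rule dependent_nat_choice)
    show "\<exists>p. P 0 p" using w by (intro exI[of _ "(Some b, w)"]) (auto simp: P_def)
  next
    fix p j assume P: "P j p"
    show "\<exists>q. P (Suc j) q \<and> Q j p q"
    proof (cases "j < n")
      case True
      have "\<exists>x v. Z (n - Suc j) = put x v \<and> box_ok v x \<and> step v (snd p) x (fst p) \<and> vstrip v (snd p)"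
      proof (rule step_reverse_exists[OF concave_chainsD(2)[OF Z]])
        have "Z (n - j) = Z (Suc (n - Suc j))" using True by (simp add: Suc_diff_Suc)
        then show "vstrip (Z (n - Suc j)) (put (fst p) (snd p))"
          using concave_chainsD(3)[OF Z, of "n - Suc j"] P by (simp add: P_def)
      qed (use P in \<open>simp add: P_def\<close>)
      then obtain x v where "Z (n - Suc j) = put x v" "box_ok v x" "step v (snd p) x (fst p)" "vstrip v (snd p)"
        by blast
      then show ?thesis by (intro exI[of _ "(x, v)"]) (auto simp: P_def Q_def)
    next
      case False
      then show ?thesis using P by (intro exI[of _ p]) (auto simp: P_def Q_def)
    qed
  qed
  then obtain f where f: "P j (f j)" "Q j (f j) (f (Suc j))" for j by blast
  define x where "x k = fst (f (n - k))" for k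
  define Y where "Y k = snd (f (n - k))" for k
  have f0: "f 0 = (Some b, w)" using f(1)[of 0] by (simp add: P_def)
  have late: "x k = Some b \<and> Y k = w \<and> Z k = Z n" if "n \<le> k" for k
    using that f0 concave_chainsD(5)[OF Z that] by (simp add: x_def Y_def)
  have ZY: "Z k = put (x k) (Y k)" for k
  proof (cases "k \<le> n")
    case True
    then show ?thesis using f(1)[of "n - k"] by (simp add: P_def x_def Y_def)
  next
    case False
    then show ?thesis using late[of k] w by simp
  qed
  have ok: "box_ok (Y k) (x k)" for k using f(1)[of "n - k"] by (simp add: P_def x_def Y_def)
  have sv: "step (Y k) (Y (Suc k)) (x k) (x (Suc k)) \<and> vstrip (Y k) (Y (Suc k))" for k
  proof (cases "k < n")
    case True
    then have "n - k = Suc (n - Suc k)" by simp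
    then show ?thesis using f(2)[of "n - Suc k"] True by (simp add: Q_def x_def Y_def)
  next
    case False
    then have "x k = Some b" "x (Suc k) = Some b" "Y k = w" "Y (Suc k) = w"
      using late[of k] late[of "Suc k"] by auto
    then show ?thesis by (cases b) (auto intro!: step.row step.stay vstrip_refl)
  qed
  \<comment> \<open>The box must have disappeared on the way, as \<open>Z 0\<close> has no cell to
    lose; the first index where it is present is the block of insertion.\<close>
  have x0: "x 0 = None"
  proof (cases "x 0")
    case (Some c)
    then have "add_box (Y 0) (box_row c) = (\<lambda>_. 0)" using ZY[of 0] concave_chainsD(1)[OF Z] by simp
    from fun_cong[OF this, of "box_row c"] show ?thesis by (simp add: add_box_apply)
  qed
  define k0 where "k0 = (LEAST k. x k \<noteq> None)"
  have xn: "x n = Some b" using late[of n] by simp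
  have k0n: "k0 \<le> n" unfolding k0_def by (rule Least_le) (use xn in simp)
  have xk0: "x k0 \<noteq> None" unfolding k0_def by (rule LeastI[of _ n]) (use xn in simp)
  then have k01: "1 \<le> k0" using x0 by (cases k0) auto
  have after: "x k \<noteq> None" if "k0 \<le> k" for k
    using that
  proof (induction rule: dec_induct)
    case (step j)
    then show ?case using sv[of j] step_Some by (metis not_None_eq)
  qed (rule xk0)
  have path: "box_path k0 Y x"
    unfolding box_path_def
  proof (intro allI conjI)
    fix k
    show "x k = None \<longleftrightarrow> k < k0"
      using after[of k] not_less_Least[of k "\<lambda>k. x k \<noteq> None"] unfolding k0_def[symmetric]
      by (cases "k < k0") auto
  qed (use ok sv in blast)+
  have strict: "strict_shape (Y k)" for k using ok[of k] by (simp add: box_ok_def)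
  have vs: "vstrip (Y k) (Y (Suc k))" for k using sv by blast
  have vs': "vstrip (Y (k - 1)) (Y k)" for k
    using vs[of "k - 1"] by (cases k) (auto simp: vstrip_refl)
  have below: "box_below (Suc n) (x k)" for k
    unfolding box_below_def
  proof (intro allI impI)
    fix c assume "x k = Some c"
    then have "Z k (box_row c) \<noteq> 0" using ZY[of k] by (simp add: add_box_apply)
    then show "box_row c < Suc n" using chain_empty_row[OF Z, of "box_row c" k]
      by (metis leI less_SucI)
  qed
  have empty: "Y k u = 0" if "Suc n \<le> u" for k u
  proof -
    have "Y k u \<le> Z k u" unfolding ZY by (cases "x k") (auto simp: add_box_apply)
    then show ?thesis using chain_empty_row[OF Z, of u k] that by simp
  qed
  have rc: "row_concave (Suc n) (Y (k - 1)) (Y k) (Y (Suc k))" for k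
  proof (cases "\<exists>t. x k = Some (ColB t)")
    case False
    have "row_concave (Suc n) (put (x (k - 1)) (Y (k - 1))) (put (x k) (Y k)) (put (x (Suc k)) (Y (Suc k)))"
      using concave_chainsD(4)[OF Z, of k] by (simp only: ZY)
    then show ?thesis
    proof (rule row_concave_delete[OF _ path_step_pred[OF path k01]])
      show "step (Y k) (Y (Suc k)) (x k) (x (Suc k))" using sv by blast
      show "x k \<noteq> Some (ColB t)" for t using False by blast
    qed (rule below vs vs' ok empty | assumption)+
  next
    case True
    then obtain t where t: "x k = Some (ColB t)" by blast
    obtain c t' where c: "x (k - 1) = Some c" "x (Suc k) = Some (ColB t')"
      using path_col[OF path k01 t] .
    have "col_concave (Suc n) (Z (k - 1)) (Z k) (Z (Suc k))"
      by (rule row_concave_imp_col[OF concave_chainsD(2,6,3,4)[OF Z]])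
    then have "col_concave (Suc n) (Y (k - 1)) (Y k) (Y (Suc k))"
      unfolding ZY t c
    proof (rule col_concave_delete)
      show "step (Y (k - 1)) (Y k) (Some c) (Some (ColB t))"
        using path_step_pred[OF path k01, of k] unfolding c t .
      show "step (Y k) (Y (Suc k)) (Some (ColB t)) (Some (ColB t'))" using sv[of k] unfolding c t by blast
      show "box_row c < Suc n" using below[of "k - 1"] unfolding c by (simp add: box_below_def)
      show "box_ok (Y (k - 1)) (Some c)" using ok[of "k - 1"] unfolding c .
    qed (use below[of k] below[of "Suc k"] ok[of k] c t vs[of k] vs'[of k]
      in \<open>simp_all add: box_below_def\<close>)
    then show ?thesis
      by (rule col_concave_imp_row[OF strict strict strict vs' vs])
  qed
  have Y0: "Y 0 = (\<lambda>_. 0)" using ZY[of 0] x0 concave_chainsD(1)[OF Z] by simp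
  have stat: "Y k = Y n" if "n \<le> k" for k using late[of k] late[of n] that by simp
  have "Y \<in> concave_chains n" by (rule chainsI[where Y = Y, OF Y0 strict vs rc stat])
  then show ?thesis
    unfolding inserts_def using Z path xn k0n k01 ZY by blast
qed

lemma delete_unique:
  assumes "inserts n Y k0 Z b" "inserts n Y' k0' Z b"
  shows "Y = Y' \<and> k0 = k0'"
proof -
  obtain x where x: "box_path k0 Y x" "x n = Some b" "Z = (\<lambda>k. put (x k) (Y k))"
    and Y: "Y \<in> concave_chains n" and k0: "k0 \<le> n"
    using assms(1) by (auto simp: inserts_def)
  obtain x' where x': "box_path k0' Y' x'" "x' n = Some b" "Z = (\<lambda>k. put (x' k) (Y' k))"
    and Y': "Y' \<in> concave_chains n" and k0': "k0' \<le> n"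
    using assms(2) by (auto simp: inserts_def)
  have ZY: "put (x k) (Y k) = put (x' k) (Y' k)" for k using x(3) x'(3) by metis
  have low: "x k = x' k \<and> Y k = Y' k" if "k \<le> n" for k
    using that
  proof (induction rule: inc_induct)
    case base
    then show ?case using ZY[of n] x(2) x'(2) by (auto dest: add_box_inj)
  next
    case (step k)
    have s: "step (Y k) (Y (Suc k)) (x k) (x (Suc k))" "step (Y' k) (Y (Suc k)) (x' k) (x (Suc k))"
      "box_ok (Y k) (x k)" "box_ok (Y' k) (x' k)" "vstrip (Y k) (Y (Suc k))" "vstrip (Y' k) (Y (Suc k))"
      using box_pathD(2,3)[OF x(1), of k] box_pathD(2,3)[OF x'(1), of k] step(3) 
        concave_chainsD(3)[OF Y, of k] concave_chainsD(3)[OF Y', of k] by simp_all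
    show ?case
    proof (cases "x (Suc k) = None")
      case True
      then have "x k = None" "x' k = None" using s(1,2) step_Some by (metis not_None_eq)+
      then show ?thesis using ZY[of k] by simp
    next
      case False
      then show ?thesis using step_source_unique[OF s(1,2) ZY False s(5,6,3,4)] by simp
    qed
  qed
  have "Y = Y'"
  proof (rule ext)
    fix k show "Y k = Y' k"
    proof (cases "k \<le> n")
      case True
      then show ?thesis using low[of k] by simp
    next
      case False
      then have "Y k = Y n" "Y' k = Y' n" using concave_chainsD(5)[OF Y, of k] concave_chainsD(5)[OF Y', of k] by simp_all
      then show ?thesis using low[of n] by simp
    qed
  qed
  moreover have "x k = None \<longleftrightarrow> k < k0" "x' k = None \<longleftrightarrow> k < k0'" for k
    using box_pathD(1)[OF x(1)] box_pathD(1)[OF x'(1)] by blast+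
  moreover have "k0 = k0'"
    using low[of k0] low[of k0'] k0 k0' calculation(2)[of k0] calculation(3)[of k0']
      calculation(2)[of k0'] calculation(3)[of k0] by (cases k0 k0' rule: linorder_cases) auto
  ultimately show ?thesis by simp
qed

text \<open>At index 0 there is no box and the relation holds trivially; it is then carried along
  both paths to \<open>n\<close>. Since \<open>before\<close> forces \<open>precedes\<close> and
  \<open>after\<close> forbids it, the labels decide the order of the blocks.\<close>

lemma insert_order:
  assumes "inserts n Y k1 Y' b1" "inserts n Y' k2 Y'' b2"
  shows "k2 \<le> k1 \<longleftrightarrow> precedes (label (Y n) b1) (label (Y' n) b2)"
proof -
  obtain x1 where x1: "box_path k1 Y x1" "x1 n = Some b1" "Y' = (\<lambda>k. put (x1 k) (Y k))" and k1: "1 \<le> k1"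
    and Y: "Y \<in> concave_chains n"
    using assms(1) by (auto simp: inserts_def)
  obtain x2 where x2: "box_path k2 Y' x2" "x2 n = Some b2" and k2: "1 \<le> k2" and Y': "Y' \<in> concave_chains n"
    using assms(2) by (auto simp: inserts_def)
  have Y'k: "Y' k = put (x1 k) (Y k)" for k using x1(3) by simp
  have s1: "step (Y k) (Y (Suc k)) (x1 k) (x1 (Suc k))"
    and s2: "step (put (x1 k) (Y k)) (put (x1 (Suc k)) (Y (Suc k))) (x2 k) (x2 (Suc k))"
    and ok: "box_ok (Y k) (x1 k)" "box_ok (put (x1 k) (Y k)) (x2 k)"
    and none: "x1 k = None \<longleftrightarrow> k < k1" "x2 k = None \<longleftrightarrow> k < k2"
    and vs: "vstrip (Y k) (Y (Suc k))" "vstrip (put (x1 k) (Y k)) (put (x1 (Suc k)) (Y (Suc k)))" for k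
    using box_pathD[OF x1(1), of k] box_pathD[OF x2(1), of k] concave_chainsD(3)[OF Y, of k] concave_chainsD(3)[OF Y', of k]
    unfolding Y'k by auto
  have ok2: "box_ok (put (Some b1) (Y n)) (Some b2)" using ok(2)[of n] x1(2) x2(2) by simp
  show ?thesis
  proof (cases "k2 \<le> k1")
    case True
    have "before (Y k) (x1 k) (x2 k)" for k
    proof (induction k)
      case 0
      then show ?case using none(1)[of 0] k1 by simp
    next
      case (Suc k)
      show ?case
        by (rule step_before[OF s1 s2 Suc _ vs ok(1) ok(1) ok(2) ok(2)]) (use none True in auto)
    qed
    from this[of n] show ?thesis using before_precedes[OF _ ok2] True x1(2) x2(2) Y'k[of n] by auto
  next
    case False
    have "after (Y k) (x1 k) (x2 k)" for k
    proof (induction k)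
      case 0
      then show ?case using none(2)[of 0] k2 by simp
    next
      case (Suc k)
      show ?case
        by (rule step_after[OF s1 s2 Suc _ vs ok(1) ok(1) ok(2) ok(2)]) (use none False in auto)
    qed
    from this[of n] show ?thesis using after_not_precedes[OF _ ok2] False x1(2) x2(2) Y'k[of n] by auto
  qed
qed

section \<open>Inserting a strip\<close>

text \<open>The label keeps what a shifted filling shows of a box, its row and its mark. Together
  with the shape \<open>Y n\<close> it still determines the box.\<close>

definition ins :: "nat \<Rightarrow> (nat \<Rightarrow> nat \<Rightarrow> nat) \<Rightarrow> nat \<Rightarrow> (nat \<Rightarrow> nat \<Rightarrow> nat) \<Rightarrow> bool \<times> nat \<Rightarrow> bool" where
  "ins n Y k Z l \<longleftrightarrow> (\<exists>b. inserts n Y k Z b \<and> l = label (Y n) b)"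

lemma insD:
  assumes "ins n Y k Z l"
  shows "Y \<in> concave_chains n" "Z \<in> concave_chains n" "1 \<le> k" "k \<le> n"
    "block_size n Z = (block_size n Y)(k := Suc (block_size n Y k))"
    "Z n = add_box (Y n) (snd l)" "\<not> fst l \<Longrightarrow> 0 < Y n (snd l)"
proof -
  obtain b where b: "inserts n Y k Z b" "l = label (Y n) b" using assms by (auto simp: ins_def)
  obtain x where "x n = Some b" "Z = (\<lambda>k. put (x k) (Y k))"
    using b by (auto simp: inserts_def)
  then have "Z n = add_box (Y n) (box_row b)" by simp
  then show "Z n = add_box (Y n) (snd l)" "\<not> fst l \<Longrightarrow> 0 < Y n (snd l)"
    using b(2) by (auto simp: label_def)
  show "Y \<in> concave_chains n" "Z \<in> concave_chains n" "1 \<le> k" "k \<le> n" using b(1) by (auto simp: inserts_def)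
  show "block_size n Z = (block_size n Y)(k := Suc (block_size n Y k))"
    by (rule insert_block_size[OF b(1)])
qed

lemma ins_exists:
  assumes "Y \<in> concave_chains n" "1 \<le> k" "k \<le> n" "block_size n Y k \<le> block_size n Y (k - 1)"
  shows "\<exists>Z l. ins n Y k Z l"
  using insert_exists[OF assms] unfolding ins_def by blast

lemma ins_unique:
  assumes "ins n Y k Z l" "ins n Y k Z' l'"
  shows "Z = Z' \<and> l = l'"
  using assms insert_unique unfolding ins_def by blast

lemma del_exists:
  assumes Z: "Z \<in> concave_chains n" and w: "Z n = add_box w t" "strict_shape w" "\<not> c \<Longrightarrow> 0 < w t"
  shows "\<exists>Y k. ins n Y k Z (c, t)"
proof -
  \<comment> \<open>An unprimed label stands for a row box on the diagonal and for a column box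
    elsewhere.\<close>
  define b where "b = (if c \<and> 0 < w t then ColB t else RowB t)"
  have rb: "box_row b = t" by (simp add: b_def)
  have ok: "box_ok w (Some b)"
    using w concave_chainsD(2)[OF Z, of n] by (auto simp: box_ok_def b_def split: if_splits)
  have Zn: "Z n = put (Some b) w" using w(1) rb by simp
  obtain Y k where Y: "inserts n Y k Z b" using delete_exists[OF Z Zn ok] by blast
  then obtain x where "x n = Some b" "Z = (\<lambda>k. put (x k) (Y k))" by (auto simp: inserts_def)
  then have "add_box (Y n) t = add_box w t" using w(1) rb by simp
  then have "Y n = w" by (rule add_box_inj)
  then have "label (Y n) b = (c, t)" using w(3) by (cases c) (auto simp: label_def b_def)
  then show ?thesis using Y unfolding ins_def by metis
qed

lemma del_unique:
  assumes "ins n Y k Z l" "ins n Y' k' Z l"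
  shows "Y = Y' \<and> k = k'"
proof -
  obtain b where b: "inserts n Y k Z b" "l = label (Y n) b" using assms(1) by (auto simp: ins_def)
  obtain b' where b': "inserts n Y' k' Z b'" "l = label (Y' n) b'" using assms(2) by (auto simp: ins_def)
  have "add_box (Y n) (snd l) = add_box (Y' n) (snd l)"
    using insD(6)[OF assms(1)] insD(6)[OF assms(2)] by simp
  then have e: "Y n = Y' n" by (rule add_box_inj)
  have ok: "box_ok (Y n) (Some b)" "box_ok (Y' n) (Some b')"
    using b(1) b'(1) box_pathD(2) unfolding inserts_def by metis+
  have "b = b'"
    using b(2) b'(2) e ok by (cases b; cases b') (auto simp: label_def box_ok_def)
  then show ?thesis using delete_unique b(1) b'(1) by blast
qed

lemma ins_order:
  assumes "ins n Y k1 Y' l1" "ins n Y' k2 Y'' l2"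
  shows "k2 \<le> k1 \<longleftrightarrow> precedes l1 l2"
  using assms insert_order unfolding ins_def by blast

text \<open>These are block sizes, counted from the bottom row. The second inequality says that the
  longer row \<open>Suc k\<close> starts no further left than the shorter row \<open>k\<close>, so
  no column loses two cells; \<open>Suc\<close> is the offset between the right ends of staircase
  rows.\<close>

definition horizontal_strip :: "(nat \<Rightarrow> nat) \<Rightarrow> (nat \<Rightarrow> nat) \<Rightarrow> bool" where
  "horizontal_strip p q \<longleftrightarrow> (\<forall>k. p k \<le> q k \<and> q (Suc k) \<le> Suc (p k))"

text \<open>The cells of \<open>z / v\<close> carry the primed copies of a letter and those of \<open>w / z\<close> the unprimed ones.\<close>

definition marked_strip :: "(nat \<Rightarrow> nat) \<Rightarrow> (nat \<Rightarrow> nat) \<Rightarrow> (nat \<Rightarrow> nat) \<Rightarrow> bool" where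
  "marked_strip v z w \<longleftrightarrow> vstrip v z \<and> (\<forall>s. v s = 0 \<longrightarrow> z s = 0) \<and>
     (\<forall>s. z s \<le> w s \<and> (w (Suc s) < z s \<or> w (Suc s) = 0))"

text \<open>\<open>fin\<close> holds the last block and label, so that the next block can be
  compared with it. \<open>z\<close> is the shape reached by the primed boxes and is frozen once
  unprimed ones follow.\<close>

inductive strip :: "nat \<Rightarrow> (nat \<Rightarrow> nat \<Rightarrow> nat) \<Rightarrow> (nat \<Rightarrow> nat \<Rightarrow> nat) \<Rightarrow> (nat \<Rightarrow> nat) \<Rightarrow>
    (nat \<times> bool \<times> nat) option \<Rightarrow> bool"
  for n Y0 where
  empty: "Y0 \<in> concave_chains n \<Longrightarrow> strip n Y0 Y0 (Y0 n) None"
| add: "strip n Y0 Y z fin \<Longrightarrow> ins n Y k Z l \<Longrightarrow> (\<And>k0 l0. fin = Some (k0, l0) \<Longrightarrow> k \<le> k0) \<Longrightarrow>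
    strip n Y0 Z (if fst l then z else Z n) (Some (k, l))"

text \<open>Primed entries arrive from top to bottom, then unprimed ones from bottom to top. The
  last is the topmost unprimed entry or, failing that, the lowest primed one.\<close>

definition last_entry :: "(nat \<Rightarrow> nat) \<Rightarrow> (nat \<Rightarrow> nat) \<Rightarrow> (nat \<Rightarrow> nat) \<Rightarrow> bool \<times> nat \<Rightarrow> bool" where
  "last_entry v z w l \<longleftrightarrow> (if fst l then z (snd l) < w (snd l) \<and> (\<forall>u<snd l. z u = w u)
     else z = w \<and> v (snd l) < z (snd l) \<and> (\<forall>u>snd l. v u = z u))"

definition last_block :: "(nat \<Rightarrow> nat) \<Rightarrow> (nat \<Rightarrow> nat) \<Rightarrow> nat \<Rightarrow> bool" where
  "last_block p q k \<longleftrightarrow> p k < q k \<and> (\<forall>j<k. p j = q j)"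

section \<open>Strips of insertions against marked strips\<close>

lemma last_entry_unique: "last_entry v z w l \<Longrightarrow> last_entry v z w l' \<Longrightarrow> l = l'"
proof -
  assume l: "last_entry v z w l" "last_entry v z w l'"
  obtain c t c' t' where e: "l = (c, t)" "l' = (c', t')" by (cases l; cases l')
  have "c = c'" using l by (auto simp: e last_entry_def split: if_splits)
  moreover have "t = t'"
    using l \<open>c = c'\<close> by (cases t t' rule: linorder_cases) (auto simp: e last_entry_def split: if_splits)
  ultimately show "l = l'" using e by simp
qed

lemma last_block_unique: "last_block p q k \<Longrightarrow> last_block p q k' \<Longrightarrow> k = k'"
  unfolding last_block_def by (metis less_irrefl linorder_neqE_nat)

lemma marked_strip_trivial:
  assumes "strict_shape v"
  shows "marked_strip v v v"
  using assms by (auto simp: marked_strip_def strict_shape_def vstrip_refl)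

lemma block_size_0: "block_size n Y 0 = 0"
  by (simp add: block_size_def)

text \<open>For an unprimed cell, \<open>precedes\<close> excludes unprimed cells above row
  \<open>t\<close>; for a primed one it excludes unprimed cells altogether and primed ones from row
  \<open>t\<close> on. So the new cell violates no strip condition and becomes the last
  entry.\<close>

lemma marked_strip_add:
  assumes ms: "marked_strip v z w" and st: "strict_shape (add_box w t)"
    and l: "\<not> c \<Longrightarrow> 0 < w t"
    and pre: "z = v \<and> w = v \<or> (\<exists>l0. last_entry v z w l0 \<and> precedes l0 (c, t))"
  shows "marked_strip v (if c then z else add_box w t) (add_box w t) \<and>
    last_entry v (if c then z else add_box w t) (add_box w t) (c, t)"
proof (cases c)
  case True
  have eq: "z u = w u" if "u < t" for u
    using pre
  proof
    assume "\<exists>l0. last_entry v z w l0 \<and> precedes l0 (c, t)"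
    then obtain c0 t0 where l0: "last_entry v z w (c0, t0)" "precedes (c0, t0) (c, t)" by auto
    then show ?thesis using True that by (cases c0) (auto simp: last_entry_def)
  qed simp
  have "z s \<le> w s \<and> (w (Suc s) < z s \<or> w (Suc s) = 0)" for s
    using ms unfolding marked_strip_def by auto
  then have zw: "z s \<le> w s" "w (Suc s) < z s \<or> w (Suc s) = 0" for s by auto
  have "add_box w t (Suc s) < z s \<or> add_box w t (Suc s) = 0" for s
  proof (cases "Suc s = t")
    case True
    then show ?thesis using strict_add_boxD(1)[OF st, of s] eq[of s] by (simp add: add_box_apply)
  next
    case False
    then show ?thesis using zw[of s] by (simp add: add_box_apply)
  qed
  then have "marked_strip v z (add_box w t)"
    using ms zw(1) unfolding marked_strip_def by (auto simp: add_box_apply le_SucI)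
  then show ?thesis using True eq zw(1)[of t] by (simp add: last_entry_def add_box_apply)
next
  case False
  have *: "z = w \<and> (\<forall>u\<ge>t. v u = w u)"
    using pre
  proof
    assume "\<exists>l0. last_entry v z w l0 \<and> precedes l0 (c, t)"
    then obtain c0 t0 where l0: "last_entry v z w (c0, t0)" "precedes (c0, t0) (c, t)" by auto
    then show ?thesis using False by (cases c0) (auto simp: last_entry_def)
  qed simp
  have "vstrip v w" "\<And>s. v s = 0 \<Longrightarrow> w s = 0" using ms * by (auto simp: marked_strip_def)
  then have "marked_strip v (add_box w t) (add_box w t)"
    using st * l[OF False] unfolding marked_strip_def vstrip_def strict_shape_def
    by (auto simp: add_box_apply)
  then show ?thesis using False * by (simp add: last_entry_def add_box_apply)
qed

lemma strip_sound:
  assumes "strip n Y0 Y z fin"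
  shows "Y0 \<in> concave_chains n \<and> Y \<in> concave_chains n \<and> horizontal_strip (block_size n Y0) (block_size n Y) \<and>
    marked_strip (Y0 n) z (Y n) \<and>
    (case fin of None \<Rightarrow> Y = Y0 \<and> z = Y0 n
     | Some (k, l) \<Rightarrow> last_block (block_size n Y0) (block_size n Y) k \<and>
        last_entry (Y0 n) z (Y n) l \<and> (\<exists>X. ins n X k Y l))"
  using assms
proof induction
  case empty
  then show ?case
    using block_size_concave[OF empty] marked_strip_trivial[OF concave_chainsD(2)[OF empty]]
    by (auto simp: horizontal_strip_def)
next
  case (add Y z fin k Z l)
  note d = insD[OF add.hyps(2)]
  let ?p = "block_size n Y0" and ?q = "block_size n Y"
  have hs: "?p j \<le> ?q j" "?q (Suc j) \<le> Suc (?p j)" for j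
    using add.IH unfolding horizontal_strip_def by blast+
  have low: "?p j = ?q j" if "j < k" for j
  proof (cases fin)
    case None
    then show ?thesis using add.IH by simp
  next
    case (Some a)
    then obtain k0 l0 where a: "fin = Some (k0, l0)" by (cases a) auto
    then show ?thesis using add.IH add.hyps(3)[OF a] that by (auto simp: last_block_def)
  qed
  have hs': "horizontal_strip ?p (block_size n Z)"
    unfolding horizontal_strip_def
  proof (intro allI conjI)
    fix j
    show "?p j \<le> block_size n Z j" using hs(1)[of j] d(5) by (auto intro: le_SucI)
    \<comment> \<open>At \<open>Suc j = k\<close> the bound is concavity of the block sizes of
      \<open>Z\<close>, since block \<open>j\<close> has not been touched yet.\<close>
    show "block_size n Z (Suc j) \<le> Suc (?p j)"
      using hs(2)[of j] low[of j] block_size_concave[OF d(2), of j] d(5) by (auto split: if_splits)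
  qed
  have lb: "last_block ?p (block_size n Z) k"
    using low hs(1)[of k] d(5) by (auto simp: last_block_def)
  obtain c t where l: "l = (c, t)" by (cases l)
  have "marked_strip (Y0 n) (if c then z else add_box (Y n) t) (add_box (Y n) t) \<and>
    last_entry (Y0 n) (if c then z else add_box (Y n) t) (add_box (Y n) t) (c, t)"
  proof (rule marked_strip_add)
    show "marked_strip (Y0 n) z (Y n)" using add.IH by blast
    show "strict_shape (add_box (Y n) t)" using concave_chainsD(2)[OF d(2), of n] d(6) l by simp
    show "\<not> c \<Longrightarrow> 0 < Y n t" using d(7) l by simp
    show "z = Y0 n \<and> Y n = Y0 n \<or> (\<exists>l0. last_entry (Y0 n) z (Y n) l0 \<and> precedes l0 (c, t))"
    proof (cases fin)
      case None
      then show ?thesis using add.IH by simp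
    next
      case (Some a)
      then obtain k0 l0 where a: "fin = Some (k0, l0)" by (cases a) auto
      then obtain X where "ins n X k0 Y l0" "last_entry (Y0 n) z (Y n) l0" using add.IH by auto
      then show ?thesis using ins_order[OF _ add.hyps(2)] add.hyps(3)[OF a] l by blast
    qed
  qed
  then show ?case using add.IH d(2,6) hs' lb l add.hyps(2) by auto
qed

text \<open>Blocks are used in weakly decreasing order, so the last one is the first index where the
  block sizes differ; undoing it gives the induction.\<close>

lemma strip_unique:
  assumes "strip n Y0 Y z fin" "strip n Y0 Y' z' fin'" "block_size n Y = block_size n Y'"
  shows "Y = Y' \<and> z = z' \<and> fin = fin'"
  using assms
proof (induction arbitrary: Y' z' fin')
  case empty
  from empty(2) show ?case
  proof cases
    case (add Y1 z1 last1 k l)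
    then have "last_block (block_size n Y0) (block_size n Y') k"
      using strip_sound[OF empty(2)] by auto
    then show ?thesis using empty(3) by (simp add: last_block_def)
  qed simp
next
  case (add Y z fin k Z l)
  have lb: "last_block (block_size n Y0) (block_size n Z) k"
    using strip_sound[OF strip.add[OF add.hyps]] by auto
  from add.prems(1) show ?case
  proof cases
    case empty
    then show ?thesis using lb add.prems(2) by (simp add: last_block_def)
  next
    case (add Y1 z1 last1 k1 l1)
    have "last_block (block_size n Y0) (block_size n Y') k1"
      using strip_sound[OF add.prems(1)] add by auto
    then have k: "k1 = k" using last_block_unique[OF lb] add.prems(2) by simp
    have "block_size n Y = block_size n Y1"
    proof
      fix j
      show "block_size n Y j = block_size n Y1 j"
        using insD(5)[OF add.hyps(2)] insD(5)[OF add(4)] add.prems(2) k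
        by (metis fun_upd_apply nat.inject)
    qed
    then have "Y = Y1 \<and> z = z1 \<and> fin = last1" using add.IH add(3) by blast
    then show ?thesis using ins_unique[of n Y k Z l Y' l1] add.hyps(2) add k by auto
  qed
qed

text \<open>Here the last insertion is read off the marked strip, as its last entry, and
  undone.\<close>

lemma strip_source_unique:
  assumes "strip n Y0 Y z fin" "strip n Y0' Y z fin'" "Y0 n = Y0' n"
  shows "Y0 = Y0' \<and> fin = fin'"
  using assms(1,2)
proof (induction arbitrary: fin')
  case empty
  from empty(2) show ?case
  proof cases
    case (add Y1 z1 last1 k l)
    then have "last_entry (Y0' n) (Y0 n) (Y0 n) l"
      using strip_sound[OF empty(2)] by auto
    then show ?thesis using assms(3) by (auto simp: last_entry_def split: if_splits)
  qed simp
next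
  case (add Y z fin k Z l)
  note sn = strip_sound[OF strip.add[OF add.hyps]]
  have le: "last_entry (Y0 n) (if fst l then z else Z n) (Z n) l"
    using sn by auto
  \<comment> \<open>The rule \<open>add\<close> overwrites \<open>z\<close> when the letter is
    primed. The old value is recovered because a primed box can follow only primed ones, where
    \<open>z\<close> is the current shape.\<close>
  have zY: "z = Y n" if h: "\<not> fst l" "strip n X Y z fin" "ins n Y k Z l"
     "\<And>k0 l0. fin = Some (k0, l0) \<Longrightarrow> k \<le> k0" for X Y z fin k l
  proof (cases fin)
    case None
    then show ?thesis using strip_sound[OF h(2)] by auto
  next
    case (Some a)
    then obtain k0 l0 where a: "fin = Some (k0, l0)" by (cases a) auto
    then obtain W where W: "ins n W k0 Y l0" "last_entry (X n) z (Y n) l0"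
      using strip_sound[OF h(2)] by auto
    then have "precedes l0 l" using ins_order[OF W(1) h(3)] h(4)[OF a] by blast
    then show ?thesis using h(1) W(2) by (cases l; cases l0) (auto simp: last_entry_def)
  qed
  from add.prems show ?case
  proof cases
    case empty
    then show ?thesis using le assms(3) by (auto simp: last_entry_def split: if_splits)
  next
    case (add Y1 z1 last1 k1 l1)
    have "last_entry (Y0' n) (if fst l then z else Z n) (Z n) l1"
      using strip_sound[OF add.prems] add by auto
    then have l: "l1 = l" using last_entry_unique[OF le] assms(3) by metis
    then have Y: "Y = Y1" "k = k1" using del_unique[OF add.hyps(2)] add(4) by auto
    have "z = z1"
    proof (cases "fst l")
      case True
      then show ?thesis using add(1) l by simp
    next
      case False
      then show ?thesis using zY[OF False add.hyps(1,2,3)] zY[OF _ add(3,4,5)] l Y by simp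
    qed
    then show ?thesis using add.IH[of last1] add Y l by auto
  qed
qed

lemma strip_exists:
  assumes Y0: "Y0 \<in> concave_chains n" and hs: "horizontal_strip (block_size n Y0) p"
    and p: "p 0 = 0" "\<And>k. n < k \<Longrightarrow> p k = 0"
  shows "\<exists>Y z fin. strip n Y0 Y z fin \<and> block_size n Y = p"
  using hs p
proof (induction "\<Sum>k\<le>n. p k - block_size n Y0 k" arbitrary: p rule: less_induct)
  case less
  let ?p = "block_size n Y0"
  have le: "?p k \<le> p k" "p (Suc k) \<le> Suc (?p k)" for k
    using less.prems(1) by (auto simp: horizontal_strip_def)
  show ?case
  proof (cases "p = ?p")
    case True
    then show ?thesis using strip.empty[OF Y0] by blast
  next
    case False
    then have "\<exists>k. ?p k < p k" using le(1) by (metis ext le_neq_implies_less)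
    \<comment> \<open>The smallest block that still lacks a cell is the one to be inserted
      last.\<close>
    define k where "k = (LEAST k. ?p k < p k)"
    have k: "?p k < p k" unfolding k_def using \<open>\<exists>k. ?p k < p k\<close> by (rule LeastI_ex)
    have low: "p j = ?p j" if "j < k" for j
      using not_less_Least[of j "\<lambda>k. ?p k < p k"] that le(1)[of j] unfolding k_def by auto
    have k1: "1 \<le> k" "k \<le> n" using k less.prems(2,3) by (auto intro: ccontr simp: Suc_le_eq)
    let ?q = "p(k := p k - 1)"
    have "(\<Sum>j\<le>n. ?q j - ?p j) < (\<Sum>j\<le>n. p j - ?p j)"
      by (rule sum_strict_mono_ex1) (use k k1 in auto)
    moreover have "horizontal_strip ?p ?q"
      using le k unfolding horizontal_strip_def by (auto simp: le_diff_conv le_SucI)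
    moreover have "?q 0 = 0" "\<And>j. n < j \<Longrightarrow> ?q j = 0" using less.prems(2,3) by auto
    ultimately obtain Y z fin where Y: "strip n Y0 Y z fin" "block_size n Y = ?q"
      using less.hyps[of ?q] by blast
    have "Y \<in> concave_chains n" using strip_sound[OF Y(1)] by blast
    moreover have "block_size n Y k \<le> block_size n Y (k - 1)"
      using Y(2) le(2)[of "k - 1"] le(1)[of "k - 1"] k1 by auto
    ultimately obtain Z l where Z: "ins n Y k Z l" using ins_exists k1 by blast
    have "strip n Y0 Z (if fst l then z else Z n) (Some (k, l))"
    proof (rule strip.add[OF Y(1) Z])
      fix k0 l0 assume "fin = Some (k0, l0)"
      then have "?p k0 < ?q k0" using strip_sound[OF Y(1)] Y(2) by (auto simp: last_block_def)
      then have "?p k0 < p k0" by (auto split: if_splits)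
      then show "k \<le> k0" unfolding k_def by (rule Least_le)
    qed
    moreover have "block_size n Z = p" using insD(5)[OF Z] Y(2) k by auto
    ultimately show ?thesis by blast
  qed
qed

lemma strip_source_exists:
  assumes "Y \<in> concave_chains n" "marked_strip v z (Y n)" "strict_shape v"
  shows "\<exists>Y0 fin. strip n Y0 Y z fin \<and> Y0 n = v"
  using assms(1,2)
proof (induction "\<Sum>s\<le>n. Y n s - v s" arbitrary: Y z rule: less_induct)
  case less
  let ?w = "Y n"
  have ms: "vstrip v z" "\<And>s. v s = 0 \<Longrightarrow> z s = 0" "\<And>s. z s \<le> ?w s"
    "\<And>s. ?w (Suc s) < z s \<or> ?w (Suc s) = 0"
    using less.prems(2) by (auto simp: marked_strip_def)
  have vz: "v s \<le> z s" for s using vstripD[OF ms(1), of s] by auto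
  have sw: "strict_shape ?w" by (rule concave_chainsD(2)[OF less.prems(1)])
  have below: "t \<le> n" if "v t < ?w t" for t
    using chain_empty_row[OF less.prems(1), of t n] that by (cases "t \<le> n") auto
  \<comment> \<open>\<open>go\<close> peels off one entry \<open>(c, t)\<close>; its last premise
    ensures that whatever ends the remaining strip precedes this entry. It is used with the topmost
    unprimed cell or, without unprimed cells, with the lowest primed one.\<close>
  have go: ?case if t: "v t < ?w t" "strict_shape (?w(t := ?w t - 1))" "\<not> c \<Longrightarrow> 0 < v t"
    and z': "marked_strip v z' (?w(t := ?w t - 1))" "z = (if c then z' else ?w)"
    and pre: "\<And>l0. last_entry v z' (?w(t := ?w t - 1)) l0 \<Longrightarrow> precedes l0 (c, t)" for t c z'
  proof -
    let ?w' = "?w(t := ?w t - 1)"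
    have Zn: "Y n = add_box ?w' t" using t(1) by (auto simp: add_box_def)
    have "\<not> c \<Longrightarrow> 0 < ?w' t" using t by auto
    then obtain X k where X: "ins n X k Y (c, t)"
      using del_exists[OF less.prems(1) Zn t(2), of c] by blast
    have "add_box (X n) t = add_box ?w' t" using insD(6)[OF X] Zn by simp
    then have Xn: "X n = ?w'" by (rule add_box_inj)
    have "(\<Sum>s\<le>n. X n s - v s) < (\<Sum>s\<le>n. Y n s - v s)"
      unfolding Xn by (rule sum_strict_mono_ex1) (use t(1) below in auto)
    then obtain Y0 fin where Y0: "strip n Y0 X z' fin" "Y0 n = v"
      using less.hyps[of X z'] insD(1)[OF X] z'(1) Xn by auto
    have "strip n Y0 Y (if fst (c, t) then z' else Y n) (Some (k, (c, t)))"
    proof (rule strip.add[OF Y0(1) X])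
      fix k0 l0 assume "fin = Some (k0, l0)"
      then obtain W where "ins n W k0 X l0" "last_entry v z' ?w' l0"
        using strip_sound[OF Y0(1)] Y0(2) Xn by auto
      then show "k \<le> k0" using ins_order[OF _ X] pre by blast
    qed
    moreover have "(if fst (c, t) then z' else Y n) = z" using z'(2) by simp
    ultimately show ?thesis using Y0(2) by metis
  qed
  show ?case
  proof (cases "z = ?w")
    case False
    then have "\<exists>t. z t < ?w t" using ms(3) by (metis ext le_neq_implies_less)
    define t where "t = (LEAST t. z t < ?w t)"
    have t: "z t < ?w t" unfolding t_def using \<open>\<exists>t. z t < ?w t\<close> by (rule LeastI_ex)
    show ?thesis
    proof (rule go[of t True z])
      show "v t < ?w t" using t vz[of t] by simp
      show "strict_shape (?w(t := ?w t - 1))"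
        by (rule strict_shape_remove[OF sw]) (use t ms(4)[of t] in auto)
      show "marked_strip v z (?w(t := ?w t - 1))"
        unfolding marked_strip_def
      proof (intro conjI allI impI)
        fix s
        show "z s \<le> (?w(t := ?w t - 1)) s" using ms(3)[of s] t by auto
        show "(?w(t := ?w t - 1)) (Suc s) < z s \<or> (?w(t := ?w t - 1)) (Suc s) = 0"
          using ms(4)[of s] by auto
      qed (use ms in auto)
      fix l0 assume l0: "last_entry v z (?w(t := ?w t - 1)) l0"
      show "precedes l0 (True, t)"
      proof (cases "fst l0")
        case True
        then have "z (snd l0) < ?w (snd l0)" using l0 by (auto simp: last_entry_def split: if_splits)
        then have "t \<le> snd l0" unfolding t_def by (rule Least_le)
        then show ?thesis by (cases l0) simp
      qed (cases l0, simp)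
    qed simp_all
  next
    case zw: True
    show ?thesis
    proof (cases "v = ?w")
      case True
      then show ?thesis using strip.empty[OF less.prems(1)] zw by auto
    next
      case False
      have ex: "\<exists>t. v t < ?w t" using False vz zw by (metis ext le_neq_implies_less)
      define t where "t = (GREATEST t. v t < ?w t)"
      have t: "v t < ?w t" unfolding t_def using ex below by (rule GreatestI_ex_nat)
      have high: "v u = ?w u" if "t < u" for u
        using Greatest_le_nat[of "\<lambda>t. v t < ?w t" u n, OF _ below] that vz[of u] zw unfolding t_def
        by (metis le_neq_implies_less not_le)
      have wt: "?w t = Suc (v t)" using t vstripD[OF ms(1), of t] zw by auto
      have sw': "strict_shape (?w(t := ?w t - 1))"
        by (rule strict_shape_remove[OF sw])
          (use wt high[of "Suc t"] assms(3)[unfolded strict_shape_def, rule_format, of t] in auto)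
      show ?thesis
      proof (rule go[of t False "?w(t := ?w t - 1)"])
        show "0 < v t" using ms(2)[of t] t zw by auto
        show "marked_strip v (?w(t := ?w t - 1)) (?w(t := ?w t - 1))"
          unfolding marked_strip_def
        proof (intro conjI allI impI)
          show "vstrip v (?w(t := ?w t - 1))"
            unfolding vstrip_def using vstripD[OF ms(1)] zw wt by auto
          show "(?w(t := ?w t - 1)) s = 0" if "v s = 0" for s using ms(2)[OF that] zw by auto
        qed (use sw' in \<open>auto simp: strict_shape_def\<close>)
        fix l0 assume l0: "last_entry v (?w(t := ?w t - 1)) (?w(t := ?w t - 1)) l0"
        then have "\<not> fst l0" "v (snd l0) < (?w(t := ?w t - 1)) (snd l0)"
          by (auto simp: last_entry_def split: if_splits)
        moreover from this have "snd l0 \<noteq> t" using wt by auto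
        ultimately have "snd l0 < t" using high[of "snd l0"] by (cases "snd l0" t rule: linorder_cases) auto
        then show "precedes l0 (False, t)" using \<open>\<not> fst l0\<close> by (cases l0) simp
      qed (use t sw' zw in auto)
    qed
  qed
qed

section \<open>Counting by removal of letters; symmetry of the counts\<close>

definition total :: "nat \<Rightarrow> (nat \<Rightarrow> nat) \<Rightarrow> nat" where
  "total n p = (\<Sum>k\<le>n. p k)"

text \<open>The head of the list is the multiplicity of the letter removed first. For skew fillings
  this is the smallest letter, as the cells given up are the left ends of rows.\<close>

primrec strip_count :: "nat \<Rightarrow> nat list \<Rightarrow> (nat \<Rightarrow> nat) \<Rightarrow> nat" where
  "strip_count n [] p = (if p = (\<lambda>_. 0) then 1 else 0)"
| "strip_count n (a # L) p =
     (\<Sum>q\<in>{q. horizontal_strip q p \<and> total n p = total n q + a}. strip_count n L q)"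

text \<open>Here the head belongs to the largest letter, which occupies the outer rim
  \<open>w / v\<close> with its primed and unprimed copies.\<close>

primrec marked_count :: "nat \<Rightarrow> nat list \<Rightarrow> (nat \<Rightarrow> nat) \<Rightarrow> nat" where
  "marked_count n [] w = (if w = (\<lambda>_. 0) then 1 else 0)"
| "marked_count n (a # L) w =
     (\<Sum>(v, z)\<in>{(v, z). strict_shape v \<and> marked_strip v z w \<and> total n w = total n v + a}.
        marked_count n L v)"

definition block_vector :: "nat \<Rightarrow> (nat \<Rightarrow> nat) \<Rightarrow> bool" where
  "block_vector n p \<longleftrightarrow> p 0 = 0 \<and> (\<forall>k>n. p k = 0)"

lemma finite_bounded_funs:
  fixes p :: "nat \<Rightarrow> nat"
  assumes "\<And>k. n < k \<Longrightarrow> p k = 0"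
  shows "finite {q. \<forall>k. q k \<le> p k}"
proof -
  have "inj_on (\<lambda>q. restrict q {..n}) {q. \<forall>k. q k \<le> p k}"
  proof (rule inj_onI, rule ext)
    fix q q' k assume *: "q \<in> {q. \<forall>k. q k \<le> p k}" "q' \<in> {q. \<forall>k. q k \<le> p k}"
      "restrict q {..n} = restrict q' {..n}"
    show "q k = q' k"
    proof (cases "k \<le> n")
      case True
      then show ?thesis using fun_cong[OF *(3), of k] by simp
    next
      case False
      then have "p k = 0" using assms by simp
      moreover have "q k \<le> p k" "q' k \<le> p k" using *(1,2) by auto
      ultimately show ?thesis by simp
    qed
  qed
  moreover have "(\<lambda>q. restrict q {..n}) ` {q. \<forall>k. q k \<le> p k} \<subseteq> PiE {..n} (\<lambda>k. {..p k})"
    by (rule image_subsetI) (simp add: restrict_PiE_iff)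
  then have "finite ((\<lambda>q. restrict q {..n}) ` {q. \<forall>k. q k \<le> p k})"
    by (rule finite_subset) (intro finite_PiE, auto)
  ultimately show ?thesis using finite_imageD by blast
qed

lemma horizontal_strip_le: "horizontal_strip q p \<Longrightarrow> q k \<le> p k"
  by (simp add: horizontal_strip_def)

lemma block_vector_strip: "horizontal_strip q p \<Longrightarrow> block_vector n p \<Longrightarrow> block_vector n q"
  unfolding block_vector_def horizontal_strip_def by (metis le_zero_eq)

lemma finite_horizontal_strips:
  assumes "block_vector n p"
  shows "finite {q. horizontal_strip q p \<and> P q}"
  by (rule finite_subset[OF _ finite_bounded_funs[of n p]])
    (use assms in \<open>auto simp: horizontal_strip_def block_vector_def\<close>)

lemma marked_strip_le:
  assumes "marked_strip v z w"
  shows "v s \<le> z s" "z s \<le> w s"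
proof -
  show "z s \<le> w s" using assms by (simp add: marked_strip_def)
  have "vstrip v z" using assms by (simp add: marked_strip_def)
  then show "v s \<le> z s" using vstripD[of v z s] by auto
qed

lemma finite_marked_strips:
  assumes "\<And>k. n < k \<Longrightarrow> w k = 0"
  shows "finite {(v, z). P v \<and> marked_strip v z w \<and> Q v}"
proof (rule finite_subset)
  show "{(v, z). P v \<and> marked_strip v z w \<and> Q v} \<subseteq> {q. \<forall>k. q k \<le> w k} \<times> {q. \<forall>k. q k \<le> w k}"
    using marked_strip_le le_trans by blast
  show "finite ({q. \<forall>k. q k \<le> w k} \<times> {q. \<forall>k. q k \<le> w k})"
    by (intro finite_cartesian_product finite_bounded_funs[of n] assms)
qed

text \<open>The \<open>max\<close> and the summand with \<open>min\<close> are the least and the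
  greatest value that both strip conditions allow at \<open>k\<close>; their sum minus
  \<open>p k\<close> is the reflection in that interval.\<close>

definition toggle :: "(nat \<Rightarrow> nat) \<Rightarrow> (nat \<Rightarrow> nat) \<Rightarrow> (nat \<Rightarrow> nat) \<Rightarrow> nat \<Rightarrow> nat" where
  "toggle q r p k = max (q k) (r (Suc k) - 1) +
     (case k of 0 \<Rightarrow> 0 | Suc j \<Rightarrow> min (r k) (Suc (q j))) - p k"

text \<open>The rows of the shape between two horizontal strips vary independently in intervals, and
  reflecting each interval exchanges the sizes of the strips.\<close>

lemma toggle_strips:
  assumes s: "horizontal_strip q p" "horizontal_strip p r" and r: "block_vector n r"
  shows "horizontal_strip q (toggle q r p)" "horizontal_strip (toggle q r p) r"
    "toggle q r (toggle q r p) = p"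
    "total n (toggle q r p) + total n p = total n q + total n r"
proof -
  define lo where "lo k = max (q k) (r (Suc k) - 1)" for k
  define hi where "hi k = (case k of 0 \<Rightarrow> 0 | Suc j \<Rightarrow> min (r k) (Suc (q j)))" for k
  have t: "toggle q r p' k = lo k + hi k - p' k" for p' k
    by (simp add: toggle_def lo_def hi_def)
  have le: "q k \<le> p k" "p (Suc k) \<le> Suc (q k)" "p k \<le> r k" "r (Suc k) \<le> Suc (p k)" for k
    using s by (auto simp: horizontal_strip_def)
  have r0: "r 0 = 0" "r (Suc n) = 0" using r by (auto simp: block_vector_def)
  have lp: "lo k \<le> p k" for k using le[of k] by (auto simp: lo_def)
  have ph: "p k \<le> hi k" for k
    using le[of k] le(2)[of "k - 1"] r0 by (cases k) (auto simp: hi_def)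
  have b: "lo k \<le> toggle q r p k" "toggle q r p k \<le> hi k" for k
    using lp[of k] ph[of k] by (auto simp: t)
  have h: "hi k \<le> r k" "hi (Suc k) \<le> Suc (q k)" for k
    by (cases k; simp add: hi_def)+
  have l: "q k \<le> lo k" "r (Suc k) \<le> Suc (lo k)" for k by (auto simp: lo_def)
  show "horizontal_strip q (toggle q r p)" "horizontal_strip (toggle q r p) r"
    unfolding horizontal_strip_def using b h l by (meson Suc_le_mono le_trans)+
  show "toggle q r (toggle q r p) = p"
  proof
    fix k show "toggle q r (toggle q r p) k = p k" using lp[of k] ph[of k] by (simp add: t)
  qed
  have "toggle q r p k + p k = lo k + hi k" for k using lp[of k] ph[of k] by (simp add: t)
  then have "total n (toggle q r p) + total n p = (\<Sum>k\<le>n. lo k) + (\<Sum>k\<le>n. hi k)"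
    by (simp add: total_def sum.distrib[symmetric])
  also have "(\<Sum>k\<le>n. hi k) = (\<Sum>k\<le>Suc n. hi k)" using r0 by (simp add: hi_def)
  also have "\<dots> = (\<Sum>k\<le>n. hi (Suc k))" by (simp only: sum.atMost_Suc_shift) (simp add: hi_def)
  \<comment> \<open>After the shift of indices the bounds pair up by
    \<open>max x (y - 1) + min y (Suc x) = x + y\<close>, with \<open>x = q k\<close> and
    \<open>y = r (Suc k)\<close>.\<close>
  also have "(\<Sum>k\<le>n. lo k) + (\<Sum>k\<le>n. hi (Suc k)) = (\<Sum>k\<le>n. q k + r (Suc k))"
    unfolding sum.distrib[symmetric]
    by (rule sum.cong) (auto simp: lo_def hi_def)
  also have "\<dots> = total n q + (\<Sum>k\<le>Suc n. r k)"
    unfolding sum.distrib by (simp only: sum.atMost_Suc_shift) (simp add: total_def r0)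
  also have "\<dots> = total n q + total n r" by (simp add: total_def r0)
  finally show "total n (toggle q r p) + total n p = total n q + total n r" .
qed

lemma strip_count_swap:
  assumes p: "block_vector n p"
  shows "strip_count n (a # b # L) p = strip_count n (b # a # L) p"
proof -
  define S where "S a b = (SIGMA q:{q. horizontal_strip q p \<and> total n p = total n q + a}.
    {r. horizontal_strip r q \<and> total n q = total n r + b})" for a b
  have e: "strip_count n (a # b # L) p = (\<Sum>(q, r)\<in>S a b. strip_count n L r)" for a b
    unfolding S_def strip_count.simps
  proof (rule sum.Sigma)
    show "finite {q. horizontal_strip q p \<and> total n p = total n q + a}"
      by (rule finite_horizontal_strips[OF p])
    show "\<forall>q\<in>{q. horizontal_strip q p \<and> total n p = total n q + a}.
        finite {r. horizontal_strip r q \<and> total n q = total n r + b}"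
    proof
      fix q assume "q \<in> {q. horizontal_strip q p \<and> total n p = total n q + a}"
      then have "block_vector n q" using block_vector_strip p by blast
      then show "finite {r. horizontal_strip r q \<and> total n q = total n r + b}"
        by (rule finite_horizontal_strips)
    qed
  qed
  have "(\<Sum>(q, r)\<in>S a b. strip_count n L r) = (\<Sum>(q, r)\<in>S b a. strip_count n L r)"
  proof (rule sum.reindex_bij_witness[of _ "\<lambda>(q, r). (toggle r p q, r)" "\<lambda>(q, r). (toggle r p q, r)"])
    have tog: "(toggle r p q, r) \<in> S b a \<and> toggle r p (toggle r p q) = q" if "(q, r) \<in> S a b" for q r a b
    proof -
      have h: "horizontal_strip q p" "horizontal_strip r q" "total n p = total n q + a"
        "total n q = total n r + b" using that by (auto simp: S_def)
      show ?thesis using toggle_strips[OF h(2,1) p] h(3,4) by (auto simp: S_def)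
    qed
    fix x :: "(nat \<Rightarrow> nat) \<times> (nat \<Rightarrow> nat)"
    obtain q r where x: "x = (q, r)" by (cases x)
    show "x \<in> S a b \<Longrightarrow> (case case x of (q, r) \<Rightarrow> (toggle r p q, r) of (q, r) \<Rightarrow> (toggle r p q, r)) = x"
      "x \<in> S b a \<Longrightarrow> (case case x of (q, r) \<Rightarrow> (toggle r p q, r) of (q, r) \<Rightarrow> (toggle r p q, r)) = x"
      "x \<in> S a b \<Longrightarrow> (case x of (q, r) \<Rightarrow> (toggle r p q, r)) \<in> S b a"
      "x \<in> S b a \<Longrightarrow> (case x of (q, r) \<Rightarrow> (toggle r p q, r)) \<in> S a b"
      using tog[of q r a b] tog[of q r b a] unfolding x by simp_all
    show "x \<in> S a b \<Longrightarrow> (case case x of (q, r) \<Rightarrow> (toggle r p q, r) of (q, r) \<Rightarrow> strip_count n L r) =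
        (case x of (q, r) \<Rightarrow> strip_count n L r)"
      by (cases x) simp
  qed
  then show ?thesis using e by simp
qed

lemma strip_count_Cons_cong:
  assumes "\<And>q. block_vector n q \<Longrightarrow> strip_count n L q = strip_count n L' q" "block_vector n p"
  shows "strip_count n (a # L) p = strip_count n (a # L') p"
  using assms block_vector_strip by (auto intro!: sum.cong)

lemma strip_count_snoc:
  "block_vector n p \<Longrightarrow> strip_count n (L @ [a]) p = strip_count n (a # L) p"
proof (induction L arbitrary: p)
  case (Cons b L)
  have "strip_count n ((b # L) @ [a]) p = strip_count n (b # a # L) p"
    using strip_count_Cons_cong[OF Cons.IH Cons.prems] by simp
  then show ?case using strip_count_swap[OF Cons.prems] by simp
qed simp

lemma strip_count_rev:
  "block_vector n p \<Longrightarrow> strip_count n (rev L) p = strip_count n L p"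
proof (induction L arbitrary: p)
  case (Cons a L)
  then show ?case
    using strip_count_snoc[OF Cons.prems, of "rev L" a] strip_count_Cons_cong[OF Cons.IH Cons.prems]
    by simp
qed simp

lemma total_tail: "total n v = tail_cells (Suc n) v 0"
  by (simp add: total_def tail_cells_def atLeast0LessThan lessThan_Suc_atMost)

lemma total_chain:
  assumes "Y \<in> concave_chains n"
  shows "total n (Y n) = total n (block_size n Y)"
proof -
  have "tail_cells (Suc n) (Y k) 0 = (\<Sum>j\<le>k. block_size n Y j)" for k
  proof (induction k)
    case 0
    then show ?case using concave_chainsD(1)[OF assms] by (simp add: block_size_0 tail_cells_def)
  next
    case (Suc k)
    then show ?case
      using tail_mono_vstrip[OF concave_chainsD(3)[OF assms, of k], of "Suc n" 0] by (simp add: block_size_def)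
  qed
  then show ?thesis by (simp add: total_tail) (simp add: total_def total_tail[symmetric])
qed

lemma chain_mono:
  assumes "Y \<in> concave_chains n" "j \<le> k"
  shows "Y j u \<le> Y k u"
  using assms(2)
proof (induction rule: dec_induct)
  case (step i)
  then show ?case using vstripD[OF concave_chainsD(3)[OF assms(1), of i], of u] by auto
qed simp

lemma finite_chains: "finite (concave_chains n)"
proof -
  let ?r = "\<lambda>Y. restrict (\<lambda>(k, u). Y k u) ({..n} \<times> {..n})"
  have "inj_on ?r (concave_chains n)"
  proof (rule inj_onI, rule ext, rule ext)
    fix Y Z k u
    assume Y: "Y \<in> concave_chains n" and Z: "Z \<in> concave_chains n" and e: "?r Y = ?r Z"
    have "Y (min k n) u = Z (min k n) u"
    proof (cases "u \<le> n")
      case True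
      then show ?thesis using fun_cong[OF e, of "(min k n, u)"] by simp
    next
      case False
      then show ?thesis using chain_empty_row[OF Y, of u] chain_empty_row[OF Z, of u] by simp
    qed
    moreover have "Y k = Y (min k n)" "Z k = Z (min k n)"
      using concave_chainsD(5)[OF Y, of k] concave_chainsD(5)[OF Z, of k] by (simp_all add: min_def)
    ultimately show "Y k u = Z k u" by metis
  qed
  moreover have "?r ` concave_chains n \<subseteq> PiE ({..n} \<times> {..n}) (\<lambda>_. {..n})"
  proof (rule image_subsetI)
    fix Y assume Y: "Y \<in> concave_chains n"
    have "Y k u \<le> n" if "k \<le> n" for k u
    proof (cases "Y k u = 0")
      case False
      then have "u + Y k u \<le> 0 + Y k 0" using strict_shape_le[OF concave_chainsD(2)[OF Y], of 0 u k] by simp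
      then show ?thesis using chain_first_row[OF Y, of k] that by simp
    qed simp
    then show "?r Y \<in> PiE ({..n} \<times> {..n}) (\<lambda>_. {..n})" by auto
  qed
  then have "finite (?r ` concave_chains n)"
    by (rule finite_subset) (intro finite_PiE, auto)
  ultimately show ?thesis using finite_imageD by blast
qed

lemma strip_correspondence:
  assumes "strip n Y0 Y z fin"
  shows "Y0 \<in> concave_chains n" "Y \<in> concave_chains n" "horizontal_strip (block_size n Y0) (block_size n Y)"
    "marked_strip (Y0 n) z (Y n)" "strict_shape (Y0 n)"
    "total n (Y n) = total n (block_size n Y)" "total n (Y0 n) = total n (block_size n Y0)"
  using strip_sound[OF assms] total_chain concave_chainsD(2) by blast+

text \<open>Insertion of a strip matches a chain with a marked strip inside its final shape
  (\<open>A\<close>) against a smaller chain with a horizontal strip of block sizes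
  (\<open>B\<close>). Sizes agree because a chain has as many cells as its blocks together, so both
  counts obey one recursion.\<close>

theorem marked_count_chains:
  assumes "block_vector n p"
  shows "(\<Sum>Y\<in>{Y \<in> concave_chains n. block_size n Y = p}. marked_count n L (Y n)) = strip_count n L p"
  using assms
proof (induction L arbitrary: p)
  case Nil
  have zero: "Y n = (\<lambda>_. 0) \<longleftrightarrow> p = (\<lambda>_. 0)" if "Y \<in> concave_chains n" "block_size n Y = p" for Y
  proof -
    have "Y n = (\<lambda>_. 0) \<longleftrightarrow> total n (Y n) = 0"
    proof
      assume "total n (Y n) = 0"
      then have z: "Y n u = 0" if "u \<le> n" for u using that by (simp add: total_def)
      show "Y n = (\<lambda>_. 0)"
      proof
        fix u show "Y n u = 0" using z[of u] chain_empty_row[OF that(1), of u n] by (cases "u \<le> n") auto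
      qed
    qed (simp add: total_def)
    moreover have "p = (\<lambda>_. 0) \<longleftrightarrow> total n p = 0"
    proof
      assume "total n p = 0"
      then have z: "p u = 0" if "u \<le> n" for u using that by (simp add: total_def)
      show "p = (\<lambda>_. 0)"
      proof
        fix u show "p u = 0" using z[of u] Nil unfolding block_vector_def by (cases "u \<le> n") auto
      qed
    qed (simp add: total_def)
    ultimately show ?thesis using total_chain[OF that(1)] that(2) by simp
  qed
  show ?case
  proof (cases "p = (\<lambda>_. 0)")
    case True
    have "{Y \<in> concave_chains n. block_size n Y = p} = {\<lambda>_ _. 0}"
    proof (intro equalityI subsetI)
      fix Y assume Y: "Y \<in> {Y \<in> concave_chains n. block_size n Y = p}"
      then have Yn: "Y n = (\<lambda>_. 0)" using zero[of Y] True by simp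
      have "Y k u = 0" for k u
        using chain_mono[of Y n k "max k n" u] concave_chainsD(5)[of Y n "max k n"] Y Yn by simp
      then have "Y = (\<lambda>_ _. 0)" by (intro ext)
      then show "Y \<in> {\<lambda>_ _. 0}" by simp
    next
      fix Y :: "nat \<Rightarrow> nat \<Rightarrow> nat" assume "Y \<in> {\<lambda>_ _. 0}"
      then have Y: "Y = (\<lambda>_ _. 0)" by simp
      have "Y \<in> concave_chains n"
        by (rule chainsI) (auto simp: Y strict_shape_def vstrip_def row_concave_def tail_cells_def)
      then show "Y \<in> {Y \<in> concave_chains n. block_size n Y = p}"
        using True by (auto simp: Y block_size_def tail_cells_def)
    qed
    then show ?thesis using True by simp
  next
    case False
    then show ?thesis using zero by (simp add: sum.neutral)
  qed
next
  case (Cons a L)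
  let ?C = "\<lambda>p. {Y \<in> concave_chains n. block_size n Y = p}"
  let ?M = "\<lambda>w. {(v, z). strict_shape v \<and> marked_strip v z w \<and> total n w = total n v + a}"
  let ?H = "{q. horizontal_strip q p \<and> total n p = total n q + a}"
  define A where "A = (SIGMA Y:?C p. ?M (Y n))"
  define B where "B = (SIGMA q:?H. ?C q)"
  \<comment> \<open>\<open>R1\<close> and \<open>R2\<close> show that this relation is total on both
    sides, \<open>R3\<close> and \<open>R4\<close> that it is one-to-one; the bijection is then
    obtained by choice.\<close>
  define R where "R x y \<longleftrightarrow> (\<exists>fin. strip n (snd y) (fst x) (snd (snd x)) fin \<and>
     fst (snd x) = snd y n \<and> fst y = block_size n (snd y))"
    for x :: "(nat \<Rightarrow> nat \<Rightarrow> nat) \<times> (nat \<Rightarrow> nat) \<times> (nat \<Rightarrow> nat)"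
      and y :: "(nat \<Rightarrow> nat) \<times> (nat \<Rightarrow> nat \<Rightarrow> nat)"
  have R1: "\<exists>y\<in>B. R x y" if "x \<in> A" for x
  proof -
    obtain Y v z where x: "x = (Y, v, z)" by (cases x)
    have Y: "Y \<in> concave_chains n" "block_size n Y = p" "strict_shape v" "marked_strip v z (Y n)"
      "total n (Y n) = total n v + a" using that by (auto simp: A_def x)
    obtain Y0 fin where s: "strip n Y0 Y z fin" "Y0 n = v"
      using strip_source_exists[OF Y(1,4,3)] by blast
    have "(block_size n Y0, Y0) \<in> B"
      using strip_correspondence[OF s(1)] Y(2,5) s(2) by (auto simp: B_def)
    moreover have "R x (block_size n Y0, Y0)" using s by (auto simp: R_def x)
    ultimately show ?thesis by blast
  qed
  have R2: "\<exists>x\<in>A. R x y" if "y \<in> B" for y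
  proof -
    obtain q Y0 where y: "y = (q, Y0)" by (cases y)
    have q: "horizontal_strip q p" "total n p = total n q + a" "Y0 \<in> concave_chains n" "block_size n Y0 = q"
      using that by (auto simp: B_def y)
    obtain Y z fin where s: "strip n Y0 Y z fin" "block_size n Y = p"
      using strip_exists[OF q(3)] q(1,4) Cons.prems unfolding block_vector_def by blast
    have "(Y, Y0 n, z) \<in> A"
      using strip_correspondence[OF s(1)] q s(2) by (auto simp: A_def)
    moreover have "R (Y, Y0 n, z) y" using s q by (auto simp: R_def y)
    ultimately show ?thesis by blast
  qed
  have R3: "y = y'" if "R x y" "R x y'" for x y y'
    using that strip_source_unique unfolding R_def by (metis prod.collapse)
  have R4: "x = x'" if "R x y" "R x' y" "x \<in> A" "x' \<in> A" for x x' y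
  proof -
    have "block_size n (fst x) = block_size n (fst x')" using that(3,4) by (auto simp: A_def)
    then show ?thesis using that(1,2) strip_unique unfolding R_def by (metis prod.collapse)
  qed
  have finC: "finite (?C q)" for q using finite_chains[of n] by simp
  have emp: "Y n k = 0" if "Y \<in> concave_chains n" "n < k" for Y k using chain_empty_row[OF that(1), of k] that by simp
  have "(\<Sum>Y\<in>?C p. marked_count n (a # L) (Y n)) = (\<Sum>Y\<in>?C p. \<Sum>(v, z)\<in>?M (Y n). marked_count n L v)"
    by simp
  also have "\<dots> = (\<Sum>x\<in>A. marked_count n L (fst (snd x)))"
    unfolding A_def
    by (subst sum.Sigma) (use finC finite_marked_strips[OF emp] in \<open>auto intro!: sum.cong simp: split_def\<close>)
  also have "\<dots> = (\<Sum>y\<in>B. marked_count n L (snd y n))"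
  proof (rule sum.reindex_bij_witness[of _ "\<lambda>y. SOME x. x \<in> A \<and> R x y" "\<lambda>x. SOME y. y \<in> B \<and> R x y"])
    have j: "(SOME y. y \<in> B \<and> R x y) \<in> B \<and> R x (SOME y. y \<in> B \<and> R x y)" if "x \<in> A" for x
      by (rule someI_ex) (use R1[OF that] in blast)
    have i: "(SOME x. x \<in> A \<and> R x y) \<in> A \<and> R (SOME x. x \<in> A \<and> R x y) y" if "y \<in> B" for y
      by (rule someI_ex) (use R2[OF that] in blast)
    show "(SOME x. x \<in> A \<and> R x (SOME y. y \<in> B \<and> R a y)) = a" if "a \<in> A" for a
      using i[of "SOME y. y \<in> B \<and> R a y"] j[OF that] R4 that by blast
    show "(SOME y. y \<in> B \<and> R a y) \<in> B" if "a \<in> A" for a using j[OF that] by blast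
    show "(SOME y. y \<in> B \<and> R (SOME x. x \<in> A \<and> R x b) y) = b" if "b \<in> B" for b
      using j[of "SOME x. x \<in> A \<and> R x b"] i[OF that] R3 by blast
    show "(SOME x. x \<in> A \<and> R x b) \<in> A" if "b \<in> B" for b using i[OF that] by blast
    show "marked_count n L (snd (SOME y. y \<in> B \<and> R a y) n) = marked_count n L (fst (snd a))"
      if "a \<in> A" for a using j[OF that] unfolding R_def by metis
  qed
  also have "\<dots> = (\<Sum>q\<in>?H. \<Sum>Y\<in>?C q. marked_count n L (Y n))"
    unfolding B_def
    by (subst sum.Sigma) (use finC finite_horizontal_strips[OF Cons.prems] in \<open>auto intro!: sum.cong simp: split_def\<close>)
  also have "\<dots> = (\<Sum>q\<in>?H. strip_count n L q)"
    using Cons.IH block_vector_strip Cons.prems by (intro sum.cong) auto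
  finally show ?case by simp
qed

section \<open>Fillings of skew staircases\<close>

text \<open>Fillings are sorted by the set of cells not carrying \<open>a\<close>. This serves both
  for the smallest letter of a skew filling and for the largest of a shifted one.\<close>

lemma card_split_filling:
  fixes D :: "'q \<Rightarrow> 'x set" and S :: "'x set" and a :: 'y
  assumes fin: "finite I" "\<And>q. q \<in> I \<Longrightarrow> finite (F q)"
    and inj: "inj_on D I" and sub: "\<And>q. q \<in> I \<Longrightarrow> D q \<subseteq> S"
    and F: "\<And>q T. q \<in> I \<Longrightarrow> T \<in> F q \<Longrightarrow> T \<in> extensional (D q) \<and> (\<forall>x\<in>D q. T x \<noteq> a)"
    and fwd: "\<And>T. T \<in> E \<Longrightarrow> T \<in> extensional S \<and>
      (\<exists>q\<in>I. D q = {x \<in> S. T x \<noteq> a} \<and> restrict T (D q) \<in> F q)"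
    and bwd: "\<And>q T. q \<in> I \<Longrightarrow> T \<in> F q \<Longrightarrow>
      (\<lambda>x. if x \<in> D q then T x else if x \<in> S then a else undefined) \<in> E"
  shows "card E = (\<Sum>q\<in>I. card (F q))"
proof -
  define g where "g y = (\<lambda>x. if x \<in> D (fst y) then snd y x else if x \<in> S then a else undefined)"
    for y :: "'q \<times> ('x \<Rightarrow> 'y)"
  have lev: "{x \<in> S. g (q, T) x \<noteq> a} = D q" if "q \<in> I" "T \<in> F q" for q T
    using F[OF that] sub[OF that(1)] by (auto simp: g_def)
  have "bij_betw g (SIGMA q:I. F q) E"
    unfolding bij_betw_def
  proof
    show "inj_on g (SIGMA q:I. F q)"
    proof (rule inj_onI)
      fix y y' assume y: "y \<in> (SIGMA q:I. F q)" "y' \<in> (SIGMA q:I. F q)" "g y = g y'"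
      obtain q T q' T' where e: "y = (q, T)" "y' = (q', T')" by (cases y; cases y')
      have m: "q \<in> I" "T \<in> F q" "q' \<in> I" "T' \<in> F q'" using y e by auto
      have "D q = D q'" using lev[OF m(1,2)] lev[OF m(3,4)] y(3) e by simp
      then have q: "q = q'" using inj m by (auto dest: inj_onD)
      have "T = T'"
      proof (rule extensionalityI)
        show "T \<in> extensional (D q)" "T' \<in> extensional (D q)" using F m q by auto
        fix x assume "x \<in> D q"
        then show "T x = T' x" using fun_cong[OF y(3), of x] q by (simp add: e g_def)
      qed
      then show "y = y'" using q e by simp
    qed
    show "g ` (SIGMA q:I. F q) = E"
    proof (intro equalityI subsetI)
      fix T assume "T \<in> g ` (SIGMA q:I. F q)"
      then show "T \<in> E" using bwd by (auto simp: g_def)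
    next
      fix T assume "T \<in> E"
      then obtain q where q: "T \<in> extensional S" "q \<in> I" "D q = {x \<in> S. T x \<noteq> a}" "restrict T (D q) \<in> F q"
        using fwd by blast
      have "T = g (q, restrict T (D q))"
        using q(1) by (intro ext) (auto simp: g_def q(3) extensional_def)
      then show "T \<in> g ` (SIGMA q:I. F q)" using q(2,4) by blast
    qed
  qed
  then have "card E = card (SIGMA q:I. F q)" using bij_betw_same_card by metis
  then show ?thesis using fin by (simp add: card_SigmaI)
qed

lemma finite_fillings_content:
  assumes "finite S"
  shows "finite {T \<in> S \<rightarrow>\<^sub>E A. image_mset T (mset_set S) = m \<and> P T}"
proof (rule finite_subset)
  show "{T \<in> S \<rightarrow>\<^sub>E A. image_mset T (mset_set S) = m \<and> P T} \<subseteq> S \<rightarrow>\<^sub>E set_mset m"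
    using assms by (auto simp: PiE_iff intro: extensional_arb)
  show "finite (S \<rightarrow>\<^sub>E set_mset m)" using assms by (intro finite_PiE) auto
qed

lemma content_split:
  assumes "finite S" "D \<subseteq> S" "\<And>x. x \<in> S - D \<Longrightarrow> f x = a"
  shows "image_mset f (mset_set S) = image_mset f (mset_set D) + replicate_mset (card S - card D) a"
proof -
  have f: "finite D" using assms finite_subset by blast
  have "mset_set S = mset_set D + mset_set (S - D)"
    using mset_set_Union[of D "S - D"] f assms by (simp add: Un_absorb1)
  moreover have "image_mset f (mset_set (S - D)) = image_mset (\<lambda>_. a) (mset_set (S - D))"
    using assms by (intro image_mset_cong) auto
  moreover have "card (S - D) = card S - card D" using card_Diff_subset[OF f assms(2)] .
  ultimately show ?thesis by (simp add: image_mset_const_eq)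
qed

lemma filter_mset_remove_letter:
  "a \<notin># M \<Longrightarrow> filter_mset (\<lambda>x. x \<noteq> a) (M + replicate_mset k a) = M"
  by (rule multiset_eqI) (auto simp: not_in_iff)

lemma filter_mset_add_letter:
  "filter_mset (\<lambda>x. x \<noteq> a) m + replicate_mset (count m a) a = m"
  by (rule multiset_eqI) auto

definition semistandard :: "cell set \<Rightarrow> (cell \<Rightarrow> nat) \<Rightarrow> bool" where
  "semistandard S T \<longleftrightarrow> (\<forall>r c c'. (r, c) \<in> S \<and> (r, c') \<in> S \<and> c < c' \<longrightarrow> T (r, c) \<le> T (r, c')) \<and>
     (\<forall>r r' c. (r, c) \<in> S \<and> (r', c) \<in> S \<and> r < r' \<longrightarrow> T (r, c) < T (r', c))"

text \<open>Row \<open>n - k\<close> of the staircase has \<open>k\<close> cells, of which the last \<open>p k\<close> are kept.\<close>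

definition staircase_cells :: "nat \<Rightarrow> (nat \<Rightarrow> nat) \<Rightarrow> cell set" where
  "staircase_cells n p = {(r, c). r < n \<and> c < n - r \<and> n - r \<le> c + p (n - r)}"

text \<open>The letters up to \<open>j\<close> are those already removed.\<close>

definition skew_fillings :: "nat \<Rightarrow> (nat \<Rightarrow> nat) \<Rightarrow> nat \<Rightarrow> monomial \<Rightarrow> (cell \<Rightarrow> nat) set" where
  "skew_fillings n p j m = {T \<in> staircase_cells n p \<rightarrow>\<^sub>E {j<..}.
     image_mset T (mset_set (staircase_cells n p)) = m \<and> semistandard (staircase_cells n p) T}"

text \<open>For \<open>p k = k - \<mu>\<close> evaluated at row \<open>n - k\<close>, the second
  condition says that the parts of \<open>\<mu>\<close> weakly decrease.\<close>

definition inner_partition :: "nat \<Rightarrow> (nat \<Rightarrow> nat) \<Rightarrow> bool" where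
  "inner_partition n p \<longleftrightarrow> block_vector n p \<and> (\<forall>k. p (Suc k) \<le> Suc (p k))"

lemma inner_partition_le: "inner_partition n p \<Longrightarrow> p k \<le> k"
proof (induction k)
  case 0
  then show ?case by (simp add: inner_partition_def block_vector_def)
next
  case (Suc k)
  then show ?case unfolding inner_partition_def by (metis Suc_le_mono le_trans)
qed

lemma inner_partition_strip:
  assumes "horizontal_strip q p" "inner_partition n p"
  shows "inner_partition n q"
  using assms block_vector_strip[OF assms(1)] unfolding inner_partition_def horizontal_strip_def
  by (meson le_trans)

lemma staircase_cells_Sigma:
  "staircase_cells n p = (SIGMA r:{..<n}. {n - r - p (n - r)..<n - r})"
  by (auto simp: staircase_cells_def)

lemma finite_staircase_cells: "finite (staircase_cells n p)"
  unfolding staircase_cells_Sigma by blast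

lemma card_staircase_cells:
  assumes "inner_partition n p"
  shows "card (staircase_cells n p) = total n p"
proof -
  have "card (staircase_cells n p) = (\<Sum>r<n. p (n - r))"
  proof -
    have "card {n - r - p (n - r)..<n - r} = p (n - r)" for r
      unfolding card_atLeastLessThan using inner_partition_le[OF assms] by (rule diff_diff_cancel)
    then show ?thesis unfolding staircase_cells_Sigma by (subst card_SigmaI) auto
  qed
  also have "\<dots> = (\<Sum>k<n. p (Suc k))"
    by (rule sum.reindex_bij_witness[of _ "\<lambda>k. n - Suc k" "\<lambda>r. n - Suc r"]) (auto simp: Suc_diff_Suc)
  also have "\<dots> = (\<Sum>k<Suc n. p k)"
    using assms by (simp only: sum.lessThan_Suc_shift) (simp add: inner_partition_def block_vector_def)
  finally show ?thesis by (simp add: total_def lessThan_Suc_atMost)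
qed

lemma staircase_cells_iff:
  assumes "inner_partition n p" "1 \<le> k" "k \<le> n"
  shows "(n - k, c) \<in> staircase_cells n p \<longleftrightarrow> k - p k \<le> c \<and> c < k"
  using assms(2,3) by (auto simp: staircase_cells_def)

lemma inj_staircase_cells: "inj_on (staircase_cells n) {p. inner_partition n p}"
proof (rule inj_onI, rule ext)
  fix p q k assume p: "p \<in> {p. inner_partition n p}" "q \<in> {p. inner_partition n p}"
    and e: "staircase_cells n p = staircase_cells n q"
  show "p k = q k"
  proof (cases "1 \<le> k \<and> k \<le> n")
    case True
    then have "k - p k \<le> c \<and> c < k \<longleftrightarrow> k - q k \<le> c \<and> c < k" for c
      using staircase_cells_iff[of n p k c] staircase_cells_iff[of n q k c] p e by simp
    then have "{k - p k..<k} = {k - q k..<k}" unfolding set_eq_iff atLeastLessThan_iff by blast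
    then have "card {k - p k..<k} = card {k - q k..<k}" by simp
    then show ?thesis using inner_partition_le[of n p k] inner_partition_le[of n q k] p by simp
  next
    case False
    then show ?thesis using p by (cases k) (auto simp: inner_partition_def block_vector_def)
  qed
qed

lemma staircase_cells_mono:
  assumes "horizontal_strip q p"
  shows "staircase_cells n q \<subseteq> staircase_cells n p"
proof
  fix x assume "x \<in> staircase_cells n q"
  moreover have "q (n - fst x) \<le> p (n - fst x)" using horizontal_strip_le[OF assms] .
  ultimately show "x \<in> staircase_cells n p" by (auto simp: staircase_cells_def)
qed

text \<open>The strip condition puts the cell of the next row into the smaller diagram, and the
  partition condition on \<open>q\<close> carries this further down the column.\<close>

lemma staircase_cells_below:
  assumes hs: "horizontal_strip q p" and x: "(r, c) \<in> staircase_cells n p"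
    and r: "r < r'" and x': "(r', c) \<in> staircase_cells n p"
  shows "(r', c) \<in> staircase_cells n q"
proof -
  have *: "p (Suc k) \<le> Suc (q k)" "q (Suc k) \<le> Suc (q k)" for k
    using hs unfolding horizontal_strip_def by (auto intro: le_trans)
  have "n - r \<le> Suc i + c + q (n - r - Suc i)" if "Suc i \<le> n - r" for i
    using that
  proof (induction i)
    case 0
    then have "n - r = Suc (n - r - 1)" by simp
    then have "p (n - r) \<le> Suc (q (n - r - 1))" using *(1)[of "n - r - 1"] by metis
    then show ?case using x by (auto simp: staircase_cells_def)
  next
    case (Suc i)
    then have "n - r - Suc i = Suc (n - r - Suc (Suc i))" by simp
    then show ?case using Suc *(2)[of "n - r - Suc (Suc i)"] by simp
  qed
  moreover have "Suc (r' - r - 1) \<le> n - r" using x' r by (auto simp: staircase_cells_def)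
  ultimately have "n - r \<le> Suc (r' - r - 1) + c + q (n - r - Suc (r' - r - 1))" by blast
  then have "n - r \<le> (r' - r) + c + q (n - r')"
    using x' r by (simp add: staircase_cells_def Suc_diff_Suc)
  then show ?thesis
    using x' r by (auto simp: staircase_cells_def)
qed

lemma upper_segment:
  fixes A :: "nat set"
  assumes "A \<subseteq> {a..<b}" "\<And>x y. x \<in> A \<Longrightarrow> x \<le> y \<Longrightarrow> y < b \<Longrightarrow> y \<in> A"
  shows "x \<in> A \<longleftrightarrow> b - card A \<le> x \<and> x < b"
proof (cases "A = {}")
  case False
  have f: "finite A" using assms(1) finite_subset by blast
  have m: "Min A \<in> A" using f False by simp
  have "A = {Min A..<b}"
    using assms(1) Min_le[OF f] assms(2)[OF m] by (intro equalityI subsetI) auto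
  moreover have "Min A < b" using m assms(1) by auto
  ultimately have "card A = b - Min A" by (metis card_atLeastLessThan)
  then show ?thesis using \<open>A = {Min A..<b}\<close> \<open>Min A < b\<close> by (metis atLeastLessThan_iff diff_diff_cancel less_imp_le)
qed simp

lemma lower_segment:
  fixes A :: "nat set"
  assumes "A \<subseteq> {a..<b}" "\<And>x y. x \<in> A \<Longrightarrow> a \<le> y \<Longrightarrow> y \<le> x \<Longrightarrow> y \<in> A"
  shows "x \<in> A \<longleftrightarrow> a \<le> x \<and> x < a + card A"
proof (cases "A = {}")
  case False
  have f: "finite A" using assms(1) finite_subset by blast
  have m: "Max A \<in> A" using f False by simp
  have "A = {a..<Suc (Max A)}"
    using assms(1) Max_ge[OF f] assms(2)[OF m] by (intro equalityI subsetI) (auto simp: less_Suc_eq_le)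
  moreover have "a \<le> Max A" using m assms(1) by auto
  ultimately have "a + card A = Suc (Max A)" by (metis card_atLeastLessThan le_SucI le_add_diff_inverse)
  then show ?thesis using \<open>A = {a..<Suc (Max A)}\<close> by (metis atLeastLessThan_iff)
qed simp

lemma semistandard_subset: "semistandard S T \<Longrightarrow> S' \<subseteq> S \<Longrightarrow> semistandard S' T"
  unfolding semistandard_def by blast

lemma semistandard_cong:
  assumes "\<And>x. x \<in> S \<Longrightarrow> T x = T' x"
  shows "semistandard S T = semistandard S T'"
  unfolding semistandard_def using assms by (simp cong: conj_cong imp_cong)

text \<open>The letter \<open>a\<close> fills a left segment of each row. Below any cell a column
  has only entries greater than \<open>a\<close>, which yields the inequality between consecutive
  rows.\<close>

lemma smallest_letter_level:
  assumes p: "inner_partition n p" and ss: "semistandard (staircase_cells n p) T"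
    and T: "\<And>x. x \<in> staircase_cells n p \<Longrightarrow> a \<le> T x"
  obtains q where "horizontal_strip q p" "staircase_cells n q = {x \<in> staircase_cells n p. T x \<noteq> a}"
proof -
  let ?S = "staircase_cells n p"
  define A where "A k = {c. k \<le> n \<and> (n - k, c) \<in> ?S \<and> T (n - k, c) \<noteq> a}" for k
  define q where "q k = card (A k)" for k
  have A: "A k \<subseteq> {k - p k..<k}" for k by (auto simp: A_def staircase_cells_def)
  have up: "y \<in> A k" if "x \<in> A k" "x \<le> y" "y < k" for x y k
  proof -
    have S: "(n - k, x) \<in> ?S" "(n - k, y) \<in> ?S" "k \<le> n"
      using that by (auto simp: A_def staircase_cells_def)
    then have "T (n - k, x) \<le> T (n - k, y)"
      using ss that(2) unfolding semistandard_def by (cases "x = y") auto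
    moreover have "a < T (n - k, x)" using that(1) T[OF S(1)] by (auto simp: A_def)
    ultimately show ?thesis using S by (simp add: A_def)
  qed
  have iff: "c \<in> A k \<longleftrightarrow> k - q k \<le> c \<and> c < k" for c k
    unfolding q_def by (rule upper_segment[OF A up])
  have le: "q k \<le> p k" for k
    using card_mono[OF _ A[of k]] inner_partition_le[OF p, of k] by (simp add: q_def)
  have "p (Suc k) \<le> Suc (q k)" for k
  proof (cases "Suc k \<le> n")
    case True
    have "{Suc k - p (Suc k)..<k} \<subseteq> A k"
    proof
      fix c assume c: "c \<in> {Suc k - p (Suc k)..<k}"
      have pk: "p (Suc k) \<le> Suc (p k)" using p by (simp add: inner_partition_def)
      have S: "(n - Suc k, c) \<in> ?S" "(n - k, c) \<in> ?S"
        using True c pk by (auto simp: staircase_cells_def)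
      have "n - Suc k < n - k" using True by simp
      then have "T (n - Suc k, c) < T (n - k, c)" using ss S unfolding semistandard_def by blast
      then have "T (n - k, c) \<noteq> a" using T[OF S(1)] by simp
      then show "c \<in> A k" using S True by (simp add: A_def)
    qed
    from card_mono[OF _ this] have "k - (Suc k - p (Suc k)) \<le> q k"
      using A[of k] by (simp add: q_def finite_subset)
    then show ?thesis using inner_partition_le[OF p, of "Suc k"] by simp
  next
    case False
    then show ?thesis using p by (simp add: inner_partition_def block_vector_def)
  qed
  then have "horizontal_strip q p" using le by (simp add: horizontal_strip_def)
  moreover have "staircase_cells n q = {x \<in> ?S. T x \<noteq> a}"
  proof (intro equalityI subsetI)
    fix x assume x: "x \<in> staircase_cells n q"
    obtain r c where rc: "x = (r, c)" by (cases x)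
    have "c \<in> A (n - r)" using x iff[of c "n - r"] by (auto simp: rc staircase_cells_def)
    then show "x \<in> {x \<in> ?S. T x \<noteq> a}" using x by (auto simp: A_def rc staircase_cells_def)
  next
    fix x assume x: "x \<in> {x \<in> ?S. T x \<noteq> a}"
    obtain r c where rc: "x = (r, c)" by (cases x)
    have r: "r < n" using x by (auto simp: rc staircase_cells_def)
    then have "c \<in> A (n - r)" using x by (auto simp: A_def rc)
    then show "x \<in> staircase_cells n q" using r iff[of c "n - r"] by (auto simp: rc staircase_cells_def)
  qed
  ultimately show ?thesis using that by blast
qed

text \<open>Induction on the number \<open>len\<close> of available letters: the cells with the
  smallest letter \<open>Suc j\<close> are a horizontal strip and are taken away.\<close>

lemma card_skew_fillings:
  assumes "inner_partition n p" "set_mset m \<subseteq> {j<..j + len}"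
  shows "card (skew_fillings n p j m) = strip_count n (map (count m) [Suc j..<Suc (j + len)]) p"
  using assms
proof (induction len arbitrary: j p m)
  case 0
  then have m: "m = {#}" by auto
  have z: "staircase_cells n p = {} \<longleftrightarrow> p = (\<lambda>_. 0)"
  proof
    assume "staircase_cells n p = {}"
    moreover have "staircase_cells n (\<lambda>_. 0) = {}" by (auto simp: staircase_cells_def)
    moreover have "inner_partition n (\<lambda>_. 0)" by (simp add: inner_partition_def block_vector_def)
    ultimately show "p = (\<lambda>_. 0)" using inj_onD[OF inj_staircase_cells, of n p "\<lambda>_. 0"] 0(1) by simp
  qed (auto simp: staircase_cells_def)
  have "skew_fillings n p j m = (if p = (\<lambda>_. 0) then {\<lambda>_. undefined} else {})"
    using z finite_staircase_cells[of n p]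
    by (auto simp: skew_fillings_def m mset_set_empty_iff semistandard_def)
  then show ?case by simp
next
  case (Suc len)
  let ?S = "staircase_cells n p" and ?a = "Suc j"
  let ?I = "{q. horizontal_strip q p \<and> total n p = total n q + count m ?a}"
  let ?m = "filter_mset (\<lambda>x. x \<noteq> ?a) m"
  have bv: "block_vector n p" using Suc.prems(1) by (simp add: inner_partition_def)
  have "card (skew_fillings n p j m) = (\<Sum>q\<in>?I. card (skew_fillings n q ?a ?m))"
  proof (rule card_split_filling[where D = "staircase_cells n" and S = ?S and a = ?a])
    show "finite ?I" by (rule finite_horizontal_strips[OF bv])
    show "finite (skew_fillings n q ?a ?m)" for q
      unfolding skew_fillings_def by (rule finite_fillings_content[OF finite_staircase_cells])
    show "inj_on (staircase_cells n) ?I"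
      by (rule inj_on_subset[OF inj_staircase_cells]) (use inner_partition_strip Suc.prems(1) in blast)
    show "staircase_cells n q \<subseteq> ?S" if "q \<in> ?I" for q using staircase_cells_mono that by blast
    show "T \<in> extensional (staircase_cells n q) \<and> (\<forall>x\<in>staircase_cells n q. T x \<noteq> ?a)"
      if "T \<in> skew_fillings n q ?a ?m" for q T
      using that by (auto simp: skew_fillings_def PiE_iff)
  next
    fix T assume T: "T \<in> skew_fillings n p j m"
    then have T': "T \<in> extensional ?S" "\<And>x. x \<in> ?S \<Longrightarrow> ?a \<le> T x"
      "image_mset T (mset_set ?S) = m" "semistandard ?S T"
      by (auto simp: skew_fillings_def PiE_iff Suc_le_eq)
    obtain q where q: "horizontal_strip q p" "staircase_cells n q = {x \<in> ?S. T x \<noteq> ?a}"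
      using smallest_letter_level[OF Suc.prems(1) T'(4,2)] by blast
    let ?D = "staircase_cells n q"
    have D: "?D \<subseteq> ?S" using q by blast
    have "m = image_mset T (mset_set ?D) + replicate_mset (card ?S - card ?D) ?a"
      unfolding T'(3)[symmetric]
      by (rule content_split[OF finite_staircase_cells D]) (use q(2) in auto)
    moreover have "card ?S = total n p" "card ?D = total n q"
      using card_staircase_cells Suc.prems(1) inner_partition_strip[OF q(1)] by blast+
    moreover have "card ?D \<le> card ?S" using card_mono[OF finite_staircase_cells D] .
    ultimately have me: "m = image_mset T (mset_set ?D) + replicate_mset (total n p - total n q) ?a"
      and le: "total n q \<le> total n p" by simp_all
    have na: "?a \<notin># image_mset T (mset_set ?D)"
      using q(2) finite_staircase_cells[of n q] by auto
    have "count m ?a = total n p - total n q"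
      using arg_cong[OF me, of "\<lambda>m. count m ?a"] na[unfolded not_in_iff] by simp
    then have I: "q \<in> ?I" using q(1) le by simp
    have "?m = image_mset T (mset_set ?D)"
      using filter_mset_remove_letter[OF na] me by metis
    also have "\<dots> = image_mset (restrict T ?D) (mset_set ?D)"
      using finite_staircase_cells[of n q] by (intro image_mset_cong) auto
    finally have c: "image_mset (restrict T ?D) (mset_set ?D) = ?m" by simp
    have "?a < T x" if "x \<in> ?D" for x using T'(2)[of x] q(2) that by auto
    then have "restrict T ?D \<in> ?D \<rightarrow>\<^sub>E {?a<..}" by auto
    moreover have "semistandard ?D (restrict T ?D)"
      using semistandard_subset[OF T'(4) D] semistandard_cong[of ?D T "restrict T ?D"] by simp
    ultimately have "restrict T ?D \<in> skew_fillings n q ?a ?m"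
      using c by (simp add: skew_fillings_def)
    then show "T \<in> extensional ?S \<and>
        (\<exists>q\<in>?I. staircase_cells n q = {x \<in> ?S. T x \<noteq> ?a} \<and>
          restrict T (staircase_cells n q) \<in> skew_fillings n q ?a ?m)"
      using T'(1) I q(2) by blast
  next
    fix q T assume q: "q \<in> ?I" and T: "T \<in> skew_fillings n q ?a ?m"
    let ?D = "staircase_cells n q"
    let ?T = "\<lambda>x. if x \<in> ?D then T x else if x \<in> ?S then ?a else undefined"
    have hs: "horizontal_strip q p" "total n p = total n q + count m ?a" using q by auto
    have D: "?D \<subseteq> ?S" using staircase_cells_mono[OF hs(1)] .
    have T': "\<And>x. x \<in> ?D \<Longrightarrow> ?a < T x" "image_mset T (mset_set ?D) = ?m" "semistandard ?D T"
      using T by (auto simp: skew_fillings_def PiE_iff)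
    have "image_mset ?T (mset_set ?S) = image_mset ?T (mset_set ?D) + replicate_mset (card ?S - card ?D) ?a"
      by (rule content_split[OF finite_staircase_cells D]) auto
    also have "image_mset ?T (mset_set ?D) = image_mset T (mset_set ?D)"
      using finite_staircase_cells[of n q] by (intro image_mset_cong) auto
    also have "card ?S - card ?D = count m ?a"
      using card_staircase_cells[OF Suc.prems(1)] card_staircase_cells[OF inner_partition_strip[OF hs(1) Suc.prems(1)]]
        hs(2) by simp
    also have "image_mset T (mset_set ?D) + replicate_mset (count m ?a) ?a = m"
      unfolding T'(2) by (rule filter_mset_add_letter)
    finally have content: "image_mset ?T (mset_set ?S) = m" .
    have "semistandard ?S ?T"
      unfolding semistandard_def
    proof (intro conjI allI impI)
      fix r c c' assume h: "(r, c) \<in> ?S \<and> (r, c') \<in> ?S \<and> c < c'"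
      have "(r, c') \<in> ?D" if "(r, c) \<in> ?D" using that h by (auto simp: staircase_cells_def)
      then show "?T (r, c) \<le> ?T (r, c')"
        using h T'(1) T'(3) unfolding semistandard_def by (auto simp: less_imp_le)
    next
      fix r r' c assume h: "(r, c) \<in> ?S \<and> (r', c) \<in> ?S \<and> r < r'"
      then have "(r', c) \<in> ?D" using staircase_cells_below[OF hs(1)] by blast
      then show "?T (r, c) < ?T (r', c)"
        using h T'(1) T'(3) unfolding semistandard_def by auto
    qed
    moreover have "?T \<in> ?S \<rightarrow>\<^sub>E {j<..}"
      using T'(1) D by (fastforce simp: PiE_iff extensional_def)
    ultimately show "?T \<in> skew_fillings n p j m" using content by (simp add: skew_fillings_def)
  qed
  also have "\<dots> = (\<Sum>q\<in>?I. strip_count n (map (count ?m) [Suc ?a..<Suc (?a + len)]) q)"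
  proof (rule sum.cong[OF refl])
    fix q assume "q \<in> ?I"
    then have "inner_partition n q" using inner_partition_strip Suc.prems(1) by blast
    moreover have "set_mset ?m \<subseteq> {?a<..?a + len}"
    proof
      fix x assume "x \<in># ?m"
      then have "x \<in> {j<..j + Suc len}" "x \<noteq> ?a" using Suc.prems(2) by auto
      then show "x \<in> {?a<..?a + len}" by auto
    qed
    ultimately show "card (skew_fillings n q ?a ?m) = strip_count n (map (count ?m) [Suc ?a..<Suc (?a + len)]) q"
      by (rule Suc.IH)
  qed
  also have "map (count ?m) [Suc ?a..<Suc (?a + len)] = map (count m) [Suc ?a..<Suc (?a + len)]"
    by (rule map_cong) auto
  also have "(\<Sum>q\<in>?I. strip_count n (map (count m) [Suc ?a..<Suc (?a + len)]) q) =
      strip_count n (map (count m) (?a # [Suc ?a..<Suc (?a + len)])) p"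
    unfolding list.map strip_count.simps ..
  also have "?a # [Suc ?a..<Suc (?a + len)] = [Suc j..<Suc (j + Suc len)]"
    using upt_conv_Cons[of "Suc j" "Suc (j + Suc len)"] by (simp del: upt_Suc)
  finally show ?case .
qed

section \<open>Shifted fillings\<close>

text \<open>Order becomes \<open>\<le>\<close> of numbers, and \<open>letter_code a < N\<close> cuts
  the alphabet after any letter, primed or not.\<close>

fun letter_code :: "letter \<Rightarrow> nat" where
  "letter_code (Primed k) = 2 * k"
| "letter_code (Unprimed k) = Suc (2 * k)"

lemma letter_le_code: "letter_le a b \<longleftrightarrow> letter_code a \<le> letter_code b"
  by (cases a; cases b) auto

lemma letter_code_inj: "letter_code a = letter_code b \<Longrightarrow> a = b"
  by (cases a; cases b) (auto, presburger+)

lemma letter_code_index: "letter_index a = letter_code a div 2"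
  by (cases a) auto

definition shape_cells :: "(nat \<Rightarrow> nat) \<Rightarrow> cell set" where
  "shape_cells w = {(r, c). r \<le> c \<and> c < r + w r}"

definition marked_semistandard :: "cell set \<Rightarrow> (cell \<Rightarrow> letter) \<Rightarrow> bool" where
  "marked_semistandard S T \<longleftrightarrow>
     (\<forall>r c c'. (r, c) \<in> S \<and> (r, c') \<in> S \<and> c < c' \<longrightarrow> letter_le (T (r, c)) (T (r, c'))) \<and>
     (\<forall>r r' c. (r, c) \<in> S \<and> (r', c) \<in> S \<and> r < r' \<longrightarrow> letter_le (T (r, c)) (T (r', c))) \<and>
     (\<forall>r r' c k. (r, c) \<in> S \<and> (r', c) \<in> S \<and> T (r, c) = Unprimed k \<and> T (r', c) = Unprimed k
        \<longrightarrow> r = r') \<and>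
     (\<forall>r c c' k. (r, c) \<in> S \<and> (r, c') \<in> S \<and> T (r, c) = Primed k \<and> T (r, c') = Primed k
        \<longrightarrow> c = c') \<and>
     (\<forall>r k. (r, r) \<in> S \<longrightarrow> T (r, r) \<noteq> Primed k)"

text \<open>The content is constrained by a predicate because \<open>Unprimed K\<close> and
  \<open>Primed K\<close> are removed one after the other; the predicate collects the copies of
  \<open>K\<close> already taken away.\<close>

definition shifted_fillings ::
    "(nat \<Rightarrow> nat) \<Rightarrow> nat \<Rightarrow> (monomial \<Rightarrow> bool) \<Rightarrow> (cell \<Rightarrow> letter) set" where
  "shifted_fillings w N P = {T \<in> shape_cells w \<rightarrow>\<^sub>E {a. 1 \<le> letter_index a \<and> letter_code a < N}.
     P (image_mset (\<lambda>x. letter_index (T x)) (mset_set (shape_cells w))) \<and>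
     marked_semistandard (shape_cells w) T}"

definition primed_strip :: "(nat \<Rightarrow> nat) \<Rightarrow> (nat \<Rightarrow> nat) \<Rightarrow> bool" where
  "primed_strip v z \<longleftrightarrow> vstrip v z \<and> (\<forall>s. v s = 0 \<longrightarrow> z s = 0)"

definition unprimed_strip :: "(nat \<Rightarrow> nat) \<Rightarrow> (nat \<Rightarrow> nat) \<Rightarrow> bool" where
  "unprimed_strip z w \<longleftrightarrow> (\<forall>s. z s \<le> w s \<and> (w (Suc s) < z s \<or> w (Suc s) = 0))"

definition letter_strip :: "letter \<Rightarrow> (nat \<Rightarrow> nat) \<Rightarrow> (nat \<Rightarrow> nat) \<Rightarrow> bool" where
  "letter_strip a z w \<longleftrightarrow> strict_shape z \<and>
     (case a of Primed _ \<Rightarrow> primed_strip z w | Unprimed _ \<Rightarrow> unprimed_strip z w)"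

lemma marked_strip_split: "marked_strip v z w \<longleftrightarrow> primed_strip v z \<and> unprimed_strip z w"
  by (auto simp: marked_strip_def primed_strip_def unprimed_strip_def)

lemma unprimed_strip_strict: "unprimed_strip z w \<Longrightarrow> strict_shape z"
  unfolding unprimed_strip_def strict_shape_def by (metis le_less_trans le_zero_eq)

lemma letter_strip_le:
  assumes "letter_strip a z w"
  shows "z s \<le> w s"
  using assms vstripD[of z w s]
  by (cases a) (auto simp: letter_strip_def primed_strip_def unprimed_strip_def)

lemma shape_cells_Sigma:
  assumes "\<And>u. n < u \<Longrightarrow> w u = 0"
  shows "shape_cells w = (SIGMA r:{..n}. {r..<r + w r})"
  using assms by (fastforce simp: shape_cells_def not_le[symmetric])

lemma finite_shape_cells: "(\<And>u. n < u \<Longrightarrow> w u = 0) \<Longrightarrow> finite (shape_cells w)"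
  using shape_cells_Sigma[of n w] by simp

lemma card_shape_cells: "(\<And>u. n < u \<Longrightarrow> w u = 0) \<Longrightarrow> card (shape_cells w) = total n w"
  using shape_cells_Sigma[of n w] by (simp add: card_SigmaI total_def)

lemma inj_shape_cells: "inj_on shape_cells A"
proof (rule inj_onI, rule ext)
  fix z z' r assume e: "shape_cells z = shape_cells z'"
  have "{r..<r + v r} = {c. (r, c) \<in> shape_cells v}" for v by (auto simp: shape_cells_def)
  then have "card {r..<r + z r} = card {r..<r + z' r}" using e by simp
  then show "z r = z' r" by simp
qed

lemma shape_cells_mono: "(\<And>s. z s \<le> w s) \<Longrightarrow> shape_cells z \<subseteq> shape_cells w"
  by (auto simp: shape_cells_def intro: less_le_trans add_left_mono)

lemma shape_cells_up:
  assumes "strict_shape w" "(r', c) \<in> shape_cells w" "r \<le> r'"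
  shows "(r, c) \<in> shape_cells w"
  using assms(2) strict_shape_le[OF assms(1,3)] assms(3) by (auto simp: shape_cells_def)

lemma finite_shifted_fillings:
  assumes "finite (shape_cells w)"
  shows "finite (shifted_fillings w N P)"
proof (rule finite_subset)
  have "{a. letter_code a < N} \<subseteq> Primed ` {..N} \<union> Unprimed ` {..N}"
  proof
    fix a assume "a \<in> {a. letter_code a < N}"
    then show "a \<in> Primed ` {..N} \<union> Unprimed ` {..N}" by (cases a) auto
  qed
  then show "finite (shape_cells w \<rightarrow>\<^sub>E {a. letter_code a < N})"
    using assms by (intro finite_PiE) (auto intro: finite_subset)
  show "shifted_fillings w N P \<subseteq> shape_cells w \<rightarrow>\<^sub>E {a. letter_code a < N}"
    by (auto simp: shifted_fillings_def PiE_iff intro: extensional_arb)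
qed

lemma marked_semistandard_subset:
  "marked_semistandard S T \<Longrightarrow> S' \<subseteq> S \<Longrightarrow> marked_semistandard S' T"
  unfolding marked_semistandard_def subset_iff by (smt (verit))

lemma marked_semistandard_cong:
  assumes "\<And>x. x \<in> S \<Longrightarrow> T x = T' x"
  shows "marked_semistandard S T = marked_semistandard S T'"
  unfolding marked_semistandard_def using assms by (simp cong: conj_cong imp_cong)

text \<open>Weak monotonicity makes the smaller letters a strict shape. The strip conditions come
  from the rules of one unprimed copy per column, one primed copy per row, and no prime on the
  diagonal.\<close>

lemma largest_letter_level:
  assumes w: "strict_shape w" and ms: "marked_semistandard (shape_cells w) T"
    and T: "\<And>x. x \<in> shape_cells w \<Longrightarrow> letter_code (T x) \<le> letter_code a"
  obtains z where "letter_strip a z w" "shape_cells z = {x \<in> shape_cells w. T x \<noteq> a}"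
proof -
  let ?S = "shape_cells w"
  define A where "A r = {c. (r, c) \<in> ?S \<and> T (r, c) \<noteq> a}" for r
  define z where "z r = card (A r)" for r
  have row: "letter_code (T (r, c)) \<le> letter_code (T (r, c'))"
    if "(r, c) \<in> ?S" "(r, c') \<in> ?S" "c \<le> c'" for r c c'
    using ms that unfolding marked_semistandard_def letter_le_code by (cases "c = c'") auto
  have col: "letter_code (T (r, c)) \<le> letter_code (T (r', c))"
    if "(r, c) \<in> ?S" "(r', c) \<in> ?S" "r \<le> r'" for r r' c
    using ms that unfolding marked_semistandard_def letter_le_code by (cases "r = r'") auto
  have lt: "letter_code (T x) < letter_code a \<longleftrightarrow> T x \<noteq> a" if "x \<in> ?S" for x
    using T[OF that] letter_code_inj[of "T x" a] by (metis le_neq_implies_less less_irrefl)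
  have A: "A r \<subseteq> {r..<r + w r}" for r by (auto simp: A_def shape_cells_def)
  have down: "y \<in> A r" if "x \<in> A r" "r \<le> y" "y \<le> x" for x y r
  proof -
    have S: "(r, x) \<in> ?S" "(r, y) \<in> ?S" using that by (auto simp: A_def shape_cells_def)
    have "letter_code (T (r, y)) < letter_code a"
      using row[OF S(2,1) that(3)] lt[OF S(1)] that(1) by (auto simp: A_def)
    then show ?thesis using S lt by (auto simp: A_def)
  qed
  have iff: "c \<in> A r \<longleftrightarrow> r \<le> c \<and> c < r + z r" for c r
    unfolding z_def by (rule lower_segment[OF A down])
  have zw: "z r \<le> w r" for r
    using card_mono[OF _ A[of r]] by (simp add: z_def)
  have cells: "shape_cells z = {x \<in> ?S. T x \<noteq> a}"
  proof (rule set_eqI)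
    fix x :: cell
    obtain r c where rc: "x = (r, c)" by (cases x)
    show "x \<in> shape_cells z \<longleftrightarrow> x \<in> {x \<in> ?S. T x \<noteq> a}"
      using iff[of c r] by (auto simp: rc shape_cells_def A_def)
  qed
  have up: "w (Suc s) < w s" if "0 < w (Suc s)" for s
    using w that unfolding strict_shape_def by (metis less_irrefl)
  have "strict_shape z"
    unfolding strict_shape_def
  proof
    fix s
    show "z (Suc s) < z s \<or> z (Suc s) = 0"
    proof (cases "z (Suc s) = 0")
      case False
      have ws: "w (Suc s) < w s" using up[of s] zw[of "Suc s"] False by simp
      let ?c = "s + z (Suc s)"
      have "(Suc s, ?c) \<in> shape_cells z" using False by (simp add: shape_cells_def)
      then have S: "(Suc s, ?c) \<in> ?S" "T (Suc s, ?c) \<noteq> a" unfolding cells by auto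
      have S': "(s, ?c) \<in> ?S" using zw[of "Suc s"] ws by (simp add: shape_cells_def)
      have "T (s, ?c) \<noteq> a" using col[OF S' S(1)] lt[OF S(1)] lt[OF S'] S(2) by simp
      then have "(s, ?c) \<in> shape_cells z" unfolding cells using S' by simp
      then show ?thesis by (simp add: shape_cells_def)
    qed simp
  qed
  moreover have "unprimed_strip z w" if a: "a = Unprimed k" for k
    unfolding unprimed_strip_def
  proof (intro allI conjI)
    fix s
    show "w (Suc s) < z s \<or> w (Suc s) = 0"
    proof (cases "w (Suc s) = 0")
      case False
      let ?c = "s + w (Suc s)"
      have S: "(Suc s, ?c) \<in> ?S" "(s, ?c) \<in> ?S" using False up[of s] by (auto simp: shape_cells_def)
      have "T (s, ?c) \<noteq> a"
      proof
        assume e: "T (s, ?c) = a"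
        then have "T (Suc s, ?c) = a" using col[OF S(2,1)] lt[OF S(1)] by auto
        then have "s = Suc s" using e S ms unfolding a marked_semistandard_def by blast
        then show False by simp
      qed
      then have "(s, ?c) \<in> shape_cells z" unfolding cells using S by simp
      then show ?thesis by (simp add: shape_cells_def)
    qed simp
  qed (rule zw)
  moreover have "primed_strip z w" if a: "a = Primed k" for k
  proof -
    have out: "T (s, c) = a" if "s + z s \<le> c" "c < s + w s" for s c
    proof -
      have "(s, c) \<in> ?S" "(s, c) \<notin> shape_cells z" using that by (auto simp: shape_cells_def)
      then show ?thesis unfolding cells by simp
    qed
    have "w s \<le> Suc (z s)" for s
    proof (rule ccontr)
      assume h: "\<not> w s \<le> Suc (z s)"
      have "T (s, s + z s) = Primed k" "T (s, Suc (s + z s)) = Primed k"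
        using out[of s "s + z s"] out[of s "Suc (s + z s)"] h a by auto
      moreover have "(s, s + z s) \<in> ?S" "(s, Suc (s + z s)) \<in> ?S" using h by (auto simp: shape_cells_def)
      ultimately have "s + z s = Suc (s + z s)" using ms unfolding marked_semistandard_def by blast
      then show False by simp
    qed
    then have "vstrip z w" unfolding vstrip_def using zw by (metis le_SucE le_antisym)
    moreover have "w s = 0" if "z s = 0" for s
    proof (rule ccontr)
      assume "w s \<noteq> 0"
      then have "(s, s) \<in> ?S" "T (s, s) = Primed k" using out[of s s] that a by (auto simp: shape_cells_def)
      then show False using ms unfolding marked_semistandard_def by blast
    qed
    ultimately show ?thesis by (simp add: primed_strip_def)
  qed
  ultimately have "letter_strip a z w" by (cases a) (auto simp: letter_strip_def)
  then show ?thesis using that cells by blast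
qed

text \<open>Order is preserved because \<open>a\<close> exceeds everything inside and
  \<open>shape_cells z\<close> is closed to the left and upwards; conflicts of equal letters arise
  only among the new cells and are excluded by the strip condition.\<close>

lemma add_largest_letter:
  assumes w: "strict_shape w" and st: "letter_strip a z w"
    and ms: "marked_semistandard (shape_cells z) T"
    and T: "\<And>x. x \<in> shape_cells z \<Longrightarrow> letter_code (T x) < letter_code a"
  shows "marked_semistandard (shape_cells w)
    (\<lambda>x. if x \<in> shape_cells z then T x else if x \<in> shape_cells w then a else undefined)"
    (is "marked_semistandard ?S ?T")
proof -
  let ?D = "shape_cells z"
  have z: "strict_shape z" using st by (simp add: letter_strip_def)
  have DS: "?D \<subseteq> ?S" using shape_cells_mono letter_strip_le[OF st] by blast
  have le: "letter_code (?T x) \<le> letter_code a" if "x \<in> ?S" for x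
    using T[of x] that by auto
  have D: "x \<in> ?D \<Longrightarrow> ?T x = T x" for x by simp
  have nD: "x \<in> ?S \<Longrightarrow> x \<notin> ?D \<Longrightarrow> ?T x = a" for x by simp
  have Dna: "?T x \<noteq> a" if "x \<in> ?D" for x using T[OF that] that by auto
  have ms': "marked_semistandard ?D ?T" using ms marked_semistandard_cong[of ?D T ?T] by simp
  show ?thesis
    unfolding marked_semistandard_def
  proof (intro conjI allI impI)
    fix r c c' assume h: "(r, c) \<in> ?S \<and> (r, c') \<in> ?S \<and> c < c'"
    show "letter_le (?T (r, c)) (?T (r, c'))"
    proof (cases "(r, c') \<in> ?D")
      case True
      then have "(r, c) \<in> ?D" using h by (auto simp: shape_cells_def)
      then show ?thesis using ms' True h unfolding marked_semistandard_def by blast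
    next
      case False
      then show ?thesis using nD[of "(r, c')"] le[of "(r, c)"] h unfolding letter_le_code by simp
    qed
  next
    fix r r' c assume h: "(r, c) \<in> ?S \<and> (r', c) \<in> ?S \<and> r < r'"
    show "letter_le (?T (r, c)) (?T (r', c))"
    proof (cases "(r', c) \<in> ?D")
      case True
      then have "(r, c) \<in> ?D" using h shape_cells_up[OF z] by (meson less_imp_le)
      then show ?thesis using ms' True h unfolding marked_semistandard_def by blast
    next
      case False
      then show ?thesis using nD[of "(r', c)"] le[of "(r, c)"] h unfolding letter_le_code by simp
    qed
  next
    fix r r' c k
    assume h: "(r, c) \<in> ?S \<and> (r', c) \<in> ?S \<and> ?T (r, c) = Unprimed k \<and> ?T (r', c) = Unprimed k"
    show "r = r'"
    proof (cases "(r, c) \<in> ?D \<or> (r', c) \<in> ?D")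
      case True
      then have "(r, c) \<in> ?D \<and> (r', c) \<in> ?D"
        using h Dna[of "(r, c)"] Dna[of "(r', c)"] nD[of "(r, c)"] nD[of "(r', c)"] by metis
      then show ?thesis using ms' h unfolding marked_semistandard_def by blast
    next
      case False
      have a: "a = Unprimed k" using False h by auto
      then have u: "w (Suc s) < z s \<or> w (Suc s) = 0" for s
        using st by (simp add: letter_strip_def unprimed_strip_def)
      have no: False if "(i, c) \<in> ?S" "(i, c) \<notin> ?D" "(i', c) \<in> ?S" "i < i'" for i i'
      proof -
        have "(Suc i, c) \<in> ?S" using shape_cells_up[OF w that(3), of "Suc i"] that(4) by simp
        then show False using u[of i] that(1,2) by (auto simp: shape_cells_def)
      qed
      show ?thesis using no[of r r'] no[of r' r] False h by (cases r r' rule: linorder_cases) auto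
    qed
  next
    fix r c c' k
    assume h: "(r, c) \<in> ?S \<and> (r, c') \<in> ?S \<and> ?T (r, c) = Primed k \<and> ?T (r, c') = Primed k"
    show "c = c'"
    proof (cases "(r, c) \<in> ?D \<or> (r, c') \<in> ?D")
      case True
      then have "(r, c) \<in> ?D \<and> (r, c') \<in> ?D"
        using h Dna[of "(r, c)"] Dna[of "(r, c')"] nD[of "(r, c)"] nD[of "(r, c')"] by metis
      then show ?thesis using ms' h unfolding marked_semistandard_def by blast
    next
      case False
      have a: "a = Primed k" using False h by auto
      then have "vstrip z w" using st by (simp add: letter_strip_def primed_strip_def)
      from vstripD[OF this, of r] show ?thesis using False h by (auto simp: shape_cells_def)
    qed
  next
    fix r k assume h: "(r, r) \<in> ?S"
    show "?T (r, r) \<noteq> Primed k"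
    proof (cases "(r, r) \<in> ?D")
      case True
      then show ?thesis using ms' unfolding marked_semistandard_def by blast
    next
      case False
      show ?thesis
      proof
        assume "?T (r, r) = Primed k"
        then have "a = Primed k" using False h by simp
        then have "z r = 0 \<longrightarrow> w r = 0" using st by (simp add: letter_strip_def primed_strip_def)
        then show False using False h by (auto simp: shape_cells_def)
      qed
    qed
  qed
qed

lemma card_shifted_fillings_Suc:
  assumes w: "strict_shape w" "\<And>u. n < u \<Longrightarrow> w u = 0" and a: "letter_code a = N" "1 \<le> letter_index a"
  shows "card (shifted_fillings w (Suc N) P) =
    (\<Sum>z\<in>{z. letter_strip a z w}. card (shifted_fillings z N
      (\<lambda>M. P (M + replicate_mset (total n w - total n z) (letter_index a)))))"
proof -
  let ?S = "shape_cells w" and ?I = "{z. letter_strip a z w}"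
  let ?F = "\<lambda>z. shifted_fillings z N (\<lambda>M. P (M + replicate_mset (total n w - total n z) (letter_index a)))"
  have supp: "z u = 0" if "letter_strip a z w" "n < u" for z u
    using letter_strip_le[OF that(1), of u] w(2)[OF that(2)] by simp
  have content: "image_mset (\<lambda>x. letter_index (T x)) (mset_set ?S) =
      image_mset (\<lambda>x. letter_index (T x)) (mset_set (shape_cells z)) +
      replicate_mset (total n w - total n z) (letter_index a)"
    if "letter_strip a z w" "\<And>x. x \<in> ?S - shape_cells z \<Longrightarrow> T x = a" for z T
  proof -
    have sub: "shape_cells z \<subseteq> ?S" using shape_cells_mono letter_strip_le[OF that(1)] by blast
    have cs: "card ?S = total n w" "card (shape_cells z) = total n z"
      using card_shape_cells[of n w] card_shape_cells[of n z] w(2) supp[OF that(1)] by auto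
    show ?thesis
      unfolding cs[symmetric]
      by (rule content_split[OF finite_shape_cells[OF w(2)] sub]) (use that(2) in auto)
  qed
  show ?thesis
  proof (rule card_split_filling[where D = shape_cells and S = ?S and a = a])
    show "finite ?I"
      by (rule finite_subset[OF _ finite_bounded_funs[OF w(2)]]) (auto intro: letter_strip_le)
    show "finite (?F z)" if "z \<in> ?I" for z
      using finite_shifted_fillings finite_shape_cells[of n z] supp that by blast
    show "inj_on shape_cells ?I" by (rule inj_shape_cells)
    show "shape_cells z \<subseteq> ?S" if "z \<in> ?I" for z using shape_cells_mono letter_strip_le that by blast
    show "T \<in> extensional (shape_cells z) \<and> (\<forall>x\<in>shape_cells z. T x \<noteq> a)" if "T \<in> ?F z" for z T
      using that a by (auto simp: shifted_fillings_def PiE_iff)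
  next
    fix T assume "T \<in> shifted_fillings w (Suc N) P"
    then have T: "T \<in> extensional ?S" "\<And>x. x \<in> ?S \<Longrightarrow> 1 \<le> letter_index (T x) \<and> letter_code (T x) \<le> letter_code a"
      "P (image_mset (\<lambda>x. letter_index (T x)) (mset_set ?S))" "marked_semistandard ?S T"
      using a(1) by (auto simp: shifted_fillings_def PiE_iff)
    obtain z where z: "letter_strip a z w" "shape_cells z = {x \<in> ?S. T x \<noteq> a}"
      using largest_letter_level[OF w(1) T(4), of a] T(2) by blast
    let ?D = "shape_cells z"
    have D: "?D \<subseteq> ?S" using z by blast
    have "1 \<le> letter_index (T x) \<and> letter_code (T x) < N" if "x \<in> ?D" for x
    proof -
      have x: "x \<in> ?S" "T x \<noteq> a" using that z(2) by auto
      then have "letter_code (T x) \<noteq> letter_code a" using letter_code_inj by blast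
      then show ?thesis using T(2)[OF x(1)] a(1) by auto
    qed
    then have "restrict T ?D \<in> ?D \<rightarrow>\<^sub>E {a. 1 \<le> letter_index a \<and> letter_code a < N}" by auto
    moreover have "marked_semistandard ?D (restrict T ?D)"
      using marked_semistandard_subset[OF T(4) D] marked_semistandard_cong[of ?D T "restrict T ?D"] by simp
    moreover have "image_mset (\<lambda>x. letter_index (restrict T ?D x)) (mset_set ?D) =
        image_mset (\<lambda>x. letter_index (T x)) (mset_set ?D)"
      using finite_shape_cells[of n z] supp[OF z(1)] by (intro image_mset_cong) auto
    moreover have "P (image_mset (\<lambda>x. letter_index (T x)) (mset_set ?D) +
        replicate_mset (total n w - total n z) (letter_index a))"
      using T(3) content[OF z(1), of T] z(2) by simp
    ultimately have "restrict T ?D \<in> ?F z" by (simp add: shifted_fillings_def)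
    then show "T \<in> extensional ?S \<and>
        (\<exists>z\<in>?I. shape_cells z = {x \<in> ?S. T x \<noteq> a} \<and> restrict T (shape_cells z) \<in> ?F z)"
      using T(1) z by blast
  next
    fix z T assume z: "z \<in> ?I" and "T \<in> ?F z"
    then have T: "\<And>x. x \<in> shape_cells z \<Longrightarrow> 1 \<le> letter_index (T x) \<and> letter_code (T x) < letter_code a"
      "P (image_mset (\<lambda>x. letter_index (T x)) (mset_set (shape_cells z)) +
        replicate_mset (total n w - total n z) (letter_index a))" "marked_semistandard (shape_cells z) T"
      using a(1) by (auto simp: shifted_fillings_def PiE_iff)
    let ?T = "\<lambda>x. if x \<in> shape_cells z then T x else if x \<in> ?S then a else undefined"
    have "marked_semistandard ?S ?T"
      by (rule add_largest_letter[OF w(1) _ T(3)]) (use z T(1) in auto)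
    moreover have "?T \<in> ?S \<rightarrow>\<^sub>E {a. 1 \<le> letter_index a \<and> letter_code a < Suc N}"
    proof -
      have "shape_cells z \<subseteq> ?S" using shape_cells_mono letter_strip_le z by blast
      moreover have "1 \<le> letter_index (T x) \<and> letter_code (T x) < Suc N" if "x \<in> shape_cells z" for x
        using T(1)[OF that] a(1) by simp
      ultimately show ?thesis using a by (auto simp: PiE_iff extensional_def)
    qed
    moreover have "image_mset (\<lambda>x. letter_index (?T x)) (mset_set (shape_cells z)) =
        image_mset (\<lambda>x. letter_index (T x)) (mset_set (shape_cells z))"
      using finite_shape_cells[of n z] supp z by (intro image_mset_cong) auto
    moreover have "image_mset (\<lambda>x. letter_index (?T x)) (mset_set ?S) =
        image_mset (\<lambda>x. letter_index (?T x)) (mset_set (shape_cells z)) +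
        replicate_mset (total n w - total n z) (letter_index a)"
      using content[of z ?T] z by auto
    ultimately show "?T \<in> shifted_fillings w (Suc N) P"
      using T(2) unfolding shifted_fillings_def by simp
  qed
qed

lemma content_without_largest:
  assumes "T \<in> shifted_fillings v (2 * K) P" "finite (shape_cells v)"
  shows "K \<notin># image_mset (\<lambda>x. letter_index (T x)) (mset_set (shape_cells v))"
  using assms unfolding shifted_fillings_def letter_code_index by (auto simp: PiE_iff)

text \<open>The bound \<open>2 * K + 2\<close> lies just above the code of
  \<open>Unprimed K\<close>. Removing first \<open>Unprimed K\<close> and then
  \<open>Primed K\<close> takes away exactly one marked strip.\<close>

lemma card_shifted_fillings:
  assumes "strict_shape w" "\<And>u. n < u \<Longrightarrow> w u = 0" "set_mset m \<subseteq> {0<..K}"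
  shows "card (shifted_fillings w (2 * K + 2) (\<lambda>M. M = m)) =
    marked_count n (rev (map (count m) [1..<Suc K])) w"
  using assms
proof (induction K arbitrary: w m)
  case 0
  then have m: "m = {#}" by auto
  \<comment> \<open>The codes 0 and 1 belong to letters of index 0, which are not allowed.\<close>
  have none: "\<not> (1 \<le> letter_index a \<and> letter_code a < 2)" for a by (cases a) auto
  have z: "shape_cells w = {} \<longleftrightarrow> w = (\<lambda>_. 0)"
  proof
    have "shape_cells (\<lambda>_. 0) = {}" by (auto simp: shape_cells_def)
    then show "shape_cells w = {} \<Longrightarrow> w = (\<lambda>_. 0)"
      using inj_onD[OF inj_shape_cells[of UNIV], of w "\<lambda>_. 0"] by simp
  qed (auto simp: shape_cells_def)
  have "shifted_fillings w 2 (\<lambda>M. M = m) = (if w = (\<lambda>_. 0) then {\<lambda>_. undefined} else {})"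
  proof (cases "w = (\<lambda>_. 0)")
    case True
    then have "shape_cells w = {}" using z by simp
    then show ?thesis using True by (auto simp: shifted_fillings_def m marked_semistandard_def)
  next
    case False
    then obtain x where "x \<in> shape_cells w" using z by blast
    then have "shifted_fillings w 2 (\<lambda>M. M = m) = {}"
      using none unfolding shifted_fillings_def PiE_iff by blast
    then show ?thesis using False by simp
  qed
  then have "card (shifted_fillings w 2 (\<lambda>M. M = m)) = (if w = (\<lambda>_. 0) then 1 else 0)" by simp
  then show ?case by (simp add: numeral_2_eq_2)
next
  case (Suc K)
  let ?K = "Suc K" and ?m = "filter_mset (\<lambda>x. x \<noteq> Suc K) m"
  let ?r = "\<lambda>w z. replicate_mset (total n w - total n z) ?K"
  let ?I = "{z. letter_strip (Unprimed ?K) z w}" and ?J = "\<lambda>z. {v. letter_strip (Primed ?K) v z}"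
  have supp: "z u = 0" if "letter_strip a z w" "\<And>u. n < u \<Longrightarrow> w u = 0" "n < u" for a w z u
    using letter_strip_le[OF that(1), of u] that(2)[OF that(3)] by simp
  have tot: "total n z \<le> total n w" if "letter_strip a z w" for a z w
    unfolding total_def using letter_strip_le[OF that] by (rule sum_mono)
  have finI: "finite {z. letter_strip a z w}" if "\<And>u. n < u \<Longrightarrow> w u = 0" for a w
    by (rule finite_subset[OF _ finite_bounded_funs[OF that]]) (auto intro: letter_strip_le)
  have "card (shifted_fillings w (2 * ?K + 2) (\<lambda>M. M = m)) =
      (\<Sum>z\<in>?I. card (shifted_fillings z (Suc (2 * ?K)) (\<lambda>M. M + ?r w z = m)))"
    using card_shifted_fillings_Suc[OF Suc.prems(1,2), where a = "Unprimed ?K" and N = "Suc (2 * ?K)"]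
    by simp
  also have "\<dots> = (\<Sum>z\<in>?I. \<Sum>v\<in>?J z. card (shifted_fillings v (2 * ?K) (\<lambda>M. M + ?r z v + ?r w z = m)))"
  proof (rule sum.cong[OF refl])
    fix z assume z: "z \<in> ?I"
    have sz: "strict_shape z" using z by (simp add: letter_strip_def)
    have supz: "z u = 0" if "n < u" for u
      by (rule supp[of "Unprimed ?K" z w]) (use z Suc.prems(2) that in auto)
    show "card (shifted_fillings z (Suc (2 * ?K)) (\<lambda>M. M + ?r w z = m)) =
        (\<Sum>v\<in>?J z. card (shifted_fillings v (2 * ?K) (\<lambda>M. M + ?r z v + ?r w z = m)))"
      using card_shifted_fillings_Suc[OF sz supz, where a = "Primed ?K" and N = "2 * ?K"] by simp
  qed
  also have "\<dots> = (\<Sum>z\<in>?I. \<Sum>v\<in>?J z. if total n w = total n v + count m ?K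
      then marked_count n (rev (map (count m) [1..<Suc K])) v else 0)"
  proof (intro sum.cong refl)
    fix z v assume z: "z \<in> ?I" and v: "v \<in> ?J z"
    have supz: "z u = 0" if "n < u" for u
      by (rule supp[of "Unprimed ?K" z w]) (use z Suc.prems(2) that in auto)
    have supv: "v u = 0" if "n < u" for u
      by (rule supp[of "Primed ?K" v z]) (use v supz that in auto)
    have fv: "finite (shape_cells v)" using finite_shape_cells supv by blast
    have sv: "strict_shape v" using v by (simp add: letter_strip_def)
    have t: "total n v \<le> total n z" "total n z \<le> total n w" using tot z v by blast+
    \<comment> \<open>As \<open>M\<close> is free of the letter \<open>K\<close>, the equation of
      contents splits into the part without \<open>K\<close> and the multiplicity of
      \<open>K\<close>.\<close>
    have r: "M + ?r z v + ?r w z = m \<longleftrightarrow> M = ?m \<and> total n w = total n v + count m ?K"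
      if "?K \<notin># M" for M
    proof -
      have "?r z v + ?r w z = replicate_mset (total n w - total n v) ?K"
        using t by (simp add: multiset_eq_iff)
      then have e: "M + ?r z v + ?r w z = M + replicate_mset (total n w - total n v) ?K"
        by (simp add: add.assoc)
      show ?thesis
      proof
        assume h: "M + ?r z v + ?r w z = m"
        have "?m = M" using filter_mset_remove_letter[OF that] h e by metis
        moreover have "count m ?K = total n w - total n v"
          using that h e by (metis add_cancel_left_left count_replicate_mset count_union not_in_iff)
        ultimately show "M = ?m \<and> total n w = total n v + count m ?K" using t by simp
      next
        assume "M = ?m \<and> total n w = total n v + count m ?K"
        then show "M + ?r z v + ?r w z = m" unfolding e using filter_mset_add_letter[of ?K m] by simp
      qed
    qed
    have "shifted_fillings v (2 * ?K) (\<lambda>M. M + ?r z v + ?r w z = m) =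
        (if total n w = total n v + count m ?K then shifted_fillings v (2 * ?K) (\<lambda>M. M = ?m) else {})"
    proof (rule set_eqI)
      fix T
      show "T \<in> shifted_fillings v (2 * ?K) (\<lambda>M. M + ?r z v + ?r w z = m) \<longleftrightarrow>
        T \<in> (if total n w = total n v + count m ?K then shifted_fillings v (2 * ?K) (\<lambda>M. M = ?m) else {})"
      proof (cases "T \<in> shifted_fillings v (2 * ?K) (\<lambda>M. True)")
        case True
        from r[OF content_without_largest[OF True fv]] True show ?thesis
          by (simp add: shifted_fillings_def)
      qed (auto simp: shifted_fillings_def)
    qed
    moreover have "card (shifted_fillings v (2 * ?K) (\<lambda>M. M = ?m)) =
        marked_count n (rev (map (count m) [1..<Suc K])) v"
    proof -
      have "set_mset ?m \<subseteq> {0<..K}"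
      proof
        fix x assume "x \<in># ?m"
        then have "x \<in> {0<..Suc K}" "x \<noteq> Suc K" using Suc.prems(3) by auto
        then show "x \<in> {0<..K}" by auto
      qed
      from Suc.IH[OF sv supv this] have "card (shifted_fillings v (2 * ?K) (\<lambda>M. M = ?m)) =
        marked_count n (rev (map (count ?m) [1..<Suc K])) v"
        by (simp only: mult_Suc_right add.commute)
      moreover have "map (count ?m) [1..<Suc K] = map (count m) [1..<Suc K]" by (rule map_cong) auto
      ultimately show ?thesis by metis
    qed
    ultimately show "card (shifted_fillings v (2 * ?K) (\<lambda>M. M + ?r z v + ?r w z = m)) =
      (if total n w = total n v + count m ?K
       then marked_count n (rev (map (count m) [1..<Suc K])) v else 0)" by simp
  qed
  also have "\<dots> = (\<Sum>(z, v)\<in>(SIGMA z:?I. ?J z). if total n w = total n v + count m ?K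
      then marked_count n (rev (map (count m) [1..<Suc K])) v else 0)"
  proof (rule sum.Sigma)
    show "finite ?I" by (rule finI[OF Suc.prems(2)])
    show "\<forall>z\<in>?I. finite (?J z)"
    proof
      fix z assume "z \<in> ?I"
      then have "z u = 0" if "n < u" for u using supp[of "Unprimed ?K" z w u] Suc.prems(2) that by blast
      then show "finite (?J z)" by (rule finI)
    qed
  qed
  also have "\<dots> = (\<Sum>(z, v)\<in>{(z, v) \<in> (SIGMA z:?I. ?J z). total n w = total n v + count m ?K}.
      marked_count n (rev (map (count m) [1..<Suc K])) v)"
  proof (rule sum.mono_neutral_cong_right)
    show "finite (SIGMA z:?I. ?J z)"
    proof (rule finite_SigmaI)
      show "finite ?I" by (rule finI[OF Suc.prems(2)])
      fix z assume "z \<in> ?I"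
      then have "z u = 0" if "n < u" for u using supp[of "Unprimed ?K" z w u] Suc.prems(2) that by blast
      then show "finite (?J z)" by (rule finI)
    qed
  qed (auto split: if_splits)
  also have "\<dots> = (\<Sum>(v, z)\<in>{(v, z). strict_shape v \<and> marked_strip v z w \<and> total n w = total n v + count m ?K}.
      marked_count n (rev (map (count m) [1..<Suc K])) v)"
    by (rule sum.reindex_bij_witness[of _ "\<lambda>(v, z). (z, v)" "\<lambda>(z, v). (v, z)"])
      (auto simp: letter_strip_def marked_strip_split unprimed_strip_strict)
  also have "\<dots> = marked_count n (count m ?K # rev (map (count m) [1..<Suc K])) w"
    unfolding marked_count.simps ..
  also have "count m ?K # rev (map (count m) [1..<Suc K]) = rev (map (count m) [1..<Suc ?K])" by simp
  finally show ?case .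
qed

section \<open>Compatible tableaux as concave_chains\<close>

definition psum :: "(nat \<Rightarrow> nat) \<Rightarrow> nat \<Rightarrow> nat" where
  "psum p k = (\<Sum>j\<le>k. p j)"

text \<open>Compatible tableaux in terms of the rows of their entries: the entries of block \<open>k\<close> are those in
  \<open>{psum p (k - 1)<..psum p k}\<close>.\<close>

definition compatible_tableau ::
    "nat \<Rightarrow> (nat \<Rightarrow> nat) \<Rightarrow> (nat \<Rightarrow> nat) \<Rightarrow> (cell \<Rightarrow> nat) \<Rightarrow> bool" where
  "compatible_tableau n p w U \<longleftrightarrow> strict_shape w \<and> U \<in> extensional (shape_cells w) \<and>
     bij_betw U (shape_cells w) {1..psum p n} \<and>
     (\<forall>r c c'. (r, c) \<in> shape_cells w \<and> (r, c') \<in> shape_cells w \<and> c < c'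
        \<longrightarrow> U (r, c) < U (r, c')) \<and>
     (\<forall>r r' c. (r, c) \<in> shape_cells w \<and> (r', c) \<in> shape_cells w \<and> r < r'
        \<longrightarrow> U (r, c) < U (r', c)) \<and>
     (\<forall>k x y. x \<in> shape_cells w \<and> y \<in> shape_cells w \<and> psum p k < U x \<and> U y = Suc (U x) \<and>
        U y \<le> psum p (Suc k) \<longrightarrow> fst x < fst y) \<and>
     (\<forall>k t x y. 1 \<le> t \<and> t < p (Suc k) \<and> x \<in> shape_cells w \<and> y \<in> shape_cells w \<and>
        U x = Suc (psum p k - t) \<and> U y = psum p (Suc k) - t \<longrightarrow> fst y \<le> fst x)"

definition level_chain :: "(nat \<Rightarrow> nat) \<Rightarrow> (nat \<Rightarrow> nat) \<Rightarrow> (cell \<Rightarrow> nat) \<Rightarrow> nat \<Rightarrow> nat \<Rightarrow> nat" where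
  "level_chain p w U k s = card {c. (s, c) \<in> shape_cells w \<and> U (s, c) \<le> psum p k}"

lemma psum_Suc: "psum p (Suc k) = psum p k + p (Suc k)"
  by (simp add: psum_def)

lemma psum_mono: "j \<le> k \<Longrightarrow> psum p j \<le> psum p k"
  unfolding psum_def by (rule sum_mono2) auto

lemma psum_stationary:
  assumes "block_vector n p" "n \<le> k"
  shows "psum p k = psum p n"
  using assms(2)
proof (induction rule: dec_induct)
  case (step j)
  then show ?case using assms(1) by (simp add: psum_Suc block_vector_def)
qed simp

lemma psum_block_size:
  assumes "Y \<in> concave_chains n"
  shows "psum (block_size n Y) k = total n (Y k)"
proof (induction k)
  case 0
  then show ?case using concave_chainsD(1)[OF assms] by (simp add: psum_def block_size_0 total_def)
next
  case (Suc k)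
  then show ?case
    using tail_mono_vstrip[OF concave_chainsD(3)[OF assms, of k], of "Suc n" 0]
    by (simp add: psum_Suc block_size_def total_tail)
qed

definition new_rows :: "(nat \<Rightarrow> nat) \<Rightarrow> (nat \<Rightarrow> nat) \<Rightarrow> nat set" where
  "new_rows v w = {u. w u = Suc (v u)}"

lemma vstrip_new_cells:
  assumes "vstrip v w"
  shows "shape_cells w - shape_cells v = (\<lambda>u. (u, u + v u)) ` new_rows v w"
proof (intro equalityI subsetI)
  fix x assume "x \<in> shape_cells w - shape_cells v"
  then show "x \<in> (\<lambda>u. (u, u + v u)) ` new_rows v w"
    using vstripD[OF assms, of "fst x"] by (cases x) (auto simp: shape_cells_def new_rows_def)
qed (auto simp: shape_cells_def new_rows_def)

lemma finite_new_rows: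
  assumes "strict_shape w"
  shows "finite (new_rows v w)"
proof (rule finite_subset)
  show "new_rows v w \<subseteq> {..w 0}"
  proof
    fix u assume "u \<in> new_rows v w"
    then show "u \<in> {..w 0}"
      using strict_shape_support[OF assms, of u] by (cases "w 0 \<le> u") (auto simp: new_rows_def)
  qed
qed simp

section \<open>From compatible tableaux to concave chains\<close>

locale tableau_levels =
  fixes n p w U
  assumes ip: "inner_partition n p" and ct: "compatible_tableau n p w U"
begin

abbreviation "S \<equiv> shape_cells w"
abbreviation "Y \<equiv> level_chain p w U"

lemmas ctD = ct[unfolded compatible_tableau_def]

lemma strict: "strict_shape w"
  by (rule ctD[THEN conjunct1])

lemma bij: "bij_betw U S {1..psum p n}"
  by (rule ctD[THEN conjunct2, THEN conjunct2, THEN conjunct1])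

lemma row: "(r, c) \<in> S \<Longrightarrow> (r, c') \<in> S \<Longrightarrow> c < c' \<Longrightarrow> U (r, c) < U (r, c')"
  by (rule ctD[THEN conjunct2, THEN conjunct2, THEN conjunct2, THEN conjunct1, rule_format]) simp

lemma col: "(r, c) \<in> S \<Longrightarrow> (r', c) \<in> S \<Longrightarrow> r < r' \<Longrightarrow> U (r, c) < U (r', c)"
  by (rule ctD[THEN conjunct2, THEN conjunct2, THEN conjunct2, THEN conjunct2, THEN conjunct1, rule_format]) simp

lemma desc:
  assumes "x \<in> S" "y \<in> S" "psum p k < U x" "U y = Suc (U x)" "U y \<le> psum p (Suc k)"
  shows "fst x < fst y"
proof -
  have "\<forall>k x y. x \<in> S \<and> y \<in> S \<and> psum p k < U x \<and> U y = Suc (U x) \<and> U y \<le> psum p (Suc k) \<longrightarrow> fst x < fst y"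
    using ctD by (elim conjE)
  then show ?thesis using assms by metis
qed

lemma asc:
  assumes "1 \<le> t" "t < p (Suc k)" "x \<in> S" "y \<in> S" "U x = Suc (psum p k - t)" "U y = psum p (Suc k) - t"
  shows "fst y \<le> fst x"
proof -
  have "\<forall>k t x y. 1 \<le> t \<and> t < p (Suc k) \<and> x \<in> S \<and> y \<in> S \<and>
      U x = Suc (psum p k - t) \<and> U y = psum p (Suc k) - t \<longrightarrow> fst y \<le> fst x"
    using ctD by (elim conjE)
  then show ?thesis using assms by metis
qed

lemma bv: "block_vector n p"
  using ip by (simp add: inner_partition_def)

lemma psum_le: "psum p k \<le> psum p n"
  using psum_mono[of k n p] psum_stationary[OF bv, of k] by (cases "k \<le> n") auto

lemma inj: "inj_on U S"
  using bij by (rule bij_betw_imp_inj_on)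

lemma U_range: "x \<in> S \<Longrightarrow> 1 \<le> U x \<and> U x \<le> psum p n"
  using bij bij_betwE by fastforce

lemma U_surj: "1 \<le> i \<Longrightarrow> i \<le> psum p n \<Longrightarrow> \<exists>x\<in>S. U x = i"
  using bij unfolding bij_betw_def by (metis atLeastAtMost_iff imageE)

lemma card_U: "card {x \<in> S. a < U x \<and> U x \<le> b} = b - a" if b: "b \<le> psum p n"
proof -
  have "U ` {x \<in> S. a < U x \<and> U x \<le> b} = {a<..b}"
  proof (intro equalityI subsetI)
    fix i assume "i \<in> {a<..b}"
    then obtain x where "x \<in> S" "U x = i" using U_surj[of i] b by auto
    then show "i \<in> U ` {x \<in> S. a < U x \<and> U x \<le> b}"
      using \<open>i \<in> {a<..b}\<close> by (intro image_eqI[of _ _ x]) simp_all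
  next
    fix i assume "i \<in> U ` {x \<in> S. a < U x \<and> U x \<le> b}"
    then show "i \<in> {a<..b}" by (elim imageE) simp
  qed
  moreover have "inj_on U {x \<in> S. a < U x \<and> U x \<le> b}" by (rule inj_on_subset[OF inj]) blast
  ultimately show ?thesis using card_image by fastforce
qed

lemma cells_Y: "shape_cells (Y k) = {x \<in> S. U x \<le> psum p k}"
proof (rule set_eqI)
  fix x :: cell
  obtain r c where rc: "x = (r, c)" by (cases x)
  have "c \<in> {c. (r, c) \<in> S \<and> U (r, c) \<le> psum p k} \<longleftrightarrow>
    r \<le> c \<and> c < r + card {c. (r, c) \<in> S \<and> U (r, c) \<le> psum p k}"
  proof (rule lower_segment)
    show "{c. (r, c) \<in> S \<and> U (r, c) \<le> psum p k} \<subseteq> {r..<r + w r}" by (auto simp: shape_cells_def)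
    fix x y assume x: "x \<in> {c. (r, c) \<in> S \<and> U (r, c) \<le> psum p k}" and y: "r \<le> y" "y \<le> x"
    have "(r, y) \<in> S" using x y by (auto simp: shape_cells_def)
    then show "y \<in> {c. (r, c) \<in> S \<and> U (r, c) \<le> psum p k}"
      using x y row[of r y x] by (cases "y = x") auto
  qed
  then show "x \<in> shape_cells (Y k) \<longleftrightarrow> x \<in> {x \<in> S. U x \<le> psum p k}"
    by (simp add: rc shape_cells_def level_chain_def)
qed

lemma strict_Y: "strict_shape (Y k)"
  unfolding strict_shape_def
proof
  fix s
  show "Y k (Suc s) < Y k s \<or> Y k (Suc s) = 0"
  proof (cases "Y k (Suc s) = 0")
    case False
    let ?c = "s + Y k (Suc s)"
    have "(Suc s, ?c) \<in> shape_cells (Y k)" using False by (simp add: shape_cells_def)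
    then have x: "(Suc s, ?c) \<in> S" "U (Suc s, ?c) \<le> psum p k" unfolding cells_Y by auto
    have "(s, ?c) \<in> S" using shape_cells_up[OF strict x(1)] by simp
    then have "(s, ?c) \<in> shape_cells (Y k)" unfolding cells_Y using col[OF _ x(1)] x(2) by fastforce
    then show ?thesis by (simp add: shape_cells_def)
  qed simp
qed

lemma block: "shape_cells (Y (Suc k)) - shape_cells (Y k) = {x \<in> S. psum p k < U x \<and> U x \<le> psum p (Suc k)}"
  unfolding cells_Y by auto

text \<open>All consecutive entries between \<open>U x\<close> and \<open>U y\<close> are descents,
  and rows increase along them.\<close>

lemma block_rows:
  assumes "x \<in> S" "y \<in> S" "psum p k < U x" "U x < U y" "U y \<le> psum p (Suc k)"
  shows "fst x < fst y"
  using assms(2,4,5)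
proof (induction "U y" arbitrary: y)
  case (Suc i)
  show ?case
  proof (cases "U x = i")
    case True
    then show ?thesis using desc[OF assms(1) Suc(3) assms(3)] Suc by simp
  next
    case False
    then have "1 \<le> i" "i \<le> psum p n" using Suc U_range[OF Suc(3)] by auto
    then obtain z where z: "z \<in> S" "U z = i" using U_surj by blast
    have "fst x < fst z" using Suc(1)[of z] z Suc False by simp
    moreover have "fst z < fst y" using desc[OF z(1) Suc(3), of k] z Suc assms(3) False by simp
    ultimately show ?thesis by simp
  qed
qed simp

lemma vstrip_Y: "vstrip (Y k) (Y (Suc k))"
proof -
  have "Y k s \<le> Y (Suc k) s" for s
    unfolding level_chain_def using psum_mono[of k "Suc k" p]
    by (intro card_mono) (auto intro: finite_subset[of _ "{..<s + w s}"] simp: shape_cells_def)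
  moreover have "Y (Suc k) s \<le> Suc (Y k s)" for s
  proof (rule ccontr)
    let ?x = "(s, s + Y k s)" and ?y = "(s, Suc (s + Y k s))"
    assume "\<not> Y (Suc k) s \<le> Suc (Y k s)"
    then have "?x \<in> shape_cells (Y (Suc k)) - shape_cells (Y k)" "?y \<in> shape_cells (Y (Suc k)) - shape_cells (Y k)"
      by (auto simp: shape_cells_def)
    then have *: "?x \<in> S" "?y \<in> S" "psum p k < U ?x" "U ?y \<le> psum p (Suc k)" unfolding block by auto
    then show False using block_rows[OF *(1,2,3) row[OF *(1,2)] *(4)] by simp
  qed
  ultimately show ?thesis unfolding vstrip_def by (metis le_SucE le_antisym)
qed

abbreviation "B k \<equiv> new_rows (Y k) (Y (Suc k))"

lemma card_block_rows:
  "card {x \<in> S. psum p k < U x \<and> U x \<le> psum p (Suc k) \<and> Q (fst x)} = card {u \<in> B k. Q u}"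
proof -
  have "{x \<in> S. psum p k < U x \<and> U x \<le> psum p (Suc k) \<and> Q (fst x)} =
      {x \<in> shape_cells (Y (Suc k)) - shape_cells (Y k). Q (fst x)}" unfolding block by auto
  also have "\<dots> = (\<lambda>u. (u, u + Y k u)) ` {u \<in> B k. Q u}"
    unfolding vstrip_new_cells[OF vstrip_Y] by auto
  finally show ?thesis by (simp add: card_image inj_on_def)
qed

text \<open>Inside a block the order of entries is the order of rows, so an entry is found by
  counting rows from the top or from the bottom.\<close>

lemma U_eq:
  assumes x: "x \<in> S" "psum p k < U x" "U x \<le> psum p (Suc k)"
  shows "U x = psum p k + card {u \<in> B k. u \<le> fst x}"
    "Suc (psum p (Suc k)) = U x + card {u \<in> B k. fst x \<le> u}"
proof -
  have both: "(U y \<le> U x \<longleftrightarrow> fst y \<le> fst x) \<and> (U x \<le> U y \<longleftrightarrow> fst x \<le> fst y)"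
    if "y \<in> S" "psum p k < U y" "U y \<le> psum p (Suc k)" for y
  proof (cases "U x" "U y" rule: linorder_cases)
    case less
    then show ?thesis using block_rows[OF x(1) that(1) x(2) less that(3)] by simp
  next
    case equal
    then show ?thesis using inj x(1) that(1) by (auto dest: inj_onD)
  next
    case greater
    then show ?thesis using block_rows[OF that(1) x(1) that(2) greater x(3)] by simp
  qed
  then have cmp: "U y \<le> U x \<longleftrightarrow> fst y \<le> fst x" and cmp': "U x \<le> U y \<longleftrightarrow> fst x \<le> fst y"
    if "y \<in> S" "psum p k < U y" "U y \<le> psum p (Suc k)" for y
    using that by blast+
  have "{y \<in> S. psum p k < U y \<and> U y \<le> U x} =
      {y \<in> S. psum p k < U y \<and> U y \<le> psum p (Suc k) \<and> fst y \<le> fst x}"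
  proof (rule Collect_cong)
    fix y
    show "y \<in> S \<and> psum p k < U y \<and> U y \<le> U x \<longleftrightarrow>
      y \<in> S \<and> psum p k < U y \<and> U y \<le> psum p (Suc k) \<and> fst y \<le> fst x"
      using cmp[of y] x(3) by auto
  qed
  then have "U x - psum p k = card {u \<in> B k. u \<le> fst x}"
    using card_U[of "U x" "psum p k"] U_range[OF x(1)] card_block_rows[of k "\<lambda>u. u \<le> fst x"] by simp
  then show "U x = psum p k + card {u \<in> B k. u \<le> fst x}" using x(2) by simp
  have "{y \<in> S. U x - 1 < U y \<and> U y \<le> psum p (Suc k)} =
      {y \<in> S. psum p k < U y \<and> U y \<le> psum p (Suc k) \<and> fst x \<le> fst y}"
  proof (rule Collect_cong)
    fix y
    show "y \<in> S \<and> U x - 1 < U y \<and> U y \<le> psum p (Suc k) \<longleftrightarrow>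
      y \<in> S \<and> psum p k < U y \<and> U y \<le> psum p (Suc k) \<and> fst x \<le> fst y"
    proof -
      have "U x - 1 < U y \<longleftrightarrow> U x \<le> U y" using x(2) by linarith
      moreover have "U x \<le> U y \<Longrightarrow> psum p k < U y" using x(2) by linarith
      ultimately show ?thesis using cmp'[of y] by blast
    qed
  qed
  then have "psum p (Suc k) - (U x - 1) = card {u \<in> B k. fst x \<le> u}"
    using card_U[OF psum_le, of "U x - 1" "Suc k"] card_block_rows[of k "\<lambda>u. fst x \<le> u"] by simp
  then show "Suc (psum p (Suc k)) = U x + card {u \<in> B k. fst x \<le> u}" using x by simp
qed

lemma card_B: "card (B k) = p (Suc k)"
  using card_block_rows[of k "\<lambda>_. True"] card_U[OF psum_le, of "psum p k" "Suc k"] by (simp add: psum_Suc)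

lemma B_cell:
  assumes "u \<in> B k"
  obtains x where "x \<in> S" "psum p k < U x" "U x \<le> psum p (Suc k)" "fst x = u"
proof -
  have "(u, u + Y k u) \<in> shape_cells (Y (Suc k)) - shape_cells (Y k)"
    unfolding vstrip_new_cells[OF vstrip_Y] using assms by blast
  then show ?thesis unfolding block using that by auto
qed

lemma Y_0: "Y 0 = (\<lambda>_. 0)"
proof
  fix s
  have "psum p 0 = 0" using bv by (simp add: psum_def block_vector_def)
  then have "{c. (s, c) \<in> S \<and> U (s, c) \<le> psum p 0} = {}" using U_range by fastforce
  then show "Y 0 s = 0" unfolding level_chain_def by (metis card.empty)
qed

lemma Y_n: "Y n = w"
proof -
  have "shape_cells (Y n) = S" unfolding cells_Y using U_range by auto
  then show ?thesis using inj_onD[OF inj_shape_cells[of UNIV], of "Y n" w] by simp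
qed

lemma Y_stationary:
  assumes "n \<le> k"
  shows "Y k = Y n"
  by (rule ext) (simp only: level_chain_def psum_stationary[OF bv assms])

lemma Y_first: "Y k 0 \<le> k"
proof (induction k)
  case (Suc k)
  then show ?case using vstripD[OF vstrip_Y, of k 0] by auto
qed (simp add: Y_0)

lemma Y_support:
  assumes "n \<le> u"
  shows "Y k u = 0"
proof -
  have "Y (min k n) u = 0"
    using strict_shape_support[OF strict_Y] Y_first[of "min k n"] assms by (meson le_trans min.cobounded2)
  moreover have "Y k = Y (min k n)" using Y_stationary[of k] by (simp add: min_def)
  ultimately show ?thesis by metis
qed

lemma total_Y: "total n (Y k) = psum p k"
proof -
  have "total n (Y k) = card (shape_cells (Y k))" by (rule card_shape_cells[symmetric]) (simp add: Y_support)
  also have "shape_cells (Y k) = {x \<in> S. 0 < U x \<and> U x \<le> psum p k}" unfolding cells_Y using U_range by fastforce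
  finally show ?thesis using card_U[OF psum_le, of 0 k] by simp
qed

lemma rows_bounded: "{u\<in>{..<Suc n}. Y (Suc k) u = Suc (Y k u) \<and> s \<le> u} = {u \<in> B k. s \<le> u}"
proof (rule set_eqI)
  fix u
  have "u < Suc n" if "Y (Suc k) u = Suc (Y k u)" using Y_support[of u "Suc k"] that by (cases "n \<le> u") auto
  then show "u \<in> {u\<in>{..<Suc n}. Y (Suc k) u = Suc (Y k u) \<and> s \<le> u} \<longleftrightarrow> u \<in> {u \<in> B k. s \<le> u}"
    by (auto simp: new_rows_def)
qed

text \<open>Let \<open>x\<close> be the first entry of the upper block in the rows
  \<open>\<ge> s\<close>, with \<open>t\<close> entries of its block after it. The ascent condition
  puts the entry \<open>y\<close> of the block before, with which its last \<open>t\<close> entries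
  begin, weakly below \<open>x\<close>; these \<open>t\<close> entries all lie in rows
  \<open>\<ge> s\<close>. For \<open>k = 0\<close> block 1 has at most one entry.\<close>

lemma row_concave_Y: "row_concave (Suc n) (Y (k - 1)) (Y k) (Y (Suc k))"
proof (cases k)
  case 0
  have "card {u \<in> B 0. s \<le> u} \<le> 1" for s
  proof -
    have "card {u \<in> B 0. s \<le> u} \<le> card (B 0)"
      by (rule card_mono) (auto intro: finite_new_rows strict_Y)
    moreover have "p (Suc 0) \<le> 1" using inner_partition_le[OF ip, of "Suc 0"] by simp
    ultimately show ?thesis using card_B[of 0] by simp
  qed
  then show ?thesis
    unfolding 0 row_concave_def using tail_vstrip[OF vstrip_Y, of "Suc n" 0] rows_bounded[of 0]
    by (simp add: Y_0 tail_cells_def)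
next
  case (Suc j)
  show ?thesis
    unfolding Suc diff_Suc_1 row_concave_iff_card[OF vstrip_Y vstrip_Y] rows_bounded
  proof
    fix s
    let ?A = "{u \<in> B (Suc j). s \<le> u}"
    have finB: "finite (B i)" for i by (rule finite_new_rows[OF strict_Y])
    show "card ?A \<le> Suc (card {u \<in> B j. s \<le> u})"
    proof (cases "card ?A \<le> 1")
      case False
      define u where "u = Min ?A"
      have "?A \<noteq> {}" using False by (metis card.empty le0)
      then have u: "u \<in> ?A" unfolding u_def using finB by (intro Min_in) auto
      have A: "{v \<in> B (Suc j). u \<le> v} = ?A" using u finB unfolding u_def by (auto intro: Min_le)
      obtain x where x: "x \<in> S" "psum p (Suc j) < U x" "U x \<le> psum p (Suc (Suc j))" "fst x = u"
        using B_cell[of u "Suc j"] u by blast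
      define t where "t = card ?A - 1"
      have "card ?A \<le> card (B (Suc j))" using finB by (intro card_mono) auto
      then have t: "1 \<le> t" "t < p (Suc (Suc j))" using False card_B[of "Suc j"] by (auto simp: t_def)
      have Ux: "U x = psum p (Suc (Suc j)) - t"
        using U_eq(2)[OF x(1-3)] x(4) A False by (simp add: t_def)
      have tp: "t \<le> p (Suc j)" using t ip unfolding inner_partition_def
        by (metis Suc_leI Suc_le_mono le_trans)
      have pj: "psum p (Suc j) \<le> psum p n" by (rule psum_le)
      have "Suc (psum p (Suc j) - t) \<le> psum p n" using pj t tp psum_Suc[of p j] by linarith
      then obtain y where y: "y \<in> S" "U y = Suc (psum p (Suc j) - t)"
        using U_surj[of "Suc (psum p (Suc j) - t)"] by auto
      have yb: "psum p j < U y" "U y \<le> psum p (Suc j)" using y(2) tp t by (auto simp: psum_Suc)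
      have le: "fst x \<le> fst y" by (rule asc[OF t y(1) x(1) y(2) Ux])
      have "card {v \<in> B j. fst y \<le> v} = t"
        using U_eq(2)[OF y(1) yb] y(2) tp by (simp add: psum_Suc)
      moreover have "card {v \<in> B j. fst y \<le> v} \<le> card {v \<in> B j. s \<le> v}"
        by (rule card_mono) (use finB le x(4) u in auto)
      ultimately show ?thesis by (simp add: t_def)
    qed simp
  qed
qed

lemma level_chain_in_chains: "Y \<in> concave_chains n"
  by (rule chainsI[where Y = Y, OF Y_0 strict_Y vstrip_Y row_concave_Y Y_stationary])

lemma block_size_Y: "block_size n Y = p"
proof
  fix k
  show "block_size n Y k = p k"
    using bv total_Y[of k] total_Y[of "k - 1"]
    by (cases k) (simp_all add: block_size_def total_tail psum_Suc block_vector_def)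
qed

lemma U_unique:
  assumes "x \<in> S"
  obtains k where "U x = total n (Y k) + card {u \<in> B k. u \<le> fst x}"
    "x \<in> shape_cells (Y (Suc k)) - shape_cells (Y k)"
proof -
  have "U x \<le> psum p n" "0 < U x" using U_range[OF assms] by auto
  then have "\<exists>k. U x \<le> psum p k" by blast
  define k where "k = (LEAST k. U x \<le> psum p k)"
  have k: "U x \<le> psum p k" unfolding k_def using \<open>\<exists>k. U x \<le> psum p k\<close> by (rule LeastI_ex)
  have "psum p 0 = 0" using bv by (simp add: psum_def block_vector_def)
  then obtain j where j: "k = Suc j" using k \<open>0 < U x\<close> by (cases k) auto
  have "\<not> U x \<le> psum p j" using not_less_Least[of j "\<lambda>k. U x \<le> psum p k"] j unfolding k_def by simp
  then have b: "psum p j < U x" "U x \<le> psum p (Suc j)" using k j by simp_all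
  show ?thesis
  proof (rule that)
    show "U x = total n (Y j) + card {u \<in> B j. u \<le> fst x}"
      unfolding total_Y by (rule U_eq(1)[OF assms b])
    show "x \<in> shape_cells (Y (Suc j)) - shape_cells (Y j)" unfolding block using assms b by blast
  qed
qed

end

text \<open>An entry is recovered from its block and from the rank of its row among the rows of the
  block, both visible in the chain.\<close>

lemma level_chain_inj:
  assumes ip: "inner_partition n p"
    and "compatible_tableau n p w U" "compatible_tableau n p w' U'"
    and e: "level_chain p w U = level_chain p w' U'"
  shows "w = w' \<and> U = U'"
proof -
  interpret A: tableau_levels n p w U by unfold_locales (use assms in auto)
  interpret A': tableau_levels n p w' U' by unfold_locales (use assms in auto)
  have w: "w = w'" using trans[OF A.Y_n[symmetric] trans[OF fun_cong[OF e] A'.Y_n]] .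
  have "U = U'"
  proof (rule extensionalityI)
    show "U \<in> extensional (shape_cells w)"
      using assms(2) unfolding compatible_tableau_def by blast
    show "U' \<in> extensional (shape_cells w)"
      using assms(3) unfolding compatible_tableau_def w by blast
    fix x assume x: "x \<in> shape_cells w"
    obtain k where k: "U x = total n (A.Y k) + card {u \<in> A.B k. u \<le> fst x}"
      "x \<in> shape_cells (A.Y (Suc k)) - shape_cells (A.Y k)" using A.U_unique[OF x] .
    then have "psum p k < U' x" "U' x \<le> psum p (Suc k)" unfolding e A'.block by auto
    moreover have "x \<in> shape_cells w'" using x w by simp
    ultimately have "U' x = psum p k + card {u \<in> A'.B k. u \<le> fst x}" using A'.U_eq(1) by blast
    then show "U x = U' x" using k(1)[unfolded e A'.total_Y] by simp
  qed
  then show ?thesis using w by simp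
qed

section \<open>From chains back to tableaux\<close>

lemma chain_cells_mono:
  assumes "Y \<in> concave_chains n" "j \<le> k"
  shows "shape_cells (Y j) \<subseteq> shape_cells (Y k)"
  by (rule shape_cells_mono) (rule chain_mono[OF assms])

lemma chain_total_mono:
  assumes "Y \<in> concave_chains n" "j \<le> k"
  shows "total n (Y j) \<le> total n (Y k)"
  unfolding total_def by (rule sum_mono) (rule chain_mono[OF assms])

lemma chain_card_cells:
  assumes "Y \<in> concave_chains n"
  shows "card (shape_cells (Y k)) = total n (Y k)" "finite (shape_cells (Y k))"
  using card_shape_cells[of n "Y k"] finite_shape_cells[of n "Y k"] chain_empty_row[OF assms, of _ k] by simp_all

lemma chain_card_new_rows:
  assumes "Y \<in> concave_chains n"
  shows "total n (Y (Suc k)) = total n (Y k) + card (new_rows (Y k) (Y (Suc k)))"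
proof -
  have "card (shape_cells (Y (Suc k)) - shape_cells (Y k)) = card (new_rows (Y k) (Y (Suc k)))"
    unfolding vstrip_new_cells[OF concave_chainsD(3)[OF assms]] by (simp add: card_image inj_on_def)
  moreover have "shape_cells (Y k) \<subseteq> shape_cells (Y (Suc k))" by (rule chain_cells_mono[OF assms]) simp
  ultimately show ?thesis
    using card_Diff_subset[OF chain_card_cells(2)[OF assms], of k "shape_cells (Y (Suc k))"]
      chain_card_cells(1)[OF assms] chain_total_mono[OF assms, of k "Suc k"] by simp
qed

text \<open>The cells are numbered block by block, and inside a block from top to bottom.\<close>

lemma chain_tableau:
  assumes Y: "Y \<in> concave_chains n"
  defines "p \<equiv> block_size n Y"
  obtains U where "compatible_tableau n p (Y n) U" "level_chain p (Y n) U = Y"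
proof -
  define S where "S = shape_cells (Y n)"
  define B where "B k = new_rows (Y k) (Y (Suc k))" for k
  \<comment> \<open>The value is one less than the number of the block: \<open>x\<close> is new in
    \<open>Y (Suc (blk x))\<close>.\<close>
  define blk where "blk x = (LEAST k. x \<in> shape_cells (Y (Suc k)))" for x
  define U where "U x = (if x \<in> S then total n (Y (blk x)) + card {u \<in> B (blk x). u \<le> fst x} else undefined)"
    for x
  have psum: "psum p k = total n (Y k)" for k unfolding p_def by (rule psum_block_size[OF Y])
  have finB: "finite (B k)" for k unfolding B_def by (rule finite_new_rows[OF concave_chainsD(2)[OF Y]])
  have empty: "shape_cells (Y 0) = {}" using concave_chainsD(1)[OF Y] by (auto simp: shape_cells_def)
  have cellsS: "shape_cells (Y k) \<subseteq> S" for k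
    using chain_cells_mono[OF Y, of k n] concave_chainsD(5)[OF Y, of k] unfolding S_def by (cases "k \<le> n") auto
  have blk: "x \<in> shape_cells (Y (Suc (blk x)))" "x \<notin> shape_cells (Y (blk x))" if "x \<in> S" for x
  proof -
    have "n \<noteq> 0" using that empty unfolding S_def by (cases n) auto
    then have "x \<in> shape_cells (Y (Suc (n - 1)))" using that by (simp add: S_def)
    then show "x \<in> shape_cells (Y (Suc (blk x)))" unfolding blk_def by (rule LeastI)
    show "x \<notin> shape_cells (Y (blk x))"
    proof (cases "blk x")
      case 0
      then show ?thesis using empty by simp
    next
      case (Suc j)
      then show ?thesis using not_less_Least[of j "\<lambda>k. x \<in> shape_cells (Y (Suc k))"] unfolding blk_def by simp
    qed
  qed
  have cells_iff: "x \<in> shape_cells (Y k) \<longleftrightarrow> blk x < k" if "x \<in> S" for x k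
    using blk[OF that] chain_cells_mono[OF Y, of k "blk x"] chain_cells_mono[OF Y, of "Suc (blk x)" k]
    by (cases "blk x < k") auto
  have inB: "fst x \<in> B (blk x)" "snd x = fst x + Y (blk x) (fst x)" if "x \<in> S" for x
  proof -
    have "x \<in> shape_cells (Y (Suc (blk x))) - shape_cells (Y (blk x))" using blk[OF that] by blast
    then obtain u where u: "x = (u, u + Y (blk x) u)" "u \<in> B (blk x)"
      unfolding vstrip_new_cells[OF concave_chainsD(3)[OF Y]] B_def by blast
    have "fst x = u" "snd x = u + Y (blk x) u" using arg_cong[OF u(1), of fst] arg_cong[OF u(1), of snd] by simp_all
    then show "fst x \<in> B (blk x)" "snd x = fst x + Y (blk x) (fst x)" using u(2) by simp_all
  qed
  have U_eq: "U x = total n (Y (blk x)) + card {u \<in> B (blk x). u \<le> fst x}" if "x \<in> S" for x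
    using that by (simp add: U_def)
  have U_lo: "total n (Y (blk x)) < U x" if "x \<in> S" for x
  proof -
    have "{u \<in> B (blk x). u \<le> fst x} \<noteq> {}" using inB(1)[OF that] by auto
    then show ?thesis using U_eq[OF that] finB by (simp add: card_gt_0_iff)
  qed
  have U_hi: "U x + card {u \<in> B (blk x). fst x < u} = total n (Y (Suc (blk x)))" if "x \<in> S" for x
  proof -
    have "B (blk x) = {u \<in> B (blk x). u \<le> fst x} \<union> {u \<in> B (blk x). fst x < u}" by auto
    then have "card (B (blk x)) = card {u \<in> B (blk x). u \<le> fst x} + card {u \<in> B (blk x). fst x < u}"
      using finB[of "blk x"] by (subst card_Un_disjoint[symmetric]) auto
    then show ?thesis using U_eq[OF that] chain_card_new_rows[OF Y, of "blk x"] by (simp add: B_def)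
  qed
  have U_le: "U x \<le> total n (Y k) \<longleftrightarrow> blk x < k" if "x \<in> S" for x k
  proof
    assume "blk x < k"
    then show "U x \<le> total n (Y k)" using U_hi[OF that] chain_total_mono[OF Y, of "Suc (blk x)" k] by simp
  next
    assume "U x \<le> total n (Y k)"
    then show "blk x < k" using U_lo[OF that] chain_total_mono[OF Y, of k "blk x"] by (cases "blk x < k") auto
  qed
  have less1: "U x < U y" if "x \<in> S" "y \<in> S" "blk x < blk y" for x y
    using U_le[OF that(1), of "blk y"] U_lo[OF that(2)] that(3) by simp
  have less2: "U x < U y" if "x \<in> S" "y \<in> S" "blk x = blk y" "fst x < fst y" for x y
  proof -
    have "fst y \<in> {u \<in> B (blk x). u \<le> fst y}" "fst y \<notin> {u \<in> B (blk x). u \<le> fst x}"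
      using inB(1)[OF that(2)] that(3,4) by simp_all
    moreover have "{u \<in> B (blk x). u \<le> fst x} \<subseteq> {u \<in> B (blk x). u \<le> fst y}" using that(4) by auto
    ultimately have "{u \<in> B (blk x). u \<le> fst x} \<subset> {u \<in> B (blk x). u \<le> fst y}" by blast
    from psubset_card_mono[OF _ this] finB show ?thesis using U_eq that by simp
  qed
  have inj: "inj_on U S"
  proof (rule inj_onI)
    fix x y assume xy: "x \<in> S" "y \<in> S" "U x = U y"
    have b: "blk x = blk y" using less1[OF xy(1,2)] less1[OF xy(2,1)] xy(3) by (metis less_irrefl linorder_neqE_nat)
    then have "fst x = fst y" using less2[OF xy(1,2)] less2[OF xy(2,1)] xy(3) by (metis less_irrefl linorder_neqE_nat)
    then show "x = y" using inB(2)[OF xy(1)] inB(2)[OF xy(2)] b by (simp add: prod_eq_iff)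
  qed
  have range: "U ` S \<subseteq> {1..total n (Y n)}"
  proof
    fix i assume "i \<in> U ` S"
    then obtain x where x: "x \<in> S" "i = U x" by blast
    have "blk x < n" using cells_iff[OF x(1), of n] x(1) by (simp add: S_def)
    then show "i \<in> {1..total n (Y n)}" using U_le[OF x(1), of n] U_lo[OF x(1)] x(2) by simp
  qed
  have "card (U ` S) = total n (Y n)"
    using card_image[OF inj] chain_card_cells(1)[OF Y, of n] by (simp add: S_def)
  then have "U ` S = {1..total n (Y n)}" using card_subset_eq[OF _ range] by simp
  then have bij: "bij_betw U S {1..total n (Y n)}" using inj by (simp add: bij_betw_def)
  have row: "U (r, c) < U (r, c')" if "(r, c) \<in> S" "(r, c') \<in> S" "c < c'" for r c c'
  proof -
    have "(r, c) \<in> shape_cells (Y (blk (r, c')))"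
      using inB(2)[OF that(2)] that(1,3) by (auto simp: shape_cells_def S_def)
    then show ?thesis using cells_iff[OF that(1)] less1[OF that(1,2)] by blast
  qed
  have col: "U (r, c) < U (r', c)" if "(r, c) \<in> S" "(r', c) \<in> S" "r < r'" for r r' c
  proof -
    have "(r, c) \<in> shape_cells (Y (Suc (blk (r', c))))"
      using shape_cells_up[OF concave_chainsD(2)[OF Y] blk(1)[OF that(2)]] that(3) by simp
    then have "blk (r, c) \<le> blk (r', c)" using cells_iff[OF that(1)] by (simp add: less_Suc_eq_le)
    then show ?thesis using less1[OF that(1,2)] less2[OF that(1,2)] that(3) by (auto simp: le_less)
  qed
  have block: "blk x = k" if "x \<in> S" "total n (Y k) < U x" "U x \<le> total n (Y (Suc k))" for x k
    using U_le[OF that(1), of k] U_le[OF that(1), of "Suc k"] that by linarith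
  have desc: "fst x < fst y"
    if "x \<in> S" "y \<in> S" "psum p k < U x" "U y = Suc (U x)" "U y \<le> psum p (Suc k)" for x y k
  proof -
    have b: "blk x = k" "blk y = k" using block that unfolding psum by auto
    have "x \<noteq> y" using that(4) by auto
    then have "fst x \<noteq> fst y" using inB(2)[OF that(1)] inB(2)[OF that(2)] b by (auto simp: prod_eq_iff)
    moreover have "\<not> fst y < fst x" using less2[OF that(2,1)] b that(4) by auto
    ultimately show ?thesis by simp
  qed
  have asc: "fst y \<le> fst x"
    if t: "1 \<le> t" "t < p (Suc k)" and x: "x \<in> S" "U x = Suc (psum p k - t)"
      and y: "y \<in> S" "U y = psum p (Suc k) - t" for t k x y
  proof (rule ccontr)
    \<comment> \<open>If \<open>y\<close> were strictly below \<open>x\<close>, block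
      \<open>Suc k\<close> would have \<open>t + 1\<close> cells from the row of \<open>y\<close>
      on, and block \<open>k\<close> at most the \<open>t - 1\<close> cells below \<open>x\<close>;
      concavity allows a surplus of only one.\<close>
    assume h: "\<not> fst y \<le> fst x"
    have by': "blk y = k" by (rule block[OF y(1)]) (use t y(2) in \<open>auto simp: psum[symmetric] psum_Suc\<close>)
    have pk: "p (Suc k) \<le> Suc (p k)" unfolding p_def by (rule block_size_concave[OF Y])
    have "k \<noteq> 0"
    proof
      assume "k = 0"
      then show False using t pk by (simp add: p_def block_size_0)
    qed
    then obtain j where j: "k = Suc j" by (cases k) auto
    have tp: "t \<le> p (Suc j)" using t pk j by simp
    have bx: "blk x = j" by (rule block[OF x(1)]) (use t tp x(2) j in \<open>auto simp: psum[symmetric] psum_Suc\<close>)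
    have "card {u \<in> B k. fst y < u} = t" using U_hi[OF y(1)] y(2) t by' by (simp add: psum[symmetric] psum_Suc)
    moreover have "{u \<in> B k. fst y \<le> u} = insert (fst y) {u \<in> B k. fst y < u}"
      using inB(1)[OF y(1)] by' by auto
    ultimately have c1: "card {u \<in> B k. fst y \<le> u} = Suc t" using finB[of k] by simp
    have c2: "Suc (card {u \<in> B j. fst x < u}) = t"
      using U_hi[OF x(1)] x(2) t tp bx j by (simp add: psum[symmetric] psum_Suc)
    have "card {u \<in> B j. fst y \<le> u} \<le> card {u \<in> B j. fst x < u}"
      by (rule card_mono) (use finB h in auto)
    moreover have rows: "{u\<in>{..<Suc n}. Y (Suc i) u = Suc (Y i u) \<and> s \<le> u} = {u \<in> B i. s \<le> u}" for i s
      using chain_empty_row[OF Y, of _ "Suc i"] unfolding B_def new_rows_def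
      by (auto simp: less_Suc_eq_le) (metis le_SucI nat_le_linear nat.distinct(1))
    have "card {u \<in> B k. fst y \<le> u} \<le> Suc (card {u \<in> B j. fst y \<le> u})"
      using row_concave_iff_card[OF concave_chainsD(3)[OF Y, of j] concave_chainsD(3)[OF Y, of "Suc j"], of "Suc n"]
        concave_chainsD(4)[OF Y, of "Suc j"] unfolding rows j by simp
    ultimately show False using c1 c2 by simp
  qed
  have "compatible_tableau n p (Y n) U"
    unfolding compatible_tableau_def S_def[symmetric]
  proof (intro conjI)
    show "strict_shape (Y n)" by (rule concave_chainsD(2)[OF Y])
    show "U \<in> extensional S" by (simp add: extensional_def U_def)
    show "bij_betw U S {1..psum p n}" using bij unfolding psum .
  qed (use row in blast, use col in blast, use desc in blast, use asc in blast)
  moreover have "level_chain p (Y n) U = Y"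
  proof (intro ext)
    fix k s
    have "{c. (s, c) \<in> S \<and> U (s, c) \<le> psum p k} = {c. (s, c) \<in> shape_cells (Y k)}"
      using cells_iff U_le cellsS[of k] unfolding psum by blast
    also have "\<dots> = {s..<s + Y k s}" by (auto simp: shape_cells_def)
    finally show "level_chain p (Y n) U k s = Y k s" by (simp add: level_chain_def S_def)
  qed
  ultimately show ?thesis using that by blast
qed

section \<open>Translation between lists of parts and shapes\<close>

definition parts :: "nat list \<Rightarrow> nat \<Rightarrow> nat" where
  "parts l s = (if s < length l then l ! s else 0)"

definition block_sizes :: "nat \<Rightarrow> nat list \<Rightarrow> nat \<Rightarrow> nat" where
  "block_sizes n \<mu> k = (if k \<le> n then k - parts \<mu> (n - k) else 0)"

lemma length_staircase: "length (staircase n) = n"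
  by (simp add: staircase_def)

lemma nth_staircase: "r < n \<Longrightarrow> staircase n ! r = n - r"
  unfolding staircase_def by (simp add: rev_nth del: upt_Suc)

lemma skew_diagram_staircase: "skew_diagram (staircase n) \<mu> = staircase_cells n (block_sizes n \<mu>)"
proof (rule set_eqI)
  fix x :: cell
  obtain r c where x: "x = (r, c)" by (cases x)
  show "x \<in> skew_diagram (staircase n) \<mu> \<longleftrightarrow> x \<in> staircase_cells n (block_sizes n \<mu>)"
  proof (cases "r < n")
    case True
    then have "n - (n - r) = r" by simp
    then show ?thesis
      using True
      by (auto simp: x skew_diagram_def diagram_def length_staircase nth_staircase staircase_cells_def
          block_sizes_def parts_def)
  qed (auto simp: x skew_diagram_def diagram_def length_staircase staircase_cells_def)
qed

lemma inner_partition_block_sizes: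
  assumes "is_partition \<mu>"
  shows "inner_partition n (block_sizes n \<mu>)"
  unfolding inner_partition_def block_vector_def
proof (intro conjI allI impI)
  fix k
  show "block_sizes n \<mu> (Suc k) \<le> Suc (block_sizes n \<mu> k)"
  proof (cases "Suc k \<le> n")
    case True
    have "parts \<mu> (n - k) \<le> parts \<mu> (n - Suc k)"
      using assms True unfolding parts_def is_partition_def by (auto simp: sorted_wrt_iff_nth_less)
    then show ?thesis using True by (simp add: block_sizes_def)
  qed (simp add: block_sizes_def)
qed (simp_all add: block_sizes_def)

lemma card_diagram: "card (diagram l) = sum_list l"
proof -
  have "diagram l = (SIGMA r:{..<length l}. {..<l ! r})" by (auto simp: diagram_def)
  then show ?thesis by (simp add: card_SigmaI sum_list_sum_nth atLeast0LessThan)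
qed

lemma psum_total: "psum p n = total n p"
  by (simp add: psum_def total_def)

lemma size_skew:
  assumes "is_partition \<mu>" "diagram \<mu> \<subseteq> diagram (staircase n)"
  shows "sum_list (staircase n) - sum_list \<mu> = psum (block_sizes n \<mu>) n"
proof -
  have "card (skew_diagram (staircase n) \<mu>) = sum_list (staircase n) - sum_list \<mu>"
    unfolding skew_diagram_def using card_Diff_subset[OF finite_diagram assms(2)] by (simp add: card_diagram)
  then show ?thesis
    using card_staircase_cells[OF inner_partition_block_sizes[OF assms(1)]]
    by (simp add: skew_diagram_staircase psum_total)
qed

lemma shifted_diagram_cells: "shifted_diagram l = shape_cells (parts l)"
  by (auto simp: shifted_diagram_def shape_cells_def parts_def split: if_splits)

lemma parts_strict:
  assumes "strict_partition l"
  shows "strict_shape (parts l)"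
  unfolding strict_shape_def
proof
  fix s
  show "parts l (Suc s) < parts l s \<or> parts l (Suc s) = 0"
    using sorted_wrt_nth_less[of "(>)" l s "Suc s"] assms
    by (cases "Suc s < length l") (simp_all add: parts_def strict_partition_def)
qed

lemma parts_inj:
  assumes "strict_partition l" "strict_partition l'" "parts l = parts l'"
  shows "l = l'"
proof -
  have pos: "s < length l \<longleftrightarrow> 0 < parts l s" if "strict_partition l" for s l
    using that nth_mem[of s l] by (cases "l ! s") (auto simp: strict_partition_def parts_def)
  have "s < length l \<longleftrightarrow> s < length l'" for s
    unfolding pos[OF assms(1)] pos[OF assms(2)] assms(3) ..
  from this[of "length l"] this[of "length l'"] have "length l = length l'" by simp
  then show ?thesis
  proof (rule nth_equalityI)
    fix s assume "s < length l"
    then show "l ! s = l' ! s"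
      using fun_cong[OF assms(3), of s] \<open>length l = length l'\<close> by (simp add: parts_def)
  qed
qed

lemma parts_surj:
  assumes "strict_shape w"
  obtains l where "strict_partition l" "parts l = w"
proof -
  define N where "N = (LEAST s. w s = 0)"
  have "w (w 0) = 0" using strict_shape_support[OF assms] by simp
  then have N: "w N = 0" unfolding N_def by (rule LeastI)
  have pos: "0 < w s" if "s < N" for s using not_less_Least[of s "\<lambda>s. w s = 0"] that unfolding N_def by simp
  define l where "l = map w [0..<N]"
  have "strict_partition l"
    unfolding strict_partition_def
  proof
    show "sorted_wrt (>) l"
      unfolding l_def sorted_wrt_iff_nth_less using pos strict_shape_less(2)[OF assms] by simp
    show "0 \<notin> set l" using pos unfolding l_def by fastforce
  qed
  moreover have "parts l = w"
  proof
    fix s show "parts l s = w s"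
      using strict_shape_zero[OF assms _ N, of s] by (auto simp: parts_def l_def)
  qed
  ultimately show ?thesis using that by blast
qed

lemma sum_list_parts: "sum_list l = card (shape_cells (parts l))"
proof -
  have "shape_cells (parts l) = (SIGMA r:{..<length l}. {r..<r + l ! r})"
    by (auto simp: shape_cells_def parts_def split: if_splits)
  then show ?thesis by (simp add: card_SigmaI sum_list_sum_nth atLeast0LessThan)
qed

text \<open>The rows below contribute \<open>psum\<close> of the first \<open>k\<close> blocks, and
  the row itself its cells from column \<open>Suc k\<close> minus its block size up to
  \<open>c\<close>. \<open>Suc k\<close> is moved to the left to avoid truncated
  subtraction.\<close>

lemma standard_filling_eq:
  assumes ip: "inner_partition n (block_sizes n \<mu>)"
    and k: "Suc k \<le> n" and c: "(n - Suc k, c) \<in> staircase_cells n (block_sizes n \<mu>)"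
  shows "standard_filling (staircase n) \<mu> (n - Suc k, c) + Suc k =
    psum (block_sizes n \<mu>) k + c + block_sizes n \<mu> (Suc k) + 1"
proof -
  let ?p = "block_sizes n \<mu>" and ?r = "n - Suc k"
  let ?S = "staircase_cells n ?p"
  let ?A = "SIGMA r:{?r<..<n}. {n - r - ?p (n - r)..<n - r}" and ?B = "{?r} \<times> {Suc k - ?p (Suc k)..c}"
  have le: "?p j \<le> j" for j by (rule inner_partition_le[OF ip])
  have nr: "n - ?r = Suc k" using k by simp
  have ck: "Suc k \<le> c + ?p (Suc k)" "c < Suc k" using c nr by (auto simp: staircase_cells_def)
  have "{(r', c') \<in> ?S. ?r < r' \<or> r' = ?r \<and> c' \<le> c} = ?A \<union> ?B"
    using k nr ck unfolding staircase_cells_def by auto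
  moreover have "card (?A \<union> ?B) = card ?A + card ?B" by (rule card_Un_disjoint) auto
  moreover have "card ?A = psum ?p k"
  proof -
    have "card {n - r - ?p (n - r)..<n - r} = ?p (n - r)" for r
      unfolding card_atLeastLessThan using le by (rule diff_diff_cancel)
    then have "card ?A = (\<Sum>r\<in>{?r<..<n}. ?p (n - r))" by (subst card_SigmaI) auto
    also have "\<dots> = (\<Sum>j\<in>{1..k}. ?p j)"
      by (rule sum.reindex_bij_witness[of _ "\<lambda>j. n - j" "\<lambda>r. n - r"]) (use k in auto)
    also have "\<dots> = psum ?p k"
      unfolding psum_def by (rule sum.mono_neutral_left) (auto simp: block_sizes_def)
    finally show ?thesis .
  qed
  moreover have "card ?B + Suc k = c + ?p (Suc k) + 1" using ck le[of "Suc k"] by simp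
  ultimately show ?thesis by (simp add: standard_filling_def skew_diagram_staircase)
qed

text \<open>In a standard tableau the columns follow from the rows: \<open>i + 1\<close> strictly
  south of \<open>i\<close> is automatically weakly west, and \<open>j > i\<close> weakly north of
  \<open>i\<close> is automatically strictly east. So ascents and descents reduce to comparisons of
  rows.\<close>

lemma CompShSYT_iff:
  assumes "is_partition \<mu>" "diagram \<mu> \<subseteq> diagram (staircase n)"
  shows "(\<nu>, U) \<in> CompShSYT (staircase n) \<mu> \<longleftrightarrow>
    strict_partition \<nu> \<and> compatible_tableau n (block_sizes n \<mu>) (parts \<nu>) U"
proof -
  let ?p = "block_sizes n \<mu>" and ?S = "shape_cells (parts \<nu>)" and ?D = "staircase_cells n (block_sizes n \<mu>)"
  let ?f = "standard_filling (staircase n) \<mu>"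
  define R where "R \<longleftrightarrow> (\<forall>r c c'. (r, c) \<in> ?S \<and> (r, c') \<in> ?S \<and> c < c' \<longrightarrow> U (r, c) < U (r, c'))"
  define C where "C \<longleftrightarrow> (\<forall>r r' c. (r, c) \<in> ?S \<and> (r', c) \<in> ?S \<and> r < r' \<longrightarrow> U (r, c) < U (r', c))"
  define T where "T \<longleftrightarrow> U \<in> extensional ?S \<and> bij_betw U ?S {1..psum ?p n} \<and> R \<and> C"
  define C1 where "C1 \<longleftrightarrow> (\<forall>k x y. x \<in> ?S \<and> y \<in> ?S \<and> psum ?p k < U x \<and> U y = Suc (U x) \<and>
        U y \<le> psum ?p (Suc k) \<longrightarrow> fst x < fst y)"
  define C2 where "C2 \<longleftrightarrow> (\<forall>k t x y. 1 \<le> t \<and> t < ?p (Suc k) \<and> x \<in> ?S \<and> y \<in> ?S \<and>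
        U x = Suc (psum ?p k - t) \<and> U y = psum ?p (Suc k) - t \<longrightarrow> fst y \<le> fst x)"
  define D1 where "D1 \<longleftrightarrow> (\<forall>i r c. (r, c) \<in> ?D \<and> (r, c + 1) \<in> ?D \<and>
        ?f (r, c) = i \<and> ?f (r, c + 1) = i + 1 \<longrightarrow> descent \<nu> U i)"
  define D2 where "D2 \<longleftrightarrow> (\<forall>i j r c. (r, c) \<in> ?D \<and> (r + 1, c) \<in> ?D \<and>
        ?f (r, c) = j \<and> ?f (r + 1, c) = i \<longrightarrow> ascent_pair \<nu> U i j)"
  have tableau: "compatible_tableau n ?p (parts \<nu>) U \<longleftrightarrow> strict_shape (parts \<nu>) \<and> T \<and> C1 \<and> C2"
    unfolding compatible_tableau_def T_def R_def C_def C1_def C2_def by (simp only: conj_assoc)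
  have syt: "U \<in> shifted_SYT \<nu> \<longleftrightarrow> U \<in> extensional ?S \<and> bij_betw U ?S {1..sum_list \<nu>} \<and> R \<and> C"
    unfolding shifted_SYT_def shifted_diagram_cells R_def C_def by (simp only: mem_Collect_eq)
  have size: "sum_list \<nu> = psum ?p n" if T
    using that bij_betw_same_card[of U ?S "{1..psum ?p n}"] by (simp add: T_def sum_list_parts)
  have "sum_list \<nu> = psum ?p n \<and> U \<in> shifted_SYT \<nu> \<longleftrightarrow> T"
  proof (cases "sum_list \<nu> = psum ?p n")
    case True
    then show ?thesis unfolding syt T_def by simp
  qed (use size in blast)
  moreover have "compatible (staircase n) \<mu> \<nu> U \<longleftrightarrow> D1 \<and> D2"
    unfolding compatible_def D1_def D2_def skew_diagram_staircase ..
  ultimately have comp: "(\<nu>, U) \<in> CompShSYT (staircase n) \<mu> \<longleftrightarrow> strict_partition \<nu> \<and> T \<and> D1 \<and> D2"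
    unfolding CompShSYT_def size_skew[OF assms] mem_Collect_eq prod.case by blast
  have "(C1 \<longleftrightarrow> D1) \<and> (C2 \<longleftrightarrow> D2)" if sp: "strict_partition \<nu>" and T
  proof -
    have ip: "inner_partition n ?p" by (rule inner_partition_block_sizes[OF assms(1)])
    have bv: "block_vector n ?p" using ip by (simp add: inner_partition_def)
    have R C and bij: "bij_betw U ?S {1..psum ?p n}" using \<open>T\<close> by (simp_all add: T_def)
    have row: "U (r, c) < U (r, c')" if "(r, c) \<in> ?S" "(r, c') \<in> ?S" "c < c'" for r c c'
      using \<open>R\<close> that unfolding R_def by blast
    have col: "U (r, c) < U (r', c)" if "(r, c) \<in> ?S" "(r', c) \<in> ?S" "r < r'" for r r' c
      using \<open>C\<close> that unfolding C_def by blast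
    have st: "strict_shape (parts \<nu>)" by (rule parts_strict[OF sp])
    have inj: "x = y" if "x \<in> ?S" "y \<in> ?S" "U x = U y" for x y
      using bij_betw_imp_inj_on[OF bij] that by (auto dest: inj_onD)
    have surj: "\<exists>x\<in>?S. U x = i" if "1 \<le> i" "i \<le> psum ?p n" for i
      using bij that unfolding bij_betw_def by (metis atLeastAtMost_iff imageE)
    have weak: "U (r, c) \<le> U (r', c')" if "(r, c) \<in> ?S" "(r', c') \<in> ?S" "r \<le> r'" "c \<le> c'" for r c r' c'
    proof -
      have m: "(r, c') \<in> ?S" using shape_cells_up[OF st that(2,3)] .
      have "U (r, c) \<le> U (r, c')" using row[OF that(1) m] that(4) by (cases "c = c'") auto
      moreover have "U (r, c') \<le> U (r', c')" using col[OF m that(2)] that(3) by (cases "r = r'") auto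
      ultimately show ?thesis by simp
    qed
    have desc: "descent \<nu> U i \<longleftrightarrow> (\<exists>x\<in>?S. \<exists>y\<in>?S. U x = i \<and> U y = Suc i \<and> fst x < fst y)" for i
    proof
      assume "\<exists>x\<in>?S. \<exists>y\<in>?S. U x = i \<and> U y = Suc i \<and> fst x < fst y"
      then obtain r c r' c' where h: "(r, c) \<in> ?S" "(r', c') \<in> ?S" "U (r, c) = i" "U (r', c') = Suc i" "r < r'"
        by (metis prod.collapse)
      have "c' \<le> c"
      proof (rule ccontr)
        assume "\<not> c' \<le> c"
        have m: "(r, c') \<in> ?S" using shape_cells_up[OF st h(2)] h(5) by simp
        have "U (r, c) < U (r, c')" "U (r, c') < U (r', c')"
          using row[OF h(1) m] col[OF m h(2,5)] \<open>\<not> c' \<le> c\<close> by auto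
        then show False using h(3,4) by simp
      qed
      then show "descent \<nu> U i"
        unfolding descent_def descent_pair_def shifted_diagram_cells using h by auto
    next
      assume "descent \<nu> U i"
      then show "\<exists>x\<in>?S. \<exists>y\<in>?S. U x = i \<and> U y = Suc i \<and> fst x < fst y"
        unfolding descent_def descent_pair_def shifted_diagram_cells by fastforce
    qed
    have asc: "ascent_pair \<nu> U i j \<longleftrightarrow> (\<exists>x\<in>?S. \<exists>y\<in>?S. U x = i \<and> U y = j \<and> fst y \<le> fst x)" if "i < j" for i j
    proof
      assume "\<exists>x\<in>?S. \<exists>y\<in>?S. U x = i \<and> U y = j \<and> fst y \<le> fst x"
      then obtain r c r' c' where h: "(r, c) \<in> ?S" "(r', c') \<in> ?S" "U (r, c) = i" "U (r', c') = j" "r' \<le> r"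
        by (metis prod.collapse)
      have "c < c'" using weak[OF h(2,1,5)] h(3,4) that by (cases "c < c'") auto
      then show "ascent_pair \<nu> U i j"
        unfolding ascent_pair_def shifted_diagram_cells using h that by blast
    next
      assume "ascent_pair \<nu> U i j"
      then show "\<exists>x\<in>?S. \<exists>y\<in>?S. U x = i \<and> U y = j \<and> fst y \<le> fst x"
        unfolding ascent_pair_def shifted_diagram_cells by fastforce
    qed
    have inD: "(n - Suc k, c) \<in> ?D \<longleftrightarrow> Suc k \<le> c + ?p (Suc k) \<and> c < Suc k" if "Suc k \<le> n" for k c
      by (subst staircase_cells_iff[OF ip _ that]) (simp_all add: le_diff_conv)
    have f: "?f (n - Suc k, c) + Suc k = psum ?p k + c + ?p (Suc k) + 1"
      if "Suc k \<le> n" "(n - Suc k, c) \<in> ?D" for k c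
      by (rule standard_filling_eq[OF ip that])
    have psum_le: "psum ?p k \<le> psum ?p n" for k
      using psum_mono[of k n ?p] psum_stationary[OF bv, of k] by (cases "k \<le> n") auto
    have ple: "?p k \<le> k" "?p (Suc k) \<le> Suc (?p k)" for k
      using inner_partition_le[OF ip, of k] ip unfolding inner_partition_def by blast+
    have row_index: "\<exists>k. r = n - Suc k \<and> Suc k \<le> n" if "(r, c) \<in> ?D" for r c
      using that by (intro exI[of _ "n - Suc r"]) (auto simp: staircase_cells_def)
    have 1: "C1 \<longleftrightarrow> D1"
    proof
      assume C1
      show D1
        unfolding D1_def
      proof (intro allI impI)
        fix i r c assume h: "(r, c) \<in> ?D \<and> (r, c + 1) \<in> ?D \<and> ?f (r, c) = i \<and> ?f (r, c + 1) = i + 1"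
        obtain k where k: "r = n - Suc k" "Suc k \<le> n" using row_index h by blast
        have c: "Suc k \<le> c + ?p (Suc k)" "c + 1 < Suc k" using inD[OF k(2)] h k(1) by auto
        have i: "i + Suc k = psum ?p k + c + ?p (Suc k) + 1" using f[OF k(2)] h k(1) by auto
        have b: "psum ?p k < i" "Suc i \<le> psum ?p (Suc k)" using i c by (auto simp: psum_Suc)
        obtain x y where xy: "x \<in> ?S" "U x = i" "y \<in> ?S" "U y = Suc i"
          using surj[of i] surj[of "Suc i"] b psum_le[of "Suc k"] by fastforce
        then have "fst x < fst y" using \<open>C1\<close> b unfolding C1_def by metis
        then show "descent \<nu> U i" unfolding desc using xy by blast
      qed
    next
      assume D1
      show C1
        unfolding C1_def
      proof (intro allI impI)
        fix k x y assume h: "x \<in> ?S \<and> y \<in> ?S \<and> psum ?p k < U x \<and> U y = Suc (U x) \<and> U y \<le> psum ?p (Suc k)"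
        have k: "Suc k \<le> n"
        proof (rule ccontr)
          assume "\<not> Suc k \<le> n"
          then have "?p (Suc k) = 0" by (simp add: block_sizes_def)
          then show False using h psum_Suc[of ?p k] by linarith
        qed
        define c where "c = U x - psum ?p k - 1 + (Suc k - ?p (Suc k))"
        have c: "c + ?p (Suc k) + psum ?p k + 1 = U x + Suc k" using h ple(1)[of "Suc k"] by (auto simp: c_def)
        have cD: "(n - Suc k, c) \<in> ?D" "(n - Suc k, c + 1) \<in> ?D"
          using c h unfolding inD[OF k] by (auto simp: psum_Suc)
        have "?f (n - Suc k, c) = U x" "?f (n - Suc k, c + 1) = U x + 1"
          using f[OF k cD(1)] f[OF k cD(2)] c by auto
        then have "descent \<nu> U (U x)" using \<open>D1\<close> cD unfolding D1_def by blast
        then obtain x' y' where "x' \<in> ?S" "y' \<in> ?S" "U x' = U x" "U y' = Suc (U x)" "fst x' < fst y'"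
          unfolding desc by blast
        then show "fst x < fst y" using inj[of x' x] inj[of y' y] h by simp
      qed
    qed
    have 2: "C2 \<longleftrightarrow> D2"
    proof
      assume C2
      show D2
        unfolding D2_def
      proof (intro allI impI)
        fix i j r c assume h: "(r, c) \<in> ?D \<and> (r + 1, c) \<in> ?D \<and> ?f (r, c) = j \<and> ?f (r + 1, c) = i"
        obtain k' where k': "r + 1 = n - Suc k'" "Suc k' \<le> n" using row_index h by blast
        then have k: "r = n - Suc (Suc k')" "Suc (Suc k') \<le> n" by auto
        have c: "Suc (Suc k') \<le> c + ?p (Suc (Suc k'))" "c < Suc k'"
          using inD[OF k(2)] inD[OF k'(2)] h k(1) k'(1) by auto
        have j: "j + Suc (Suc k') = psum ?p (Suc k') + c + ?p (Suc (Suc k')) + 1" using f[OF k(2)] h k(1) by auto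
        have i: "i + Suc k' = psum ?p k' + c + ?p (Suc k') + 1" using f[OF k'(2)] h k'(1) by auto
        \<comment> \<open>\<open>t\<close> counts the cells to the right of column \<open>c\<close>
          in the upper of the two rows. The lower row ends one column earlier and has
          \<open>t - 1\<close> such cells, whence the \<open>Suc\<close> in the formula for
          \<open>i\<close>.\<close>
        define t where "t = Suc k' - c"
        have t: "1 \<le> t" "t < ?p (Suc (Suc k'))" using c by (auto simp: t_def)
        have tp: "t \<le> ?p (Suc k')" using t ple(2)[of "Suc k'"] by simp
        have e: "i = Suc (psum ?p (Suc k') - t)" "j = psum ?p (Suc (Suc k')) - t"
          using i j c tp by (auto simp: t_def psum_Suc)
        have b: "1 \<le> i" "i < j" "j \<le> psum ?p (Suc (Suc k'))" using e t tp by (auto simp: psum_Suc)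
        obtain x y where xy: "x \<in> ?S" "U x = i" "y \<in> ?S" "U y = j"
          using surj[of i] surj[of j] b psum_le[of "Suc (Suc k')"] by fastforce
        then have "fst y \<le> fst x" using \<open>C2\<close> t e unfolding C2_def by metis
        then show "ascent_pair \<nu> U i j" unfolding asc[OF b(2)] using xy by blast
      qed
    next
      assume D2
      show C2
        unfolding C2_def
      proof (intro allI impI)
        fix k t x y assume h: "1 \<le> t \<and> t < ?p (Suc k) \<and> x \<in> ?S \<and> y \<in> ?S \<and>
          U x = Suc (psum ?p k - t) \<and> U y = psum ?p (Suc k) - t"
        have k: "Suc k \<le> n" using h by (cases "Suc k \<le> n") (auto simp: block_sizes_def)
        have tp: "t \<le> ?p k" "?p k \<le> k" using h ple(2)[of k] ple(1)[of k] by auto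
        then obtain j where j: "k = Suc j" using h by (cases k) auto
        define c where "c = k - t"
        have c: "c + t = k" using tp by (simp add: c_def)
        have jn: "Suc j \<le> n" using k j by simp
        have cD: "(n - Suc k, c) \<in> ?D" "(n - Suc j, c) \<in> ?D"
          unfolding inD[OF k] inD[OF jn] using c h tp j by auto
        have r: "n - Suc k + 1 = n - Suc j" using k j by simp
        have "?f (n - Suc k, c) = U y" "?f (n - Suc j, c) = U x"
          using f[OF k cD(1)] f[OF jn cD(2)] c h tp j by (auto simp: psum_Suc)
        then have "ascent_pair \<nu> U (U x) (U y)" using \<open>D2\<close> cD r unfolding D2_def by metis
        moreover have "U x < U y" using h tp by (auto simp: psum_Suc j)
        ultimately obtain x' y' where "x' \<in> ?S" "y' \<in> ?S" "U x' = U x" "U y' = U y" "fst y' \<le> fst x'"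
          using asc by blast
        then show "fst y \<le> fst x" using inj[of x' x] inj[of y' y] h by simp
      qed
    qed
    show ?thesis using 1 2 by blast
  qed
  then show ?thesis unfolding tableau comp using parts_strict by blast
qed

section \<open>Comparison of coefficients\<close>

lemma schur_P_coefficient:
  assumes "strict_partition \<nu>" "\<And>u. n < u \<Longrightarrow> parts \<nu> u = 0" "set_mset m \<subseteq> {0<..K}"
  shows "schur_P \<nu> m = int (marked_count n (rev (map (count m) [1..<Suc K])) (parts \<nu>))"
proof -
  let ?c = "\<lambda>T. image_mset (\<lambda>x. letter_index (T x)) (mset_set (shape_cells (parts \<nu>)))"
  have "{T \<in> shifted_SSYT \<nu>. ?c T = m} = shifted_fillings (parts \<nu>) (2 * K + 2) (\<lambda>M. M = m)"
  proof (rule set_eqI)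
    fix T
    have bound: "letter_code (T x) < 2 * K + 2" if "x \<in> shape_cells (parts \<nu>)" "?c T = m" for x
    proof -
      have "letter_index (T x) \<in># ?c T" using that(1) finite_shape_cells[of n "parts \<nu>"] assms(2) by auto
      then have "letter_index (T x) \<le> K" using that(2) assms(3) by auto
      then show ?thesis by (cases "T x") auto
    qed
    show "T \<in> {T \<in> shifted_SSYT \<nu>. ?c T = m} \<longleftrightarrow>
        T \<in> shifted_fillings (parts \<nu>) (2 * K + 2) (\<lambda>M. M = m)"
      using bound
      unfolding shifted_SSYT_def shifted_fillings_def marked_semistandard_def shifted_diagram_cells PiE_iff
      by auto
  qed
  then show ?thesis
    using card_shifted_fillings[OF parts_strict[OF assms(1)] assms(2,3)]
    by (simp add: schur_P_def generating_series_def shifted_diagram_cells)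
qed

lemma skew_schur_coefficient:
  assumes "is_partition \<mu>" "set_mset m \<subseteq> {0<..K}"
  shows "skew_schur (staircase n) \<mu> m = int (strip_count n (map (count m) [1..<Suc K]) (block_sizes n \<mu>))"
proof -
  have e: "{1..} = {0::nat<..}" by auto
  have "{T \<in> SSYT (staircase n) \<mu>. image_mset T (mset_set (skew_diagram (staircase n) \<mu>)) = m} =
      skew_fillings n (block_sizes n \<mu>) 0 m"
    unfolding SSYT_def skew_fillings_def semistandard_def skew_diagram_staircase e by auto
  then show ?thesis
    using card_skew_fillings[OF inner_partition_block_sizes[OF assms(1)], of m 0 K n] assms(2)
    by (simp add: skew_schur_def generating_series_def)
qed

lemma skew_schur_eq:
  assumes mu: "is_partition \<mu>" "diagram \<mu> \<subseteq> diagram (staircase n)"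
  shows "skew_schur (staircase n) \<mu> = (\<Sum>(\<nu>, U)\<in>CompShSYT (staircase n) \<mu>. schur_P \<nu>)"
proof
  fix m
  let ?C = "CompShSYT (staircase n) \<mu>" and ?p = "block_sizes n \<mu>"
  have ip: "inner_partition n ?p" by (rule inner_partition_block_sizes[OF mu(1)])
  then have bv: "block_vector n ?p" by (simp add: inner_partition_def)
  have apply_sum: "(\<Sum>(\<nu>, U)\<in>?C. schur_P \<nu>) m = (\<Sum>(\<nu>, U)\<in>?C. schur_P \<nu> m)"
    using finite_CompShSYT by (induction rule: finite_induct) (auto simp: split_def)
  show "skew_schur (staircase n) \<mu> m = (\<Sum>(\<nu>, U)\<in>?C. schur_P \<nu>) m"
  proof (cases "0 \<in># m")
    \<comment> \<open>Variables are indexed from 1, so a monomial containing index 0 has coefficient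
      0 on both sides.\<close>
    case True
    have "{T \<in> SSYT (staircase n) \<mu>. image_mset T (mset_set (skew_diagram (staircase n) \<mu>)) = m} = {}"
    proof -
      have False if "T \<in> SSYT (staircase n) \<mu>" and m: "image_mset T (mset_set (skew_diagram (staircase n) \<mu>)) = m" for T
      proof -
        obtain x where "x \<in> skew_diagram (staircase n) \<mu>" "T x = 0"
          using True finite_skew_diagram[of "staircase n" \<mu>] unfolding m[symmetric] by auto
        moreover have "T x \<in> {1..}" if "x \<in> skew_diagram (staircase n) \<mu>"
          using \<open>T \<in> SSYT _ _\<close> that unfolding SSYT_def by (blast dest: PiE_mem)
        ultimately show False by simp
      qed
      then show ?thesis by blast
    qed
    then have "skew_schur (staircase n) \<mu> m = 0"
      unfolding skew_schur_def generating_series_def by (metis card.empty of_nat_0)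
    moreover have "schur_P \<nu> m = 0" for \<nu>
    proof -
      have "{T \<in> shifted_SSYT \<nu>. image_mset (\<lambda>x. letter_index (T x)) (mset_set (shifted_diagram \<nu>)) = m} = {}"
      proof -
        have False if "T \<in> shifted_SSYT \<nu>"
          and m: "image_mset (\<lambda>x. letter_index (T x)) (mset_set (shifted_diagram \<nu>)) = m" for T
        proof -
          obtain x where "x \<in> shifted_diagram \<nu>" "letter_index (T x) = 0"
            using True finite_shifted_diagram[of \<nu>] unfolding m[symmetric] by auto
          moreover have "T x \<in> {a. 1 \<le> letter_index a}" if "x \<in> shifted_diagram \<nu>"
            using \<open>T \<in> shifted_SSYT _\<close> that unfolding shifted_SSYT_def by (blast dest: PiE_mem)
          ultimately show False by simp
        qed
        then show ?thesis by blast
      qed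
      then show ?thesis unfolding schur_P_def generating_series_def by (metis card.empty of_nat_0)
    qed
    ultimately show ?thesis unfolding apply_sum by simp
  next
    case False
    \<comment> \<open>A single monomial involves finitely many variables, so finitely many letters
      suffice for both counts.\<close>
    obtain K where "\<forall>x\<in>set_mset m. x \<le> K" using finite_nat_set_iff_bounded_le[of "set_mset m"] by auto
    then have K: "set_mset m \<subseteq> {0<..K}" using False by (metis greaterThanAtMost_iff neq0_conv subsetI)
    let ?L = "map (count m) [1..<Suc K]"
    let ?Y = "{Y \<in> concave_chains n. block_size n Y = ?p}"
    define g where "g = (\<lambda>(\<nu>, U). level_chain ?p (parts \<nu>) U)"
    have gC: "g (\<nu>, U) \<in> ?Y" "g (\<nu>, U) n = parts \<nu>" if "(\<nu>, U) \<in> ?C" for \<nu> U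
    proof -
      interpret tableau_levels n ?p "parts \<nu>" U
        by unfold_locales (use that ip CompShSYT_iff[OF mu] in auto)
      show "g (\<nu>, U) \<in> ?Y" "g (\<nu>, U) n = parts \<nu>"
        using level_chain_in_chains block_size_Y Y_n by (auto simp: g_def)
    qed
    have bij: "bij_betw g ?C ?Y"
      unfolding bij_betw_def
    proof
      show "inj_on g ?C"
      proof (rule inj_onI)
        fix a b assume ab: "a \<in> ?C" "b \<in> ?C" "g a = g b"
        obtain \<nu> U \<nu>' U' where e: "a = (\<nu>, U)" "b = (\<nu>', U')" by (cases a; cases b)
        have "strict_partition \<nu>" "strict_partition \<nu>'" "compatible_tableau n ?p (parts \<nu>) U"
          "compatible_tableau n ?p (parts \<nu>') U'"
          using ab(1,2) CompShSYT_iff[OF mu] by (auto simp: e)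
        then show "a = b" using level_chain_inj[OF ip] parts_inj ab(3) by (auto simp: e g_def)
      qed
      show "g ` ?C = ?Y"
      proof (intro equalityI subsetI)
        fix Y assume "Y \<in> g ` ?C"
        then show "Y \<in> ?Y" using gC by fastforce
      next
        fix Y assume Y: "Y \<in> ?Y"
        then obtain U where U: "compatible_tableau n ?p (Y n) U" "level_chain ?p (Y n) U = Y"
          using chain_tableau[of Y n] by auto
        obtain \<nu> where \<nu>: "strict_partition \<nu>" "parts \<nu> = Y n"
          using parts_surj[OF concave_chainsD(2)] Y by blast
        then have "(\<nu>, U) \<in> ?C" "g (\<nu>, U) = Y" using U CompShSYT_iff[OF mu] by (auto simp: g_def)
        then show "Y \<in> g ` ?C" by force
      qed
    qed
    have summand: "(case a of (\<nu>, U) \<Rightarrow> schur_P \<nu> m) = int (marked_count n (rev ?L) (g a n))" if "a \<in> ?C" for a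
    proof -
      obtain \<nu> U where a: "a = (\<nu>, U)" by (cases a)
      have Y: "g a \<in> concave_chains n" "g a n = parts \<nu>" using gC that by (auto simp: a)
      have "strict_partition \<nu>" using that CompShSYT_iff[OF mu] by (simp add: a)
      moreover have "parts \<nu> u = 0" if "n < u" for u using chain_empty_row[OF Y(1), of u n] Y(2) that by simp
      ultimately show ?thesis using schur_P_coefficient[OF _ _ K] Y(2) by (simp add: a)
    qed
    have "(\<Sum>(\<nu>, U)\<in>?C. schur_P \<nu> m) = (\<Sum>a\<in>?C. int (marked_count n (rev ?L) (g a n)))"
      by (rule sum.cong[OF refl summand])
    also have "\<dots> = (\<Sum>Y\<in>?Y. int (marked_count n (rev ?L) (Y n)))"
      by (rule sum.reindex_bij_betw[OF bij])
    also have "\<dots> = int (strip_count n (rev ?L) ?p)"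
      by (simp only: marked_count_chains[OF bv] of_nat_sum[symmetric])
    \<comment> \<open>The shifted side lists the multiplicities from the largest letter, the skew
      side from the smallest; the symmetry of \<open>strip_count\<close> reconciles them.\<close>
    also have "\<dots> = skew_schur (staircase n) \<mu> m"
      by (simp only: strip_count_rev[OF bv] skew_schur_coefficient[OF mu(1) K])
    finally show ?thesis unfolding apply_sum by simp
  qed
qed

text \<open>Grouping the summands by shape makes each coefficient the number of tableaux of that
  shape.\<close>

lemma schur_P_nonneg_sum:
  assumes "finite C" "\<And>\<nu> U. (\<nu>, U) \<in> C \<Longrightarrow> strict_partition \<nu>"
  shows "schur_P_nonneg (\<Sum>(\<nu>, U)\<in>C. schur_P \<nu>)"
  unfolding schur_P_nonneg_def
proof (intro exI conjI)
  let ?a = "\<lambda>l. int (card {x \<in> C. fst x = l})"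
  show "finite (fst ` C)" using assms(1) by simp
  show "\<forall>l\<in>fst ` C. strict_partition l \<and> 0 \<le> ?a l" using assms(2) by auto
  have "(\<Sum>(\<nu>, U)\<in>C. schur_P \<nu>) = (\<Sum>x\<in>C. schur_P (fst x))" by (simp add: split_def)
  also have "\<dots> = (\<Sum>l\<in>fst ` C. \<Sum>x\<in>{x \<in> C. fst x = l}. schur_P (fst x))"
    by (rule sum.image_gen[OF assms(1)])
  also have "\<dots> = (\<Sum>l\<in>fst ` C. (\<lambda>m. ?a l * schur_P l m))"
  proof (rule sum.cong[OF refl])
    fix l
    have const: "(\<Sum>x\<in>A. schur_P l) m = int (card A) * schur_P l m" if "finite A" for A :: "'a set" and m
      using that by (induction rule: finite_induct) (auto simp: algebra_simps)
    have "(\<Sum>x\<in>{x \<in> C. fst x = l}. schur_P (fst x)) = (\<Sum>x\<in>{x \<in> C. fst x = l}. schur_P l)"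
      by (rule sum.cong) auto
    then show "(\<Sum>x\<in>{x \<in> C. fst x = l}. schur_P (fst x)) = (\<lambda>m. ?a l * schur_P l m)"
      using const assms(1) by (intro ext) (simp add: algebra_simps)
  qed
  finally show "(\<Sum>(\<nu>, U)\<in>C. schur_P \<nu>) = (\<Sum>l\<in>fst ` C. (\<lambda>m. ?a l * schur_P l m))" .
qed

theorem theorem4p10:
  fixes n :: nat and \<mu> :: "nat list"
  assumes "n \<ge> 1"
    and "is_partition \<mu>"
    and "diagram \<mu> \<subseteq> diagram (staircase n)"
  shows "schur_P_nonneg (skew_schur (staircase n) \<mu>) \<and>
    skew_schur (staircase n) \<mu> = (\<Sum>(\<nu>, U)\<in>CompShSYT (staircase n) \<mu>. schur_P \<nu>)"
  using skew_schur_eq[OF assms(2,3)] schur_P_nonneg_sum[OF finite_CompShSYT, of "staircase n" \<mu>]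
    CompShSYT_iff[OF assms(2,3)] by auto

end
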